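(* Let $k$ be a positive integer, let $G$ be a balanced bipartite graph of order $2n$ with partite sets $X$ and $Y$, and let $M$ be a perfect matching of $G$, where $n \ge 12k+3$. If $\sigma_{1,1}(G) \ge n+2$, then $G$ has a $2$-factor consisting of exactly $k$ cycles, each of length at least $6$, which contains every edge of $M$.
   Context: Graphs are finite and simple. For a bipartite graph $G$ with partite sets $X,Y$, $\sigma_{1,1}(G) = \min\{d_G(x)+d_G(y) : x \in X,\ y \in Y,\ xy \notin E(G)\}$ if $G$ is not complete bipartite, and $\sigma_{1,1}(G)=+\infty$ otherwise. A $2$-factor is a spanning subgraph in which every component is a cycle. *)

theory Defs
  imports Main "HOL-Library.Extended_Nat"
begin

definition bipartite_graph :: "'a set \<Rightarrow> 'a set \<Rightarrow> 'a set set \<Rightarrow> bool" where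
  "bipartite_graph X Y E \<longleftrightarrow> finite X \<and> finite Y \<and> X \<inter> Y = {} \<and>
     (\<forall>e\<in>E. \<exists>x\<in>X. \<exists>y\<in>Y. e = {x, y})"

definition degree :: "'a set set \<Rightarrow> 'a \<Rightarrow> nat" where
  "degree E v = card {e \<in> E. v \<in> e}"

definition sigma11 :: "'a set \<Rightarrow> 'a set \<Rightarrow> 'a set set \<Rightarrow> enat" where
  "sigma11 X Y E =
     (if (\<forall>x\<in>X. \<forall>y\<in>Y. {x, y} \<in> E) then \<infinity>
      else enat (Min {degree E x + degree E y | x y. x \<in> X \<and> y \<in> Y \<and> {x, y} \<notin> E}))"

definition perfect_matching :: "'a set \<Rightarrow> 'a set set \<Rightarrow> 'a set set \<Rightarrow> bool" where
  "perfect_matching V E M \<longleftrightarrow> M \<subseteq> E \<and> (\<forall>v\<in>V. \<exists>!e. e \<in> M \<and> v \<in> e)"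

definition cycle_edges :: "'a list \<Rightarrow> 'a set set" where
  "cycle_edges c = {{c ! i, c ! ((i + 1) mod length c)} | i. i < length c}"

definition is_cycle :: "'a set set \<Rightarrow> 'a list \<Rightarrow> bool" where
  "is_cycle E c \<longleftrightarrow> distinct c \<and> length c \<ge> 3 \<and> cycle_edges c \<subseteq> E"

definition two_factor :: "'a set \<Rightarrow> 'a set set \<Rightarrow> 'a list list \<Rightarrow> bool" where
  "two_factor V E Cs \<longleftrightarrow> (\<forall>c\<in>set Cs. is_cycle E c) \<and>
     (\<forall>i<length Cs. \<forall>j<length Cs. i \<noteq> j \<longrightarrow> set (Cs ! i) \<inter> set (Cs ! j) = {}) \<and>
     (\<Union>c\<in>set Cs. set c) = V"

end

theory Submission
  imports Defs
begin

text \<open>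
  Contracting every edge of \<open>M\<close> turns \<open>G\<close> into a digraph on \<open>n\<close> vertices in which
  \<open>outdeg x + indeg y \<ge> n\<close> whenever there is no arc from \<open>x\<close> to \<open>y\<close>, and a directed cycle of length
  \<open>l\<close> into an alternating cycle of length \<open>2 l\<close>. So the digraph has to be partitioned into \<open>k\<close> directed
  cycles of length at least 3.

  The vertices of total degree less than \<open>n\<close> form a path when sorted by out-degree. Closing it up by
  a short return path, and choosing \<open>k - 1\<close> disjoint cycles of length at most 4 that avoid the ends
  and the return path, gives \<open>k\<close> disjoint cycles covering all these vertices. Enlarge this family
  until no family of \<open>k\<close> cycles has a strictly larger vertex set, and suppose that a set \<open>H\<close> of
  vertices remains. Then \<open>H\<close> is Hamiltonian, no cycle of the family can be rerouted through
  \<open>H\<close>, and since all vertices of \<open>H\<close> have total degree at least \<open>n\<close>, it follows that \<open>H\<close> has just two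
  vertices, and that every cycle of the family either receives all arcs from \<open>H\<close> and sends none
  back, or the other way round. Bounding the number of arcs between cycles of these
  two kinds contradicts the degree condition when \<open>n \<ge> 12 k + 3\<close>.
\<close>

section \<open>Directed cycles and families of disjoint cycles\<close>

text \<open>A vertex fits into a cycle if its total degree towards the cycle exceeds the length, but
  the degree condition says nothing about a single vertex, so a vertex of small total degree may
  resist every insertion. Such vertices are therefore covered before the enlarging starts; it only
  ever increases the covered set, so they stay covered even though the cycles change. For the
  vertices of \<open>H\<close>, whose degree is large, the inequalities that express failed
  insertions are nearly tight, and this tightness is the source of the structure. The obstacle
  compared with Woodall's theorem is the minimum length 3: rerouting may leave a cycle on two
  vertices only, so one exceptional configuration survives, a vertex of a cycle joined in both
  directions to one vertex of \<open>H\<close>. Statements come with their mirror image under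
  reversal of all arcs, and the final contradiction uses that reversal exchanges the two kinds of
  cycles. The coefficient 12 comes from the final count: if the kind with the larger total size has
  \<open>a\<close> vertices, then \<open>a + 2 <= 6 * k\<close>, although \<open>2 * a\<close> is at
  least the order minus 2, hence at least \<open>12 * k + 1\<close>.\<close>

definition dipath :: "('a \<Rightarrow> 'a \<Rightarrow> bool) \<Rightarrow> 'a list \<Rightarrow> bool" where
  "dipath E xs \<longleftrightarrow> xs \<noteq> [] \<and> distinct xs \<and> successively E xs"

text \<open>A single vertex counts as a cycle; this is the start of the extension process behind
  Woodall's theorem.\<close>

definition dicyc :: "('a \<Rightarrow> 'a \<Rightarrow> bool) \<Rightarrow> 'a list \<Rightarrow> bool" where
  "dicyc E xs \<longleftrightarrow> dipath E xs \<and> (length xs = 1 \<or> E (last xs) (hd xs))"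

lemma dipath_append:
  assumes "A \<noteq> []" "B \<noteq> []"
  shows "dipath E (A @ B) \<longleftrightarrow>
    dipath E A \<and> dipath E B \<and> set A \<inter> set B = {} \<and> E (last A) (hd B)"
  using assms by (auto simp: dipath_def successively_append_iff)

lemma dipath_single [simp]: "dipath E [x]"
  by (simp add: dipath_def)

lemma dicyc_single [simp]: "dicyc E [x]"
  by (simp add: dicyc_def)

lemma dicyc_dipath: "dicyc E xs \<Longrightarrow> dipath E xs"
  by (simp add: dicyc_def)

lemma dipath_nonempty: "dipath E xs \<Longrightarrow> xs \<noteq> []"
  by (simp add: dipath_def)

lemma dipath_distinct: "dipath E xs \<Longrightarrow> distinct xs"
  by (simp add: dipath_def)

lemma dicyc_appendI:
  assumes "dipath E A" "dipath E B" "set A \<inter> set B = {}" "E (last A) (hd B)" "E (last B) (hd A)"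
  shows "dicyc E (A @ B)"
proof -
  have "A \<noteq> []" "B \<noteq> []" using assms(1,2) by (auto simp: dipath_def)
  with assms show ?thesis by (simp add: dicyc_def dipath_append)
qed

lemma dicyc_appendD:
  assumes "dicyc E (A @ B)" "A \<noteq> []" "B \<noteq> []"
  shows "dipath E A" "dipath E B" "set A \<inter> set B = {}" "E (last A) (hd B)" "E (last B) (hd A)"
proof -
  have "length (A @ B) \<noteq> 1" using assms(2,3) by (cases A; cases B) auto
  with assms show "dipath E A" "dipath E B" "set A \<inter> set B = {}" "E (last A) (hd B)" "E (last B) (hd A)"
    by (auto simp: dicyc_def dipath_append)
qed

lemma dicyc_swap: "dicyc E (A @ B) \<Longrightarrow> dicyc E (B @ A)"
proof (cases "A = [] \<or> B = []")
  case False
  then show "dicyc E (A @ B) \<Longrightarrow> dicyc E (B @ A)"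
    using dicyc_appendD[of E A B] by (intro dicyc_appendI) auto
qed auto

lemma dipath_rev: "dipath (\<lambda>x y. E y x) (rev xs) \<longleftrightarrow> dipath E xs"
  by (simp add: dipath_def)

lemma dicyc_rev: "dicyc (\<lambda>x y. E y x) (rev xs) \<longleftrightarrow> dicyc E xs"
  by (cases "xs = []") (auto simp: dicyc_def dipath_rev last_rev hd_rev dipath_def)

definition hcyc :: "('a \<Rightarrow> 'a \<Rightarrow> bool) \<Rightarrow> 'a set \<Rightarrow> bool" where
  "hcyc E C \<longleftrightarrow> (\<exists>xs. dicyc E xs \<and> set xs = C)"

lemma hcyc_rev: "hcyc (\<lambda>x y. E y x) C \<longleftrightarrow> hcyc E C"
  unfolding hcyc_def by (metis dicyc_rev rev_rev_ident set_rev)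

lemma hcyc_finite: "hcyc E C \<Longrightarrow> finite C"
  by (auto simp: hcyc_def)

lemma dicyc_card: "dicyc E xs \<Longrightarrow> card (set xs) = length xs"
  by (simp add: dicyc_def dipath_def distinct_card)

lemma dipath_card: "dipath E xs \<Longrightarrow> card (set xs) = length xs"
  by (simp add: dipath_def distinct_card)

text \<open>Degrees are relative to a set so that they add up over disjoint sets. The in-degree
  \<open>ind\<close> is the out-degree of the reversed relation, so facts about \<open>outd\<close>
  serve for both.\<close>

definition outd :: "('a \<Rightarrow> 'a \<Rightarrow> bool) \<Rightarrow> 'a set \<Rightarrow> 'a \<Rightarrow> nat" where
  "outd E S x = card {y \<in> S. E x y}"

abbreviation ind :: "('a \<Rightarrow> 'a \<Rightarrow> bool) \<Rightarrow> 'a set \<Rightarrow> 'a \<Rightarrow> nat" where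
  "ind E \<equiv> outd (\<lambda>x y. E y x)"

lemma outd_le: "finite S \<Longrightarrow> outd E S x \<le> card S"
  by (auto simp: outd_def intro: card_mono)

lemma outd_mono: "finite T \<Longrightarrow> S \<subseteq> T \<Longrightarrow> outd E S x \<le> outd E T x"
  by (auto simp: outd_def intro!: card_mono)

lemma outd_Un:
  assumes "finite S" "finite T" "S \<inter> T = {}"
  shows "outd E (S \<union> T) x = outd E S x + outd E T x"
proof -
  have "{y \<in> S \<union> T. E x y} = {y \<in> S. E x y} \<union> {y \<in> T. E x y}" by auto
  with assms show ?thesis by (auto simp: outd_def intro!: card_Un_disjoint)
qed

lemma outd_split: "finite T \<Longrightarrow> S \<subseteq> T \<Longrightarrow> outd E T x = outd E S x + outd E (T - S) x"
  using outd_Un[of S "T - S" E x] by (simp add: Un_absorb1 finite_subset)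

lemma outd_le_notin: "finite S \<Longrightarrow> x \<in> S \<Longrightarrow> \<not> E x x \<Longrightarrow> outd E S x \<le> card S - 1"
proof -
  assume "finite S" "x \<in> S" "\<not> E x x"
  then have "{y \<in> S. E x y} \<subseteq> S - {x}" by auto
  then have "outd E S x \<le> card (S - {x})" using \<open>finite S\<close> by (auto simp: outd_def intro!: card_mono)
  then show ?thesis using \<open>x \<in> S\<close> \<open>finite S\<close> by simp
qed

lemma outd_zero: "(\<And>y. y \<in> S \<Longrightarrow> \<not> E x y) \<Longrightarrow> outd E S x = 0"
proof -
  assume "\<And>y. y \<in> S \<Longrightarrow> \<not> E x y"
  then have "{y \<in> S. E x y} = {}" by auto
  then show ?thesis by (simp only: outd_def card.empty)
qed

lemma outd_UN:
  assumes "finite F" "\<And>C. C \<in> F \<Longrightarrow> finite C" "pairwise disjnt F"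
  shows "outd E (\<Union>F) x = (\<Sum>C\<in>F. outd E C x)"
  using assms
proof (induction F rule: finite_induct)
  case empty then show ?case by (simp add: outd_def)
next
  case (insert C F)
  have "C \<inter> D = {}" if "D \<in> F" for D
    using that insert.prems(2) insert.hyps(2) by (auto simp: pairwise_insert disjnt_def)
  then have "C \<inter> \<Union>F = {}" by blast
  moreover have "pairwise disjnt F" using insert.prems(2) by (auto simp: pairwise_def)
  ultimately show ?case using insert by (simp add: outd_Un)
qed

text \<open>Families of disjoint cycles are represented by their vertex sets.\<close>

definition fam :: "('a \<Rightarrow> 'a \<Rightarrow> bool) \<Rightarrow> nat \<Rightarrow> 'a set set \<Rightarrow> bool" where
  "fam E m F \<longleftrightarrow> finite F \<and> pairwise disjnt F \<and> (\<forall>C\<in>F. m \<le> card C \<and> hcyc E C)"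

lemma fam_rev: "fam (\<lambda>x y. E y x) m F \<longleftrightarrow> fam E m F"
  using hcyc_rev[of E] by (simp add: fam_def)

lemma fam_cyc_finite: "fam E m F \<Longrightarrow> C \<in> F \<Longrightarrow> finite C"
  unfolding fam_def using hcyc_finite by blast

lemma fam_finite: "fam E m F \<Longrightarrow> finite (\<Union>F)"
  using fam_cyc_finite[of E m F] by (auto simp: fam_def)

lemma fam_subset: "fam E m F \<Longrightarrow> G \<subseteq> F \<Longrightarrow> fam E m G"
  unfolding fam_def by (meson finite_subset pairwise_subset subsetD)

lemma fam_card_Union: "fam E m F \<Longrightarrow> card (\<Union>F) = (\<Sum>C\<in>F. card C)"
  using fam_cyc_finite[of E m F] by (simp add: fam_def card_Union_disjoint)

lemma fam_outd: "fam E m F \<Longrightarrow> outd E' (\<Union>F) x = (\<Sum>C\<in>F. outd E' C x)"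
  using fam_cyc_finite[of E m F] by (simp add: fam_def outd_UN)

lemma fam_empty [simp]: "fam E m {}"
  by (simp add: fam_def)

lemma hcyc_nonempty: "hcyc E C \<Longrightarrow> C \<noteq> {}"
  by (auto simp: hcyc_def dicyc_def dipath_def)

lemma fam_insert:
  assumes "fam E m F" "dicyc E xs" "m \<le> length xs" "set xs \<inter> \<Union>F = {}"
  shows "fam E m (insert (set xs) F)" "card (insert (set xs) F) = Suc (card F)"
    "\<Union>(insert (set xs) F) = set xs \<union> \<Union>F"
proof -
  have "set xs \<noteq> {}" using assms(2) by (auto simp: dicyc_def dipath_def)
  have d: "set xs \<inter> D = {}" if "D \<in> F" for D using assms(4) that by auto
  have "set xs \<notin> F" using d[of "set xs"] \<open>set xs \<noteq> {}\<close> by auto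
  moreover have "hcyc E (set xs)" using assms(2) by (auto simp: hcyc_def)
  moreover have "pairwise disjnt (insert (set xs) F)"
    using assms(1) d by (simp add: fam_def pairwise_insert disjnt_def Int_commute)
  ultimately show "fam E m (insert (set xs) F)" "card (insert (set xs) F) = Suc (card F)"
    using assms(1,3) dicyc_card[OF assms(2)] by (simp_all add: fam_def)
qed auto

lemma fam_remove:
  assumes "fam E m F" "C \<in> F"
  shows "fam E m (F - {C})" "card F = Suc (card (F - {C}))" "\<Union>(F - {C}) = \<Union>F - C"
    "C \<subseteq> \<Union>F"
proof -
  show "fam E m (F - {C})" using assms fam_subset by blast
  show "card F = Suc (card (F - {C}))" using assms unfolding fam_def by (metis card.remove)
  have "\<And>D. D \<in> F \<Longrightarrow> D \<noteq> C \<Longrightarrow> D \<inter> C = {}"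
    using assms by (auto simp: fam_def pairwise_def disjnt_def)
  then show "\<Union>(F - {C}) = \<Union>F - C" by blast
  show "C \<subseteq> \<Union>F" using assms by auto
qed

lemma fam_disj: "fam E m F \<Longrightarrow> C \<in> F \<Longrightarrow> C' \<in> F \<Longrightarrow> C \<noteq> C' \<Longrightarrow> C \<inter> C' = {}"
  by (auto simp: fam_def pairwise_def disjnt_def)

text \<open>\<open>nx\<close> is the successor map of the cycle; the list merely fixes a starting
  point, which \<open>cyc_next_swap\<close> moves. Pigeonhole arguments are phrased with
  \<open>nx\<close>, free of that choice.\<close>

definition cyc_next :: "('a \<Rightarrow> 'a \<Rightarrow> bool) \<Rightarrow> ('a \<Rightarrow> 'a) \<Rightarrow> 'a set \<Rightarrow> 'a list \<Rightarrow> bool" where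
  "cyc_next E nx C xs \<longleftrightarrow> dicyc E xs \<and> set xs = C \<and> map nx xs = rotate1 xs"

lemma cyc_next_swap: "cyc_next E nx C (A @ B) \<Longrightarrow> cyc_next E nx C (B @ A)"
proof (induction A arbitrary: B)
  case Nil then show ?case by simp
next
  case (Cons a A)
  have 1: "cyc_next E nx C (a # (A @ B))" using Cons.prems by simp
  have "dicyc E ((A @ B) @ [a])" using 1 dicyc_swap[of E "[a]" "A @ B"] by (simp add: cyc_next_def)
  moreover have "map nx ((A @ B) @ [a]) = rotate1 ((A @ B) @ [a])"
  proof -
    have "map nx (rotate1 (a # (A @ B))) = rotate1 (map nx (a # (A @ B)))"
      by (simp add: rotate1_map)
    also have "\<dots> = rotate1 (rotate1 (a # (A @ B)))" using 1 by (simp add: cyc_next_def)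
    finally show ?thesis by simp
  qed
  ultimately have "cyc_next E nx C (A @ (B @ [a]))" using 1 by (auto simp: cyc_next_def)
  then show ?case using Cons.IH[of "B @ [a]"] by simp
qed

lemma cyc_next_last:
  assumes "cyc_next E nx C xs" shows "nx (last xs) = hd xs"
proof -
  have ne: "xs \<noteq> []" using assms by (auto simp: cyc_next_def dicyc_def dipath_def)
  have "nx (last xs) = last (map nx xs)" using ne by (simp add: last_map)
  also have "\<dots> = last (rotate1 xs)" using assms by (simp add: cyc_next_def)
  also have "\<dots> = hd xs" using ne by (cases xs) auto
  finally show ?thesis .
qed

lemma cyc_next_append:
  assumes "cyc_next E nx C (A @ B)" "A \<noteq> []" "B \<noteq> []"
  shows "nx (last A) = hd B" "nx (last B) = hd A"
  using cyc_next_last[OF assms(1)] cyc_next_last[OF cyc_next_swap[OF assms(1)]] assms(2,3)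
  by auto

lemma cyc_next_at:
  assumes "cyc_next E nx C xs" "z \<in> C"
  obtains ys where "cyc_next E nx C ys" "last ys = z" "hd ys = nx z"
proof -
  obtain A B where "xs = A @ z # B" using assms by (auto simp: cyc_next_def in_set_conv_decomp)
  then have "cyc_next E nx C ((A @ [z]) @ B)" using assms by simp
  then have "cyc_next E nx C (B @ A @ [z])" by (rule cyc_next_swap)
  then show ?thesis using that[of "B @ A @ [z]"] cyc_next_last[of E nx C "B @ A @ [z]"] by auto
qed

lemma cyc_next_bij:
  assumes "cyc_next E nx C xs" shows "nx ` C = C" "inj_on nx C"
proof -
  have "set (map nx xs) = C" using assms by (simp add: cyc_next_def)
  then show "nx ` C = C" using assms by (auto simp: cyc_next_def)
  have "distinct (map nx xs)" using assms by (simp add: cyc_next_def dicyc_def dipath_def)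
  then show "inj_on nx C" using assms by (auto simp: distinct_map cyc_next_def)
qed

lemma cyc_next_exists:
  assumes "distinct xs"
  shows "\<exists>nx. map nx xs = rotate1 xs"
proof -
  let ?nx = "\<lambda>z. the (map_of (zip xs (rotate1 xs)) z)"
  have "map ?nx xs = rotate1 xs"
    using assms by (intro nth_equalityI) (auto simp: map_of_zip_nth)
  then show ?thesis by blast
qed

text \<open>One map serves all cycles because they are disjoint: each vertex uses the map of its own
  cycle. This allows pigeonhole counts over the whole covered set.\<close>

lemma fam_next:
  assumes "fam E m F"
  obtains nx where "\<And>C. C \<in> F \<Longrightarrow> \<exists>xs. cyc_next E nx C xs"
proof -
  have "\<forall>C\<in>F. \<exists>nx xs. cyc_next E nx C xs"
  proof
    fix C assume "C \<in> F"
    then obtain xs where xs: "dicyc E xs" "set xs = C" using assms by (auto simp: fam_def hcyc_def)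
    obtain nx where "map nx xs = rotate1 xs"
      using cyc_next_exists[of xs] xs by (auto simp: dicyc_def dipath_def)
    then show "\<exists>nx xs. cyc_next E nx C xs" using xs by (auto simp: cyc_next_def)
  qed
  then obtain g where g: "\<And>C. C \<in> F \<Longrightarrow> \<exists>xs. cyc_next E (g C) C xs" by metis
  define nx where "nx z = g (THE C. C \<in> F \<and> z \<in> C) z" for z
  have "\<exists>xs. cyc_next E nx C xs" if C: "C \<in> F" for C
  proof -
    obtain xs where xs: "cyc_next E (g C) C xs" using g C by auto
    have "nx z = g C z" if "z \<in> C" for z
    proof -
      have "(THE C. C \<in> F \<and> z \<in> C) = C"
        using C that fam_disj[OF assms] by (intro the_equality) auto
      then show ?thesis by (simp add: nx_def)
    qed
    then have "map nx xs = map (g C) xs" using xs by (intro map_cong) (auto simp: cyc_next_def)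
    then have "cyc_next E nx C xs" using xs unfolding cyc_next_def by metis
    then show ?thesis by blast
  qed
  then show ?thesis using that by blast
qed

section \<open>Families of cycles that cannot be enlarged\<close>

lemma fam_replace:
  assumes "fam E m F" "C \<in> F" "dicyc E zs" "m \<le> length zs" "set zs \<inter> (\<Union>F - C) = {}"
  shows "\<exists>F'. fam E m F' \<and> card F' = card F \<and> \<Union>F' = set zs \<union> (\<Union>F - C)"
proof (intro exI conjI)
  note r = fam_remove[OF assms(1,2)]
  show "fam E m (insert (set zs) (F - {C}))"
    by (rule fam_insert(1)[OF r(1) assms(3,4)]) (use assms(5) r(3) in simp)
  show "card (insert (set zs) (F - {C})) = card F"
    using fam_insert(2)[OF r(1) assms(3,4)] assms(5) r by simp
  show "\<Union>(insert (set zs) (F - {C})) = set zs \<union> (\<Union>F - C)"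
    using r(3) by simp
qed

text \<open>Pigeonhole on \<open>C\<close>: the in-neighbours of \<open>u\<close>, shifted by the
  injective map \<open>nx\<close>, must meet the out-neighbours of \<open>v\<close>. A path from
  \<open>u\<close> to \<open>v\<close> then fits between \<open>x\<close> and its successor.\<close>

lemma insert_at:
  assumes cn: "cyc_next E nx C xs" and lt: "card C < ind E C u + outd E C v"
  obtains x where "x \<in> C" "E x u" "E v (nx x)"
proof -
  have fin: "finite C" using cn by (auto simp: cyc_next_def)
  let ?S = "{x \<in> C. E x u}" and ?T = "{y \<in> C. E v y}"
  have "nx ` ?S \<inter> ?T \<noteq> {}"
  proof
    assume e: "nx ` ?S \<inter> ?T = {}"
    have "nx ` ?S \<union> ?T \<subseteq> C" using cyc_next_bij(1)[OF cn] by auto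
    then have "card (nx ` ?S \<union> ?T) \<le> card C" using fin by (intro card_mono)
    moreover have "card (nx ` ?S \<union> ?T) = card (nx ` ?S) + card ?T"
      using e fin by (intro card_Un_disjoint) auto
    moreover have "card (nx ` ?S) = card ?S"
      using cyc_next_bij(2)[OF cn] by (intro card_image) (auto intro: inj_on_subset)
    ultimately show False using lt by (simp add: outd_def)
  qed
  then show ?thesis using that by auto
qed

lemma insert_place:
  assumes "dicyc E xs" "set xs = C" "card C < ind E C u + outd E C v"
  obtains ys where "dicyc E ys" "set ys = C" "E (last ys) u" "E v (hd ys)"
proof -
  obtain nx where "map nx xs = rotate1 xs"
    using cyc_next_exists[of xs] assms by (auto simp: dicyc_def dipath_def)
  then have cn: "cyc_next E nx C xs" using assms by (simp add: cyc_next_def)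
  obtain x where x: "x \<in> C" "E x u" "E v (nx x)" by (rule insert_at[OF cn assms(3)])
  obtain ys where "cyc_next E nx C ys" "last ys = x" "hd ys = nx x" by (rule cyc_next_at[OF cn x(1)])
  then show ?thesis using that[of ys] x by (auto simp: cyc_next_def)
qed

lemma fam_extend_path:
  assumes "fam E m F" "C \<in> F" "dipath E P" "set P \<inter> \<Union>F = {}"
    and "card C < ind E C (hd P) + outd E C (last P)"
  shows "\<exists>F'. fam E m F' \<and> card F' = card F \<and> \<Union>F' = \<Union>F \<union> set P"
proof -
  obtain xs where "dicyc E xs" "set xs = C" using assms(1,2) by (auto simp: fam_def hcyc_def)
  then obtain ys where ys: "dicyc E ys" "set ys = C" "E (last ys) (hd P)" "E (last P) (hd ys)"
    by (rule insert_place[OF _ _ assms(5)])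
  have sub: "C \<subseteq> \<Union>F" using assms(2) by auto
  have "dicyc E (ys @ P)"
    using dicyc_appendI[OF dicyc_dipath[OF ys(1)] assms(3)] ys assms(4) sub by blast
  moreover have "m \<le> length (ys @ P)"
    using assms(1,2) ys dicyc_card[OF ys(1)] by (auto simp: fam_def)
  moreover have "set (ys @ P) \<inter> (\<Union>F - C) = {}" using ys(2) assms(4) by auto
  ultimately obtain F' where F': "fam E m F'" "card F' = card F"
    "\<Union>F' = set (ys @ P) \<union> (\<Union>F - C)"
    using fam_replace[OF assms(1,2)] by blast
  have "set (ys @ P) \<union> (\<Union>F - C) = \<Union>F \<union> set P" using ys(2) sub by auto
  then show ?thesis using F' by blast
qed

text \<open>An excess over the whole family forces an excess on some single cycle, into which
  \<open>s\<close> is inserted.\<close>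

lemma fam_extend_vertex:
  assumes "fam E m F" "s \<notin> \<Union>F" "card (\<Union>F) < outd E (\<Union>F) s + ind E (\<Union>F) s"
  shows "\<exists>F'. fam E m F' \<and> card F' = card F \<and> \<Union>F' = insert s (\<Union>F)"
proof -
  have "(\<Sum>C\<in>F. card C) < (\<Sum>C\<in>F. ind E C s + outd E C s)"
    using assms(3) by (simp add: fam_card_Union[OF assms(1)] fam_outd[OF assms(1)] sum.distrib)
  then obtain C where "C \<in> F" "card C < ind E C s + outd E C s"
    by (meson not_le sum_mono)
  then show ?thesis using fam_extend_path[OF assms(1), of C "[s]"] assms(2) by auto
qed

section \<open>Paths inside a vertex set\<close>

lemma rtrancl_dipath:
  assumes "(u, v) \<in> {(x, y). x \<in> H \<and> y \<in> H \<and> E x y}\<^sup>*" "u \<in> H"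
  shows "\<exists>P. dipath E P \<and> set P \<subseteq> H \<and> hd P = u \<and> last P = v"
  using assms(1)
proof (induction rule: rtrancl_induct)
  case base
  then show ?case using assms(2) by (intro exI[of _ "[u]"]) auto
next
  case (step y z)
  then obtain P where P: "dipath E P" "set P \<subseteq> H" "hd P = u" "last P = y" by auto
  have ne: "P \<noteq> []" using P(1) by (rule dipath_nonempty)
  show ?case
  proof (cases "z \<in> set P")
    case True
    then obtain A B where AB: "P = (A @ [z]) @ B" by (auto simp: in_set_conv_decomp)
    have "dipath E (A @ [z])"
    proof (cases "B = []")
      case False
      then show ?thesis using P(1) dipath_append[of "A @ [z]" B E] unfolding AB by simp
    qed (use P(1) AB in simp)
    then show ?thesis using P AB by (intro exI[of _ "A @ [z]"]) (cases A; auto)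
  next
    case False
    have "dipath E (P @ [z])" using P step.hyps ne False by (auto simp: dipath_append)
    then show ?thesis using P step.hyps ne by (intro exI[of _ "P @ [z]"]) auto
  qed
qed

text \<open>A shortest path has no shortcuts at its ends: a further out-neighbour of
  \<open>u\<close> or in-neighbour of \<open>v\<close> on it would shorten it. The bounds control
  the degrees of the ends in \<open>bypass\<close>.\<close>

lemma shortest_dipath:
  assumes "\<exists>P. dipath E P \<and> set P \<subseteq> H \<and> hd P = u \<and> last P = v" "\<And>x. \<not> E x x"
  obtains P where "dipath E P" "set P \<subseteq> H" "hd P = u" "last P = v"
    "outd E (set P) u \<le> (if length P \<ge> 2 then 1 else 0)"
    "ind E (set P) v \<le> (if length P \<ge> 2 then 1 else 0)"
proof -
  let ?Q = "\<lambda>P. dipath E P \<and> set P \<subseteq> H \<and> hd P = u \<and> last P = v"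
  obtain P where P: "?Q P" and min: "\<And>P'. ?Q P' \<Longrightarrow> length P \<le> length P'"
    using exists_least_iff[of "\<lambda>n. \<exists>P. ?Q P \<and> length P = n"] assms(1)
    by (metis (no_types, lifting) not_le)
  have ne: "P \<noteq> []" using P by (auto simp: dipath_def)
  have out: "y = P ! 1" if "y \<in> set P" "E u y" for y
  proof (rule ccontr)
    assume y: "y \<noteq> P ! 1"
    obtain A B where AB: "P = A @ y # B" using \<open>y \<in> set P\<close> by (auto simp: in_set_conv_decomp)
    have "A \<noteq> []" using AB P that(2) assms(2) by auto
    moreover have "length A \<noteq> 1" using AB y by (auto simp: nth_append)
    ultimately have l: "length A \<ge> 2" by (cases A) (auto simp: Suc_le_eq)
    have "dipath E (y # B)" "u \<notin> set (y # B)"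
      using P dipath_append[of A "y # B" E] \<open>A \<noteq> []\<close> unfolding AB by (auto dest: hd_in_set)
    then have "?Q (u # y # B)"
      using P that(2) AB ne \<open>A \<noteq> []\<close> hd_in_set[of P] dipath_append[of "[u]" "y # B" E] by auto
    from min[OF this] show False using AB l by simp
  qed
  have inn: "y = P ! (length P - 2)" if "y \<in> set P" "E y v" for y
  proof (rule ccontr)
    assume y: "y \<noteq> P ! (length P - 2)"
    obtain A B where AB: "P = (A @ [y]) @ B" using \<open>y \<in> set P\<close> by (auto simp: in_set_conv_decomp)
    have "B \<noteq> []" using AB P that(2) assms(2) by auto
    moreover have "length B \<noteq> 1" using AB y by (auto simp: nth_append)
    ultimately have l: "length B \<ge> 2" by (cases B) (auto simp: Suc_le_eq)
    have "dipath E (A @ [y])" "v \<notin> set (A @ [y])"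
      using P dipath_append[of "A @ [y]" B E] \<open>B \<noteq> []\<close> unfolding AB by (auto dest: last_in_set)
    then have "?Q ((A @ [y]) @ [v])"
      using P that(2) AB ne \<open>B \<noteq> []\<close> last_in_set[of P] dipath_append[of "A @ [y]" "[v]" E]
      by (cases A) auto
    from min[OF this] show False using AB l by simp
  qed
  have "outd E (set P) u \<le> card {P ! 1}" unfolding outd_def using out by (intro card_mono) auto
  moreover have "ind E (set P) v \<le> card {P ! (length P - 2)}"
    unfolding outd_def using inn by (intro card_mono) auto
  moreover have "outd E (set P) u = 0 \<and> ind E (set P) v = 0" if "\<not> length P \<ge> 2"
  proof -
    have "length P = 1" using that ne by (cases P) (auto simp: not_le)
    then have "P = [u]" "u = v" using P by (auto simp: length_Suc_conv)
    then show ?thesis using assms(2) by (auto intro!: outd_zero)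
  qed
  ultimately show ?thesis using P that[of P] by auto
qed

text \<open>This is Woodall's condition for a Hamiltonian directed cycle. Contraction of the
  matching lowers each degree by one, so \<open>n + 2\<close> in the graph becomes \<open>n\<close>
  here.\<close>

definition ore :: "('a \<Rightarrow> 'a \<Rightarrow> bool) \<Rightarrow> 'a set \<Rightarrow> bool" where
  "ore E V \<longleftrightarrow> finite V \<and> (\<forall>x. \<not> E x x) \<and>
    (\<forall>x\<in>V. \<forall>y\<in>V. x \<noteq> y \<longrightarrow> \<not> E x y \<longrightarrow> card V \<le> outd E V x + ind E V y)"

lemma ore_rev: "ore (\<lambda>x y. E y x) V \<longleftrightarrow> ore E V"
  by (auto simp: ore_def add.commute)

text \<open>Maximality concerns the covered vertex set only; the cycles may be changed freely as
  long as their number is kept. The value 1 of \<open>m\<close> serves Woodall's theorem, the value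
  3 the cycle factor.\<close>

locale stuck =
  fixes E :: "'a \<Rightarrow> 'a \<Rightarrow> bool" and V :: "'a set" and m :: nat and F :: "'a set set"
  assumes ore: "ore E V" and fam: "fam E m F" and sub: "\<Union>F \<subseteq> V" and proper: "\<Union>F \<noteq> V"
    and m3: "m \<le> 3"
    and maximal: "\<And>F'. fam E m F' \<Longrightarrow> card F' = card F \<Longrightarrow> \<Union>F \<subset> \<Union>F' \<Longrightarrow> \<not> \<Union>F' \<subseteq> V"
begin

section \<open>Covered and uncovered vertices of a family that cannot be enlarged\<close>

definition "W = \<Union>F"
definition "H = V - W"

lemma W_sub: "W \<subseteq> V" and WH: "W \<inter> H = {}" "W \<union> H = V" and H_ne: "H \<noteq> {}"
  using sub proper by (auto simp: W_def H_def)

lemma finV: "finite V" and irrefl: "\<not> E x x"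
  using ore by (auto simp: ore_def)

lemma finW: "finite W" and finH: "finite H"
  using finV W_sub by (auto simp: H_def intro: finite_subset)

lemma oreD: "x \<in> V \<Longrightarrow> y \<in> V \<Longrightarrow> x \<noteq> y \<Longrightarrow> \<not> E x y \<Longrightarrow> card V \<le> outd E V x + ind E V y"
  using ore by (auto simp: ore_def)

lemma card_V: "card V = card W + card H"
  using card_Un_disjoint[OF finW finH WH(1)] WH(2) by simp

lemma outd_V: "outd E' V x = outd E' W x + outd E' H x"
  using outd_split[OF finV W_sub] by (simp add: H_def)

lemma stuck_rev: "stuck (\<lambda>x y. E y x) V m F"
proof -
  have "fam (\<lambda>x y. E y x) m F' = fam E m F'" for F' by (rule fam_rev)
  then show ?thesis using ore fam sub proper m3 maximal ore_rev[of E V] by unfold_locales auto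
qed

lemma path_le:
  assumes "C \<in> F" "dipath E P" "set P \<subseteq> H"
  shows "ind E C (hd P) + outd E C (last P) \<le> card C"
proof (rule ccontr)
  assume "\<not> ?thesis"
  then obtain F' where "fam E m F'" "card F' = card F" "\<Union>F' = \<Union>F \<union> set P"
    using fam_extend_path[OF fam assms(1,2)] assms(3) by (auto simp: not_le H_def W_def)
  moreover have "\<Union>F \<subset> \<Union>F \<union> set P"
  proof -
    obtain p where "p \<in> set P" using dipath_nonempty[OF assms(2)] by (meson list.set_sel(1))
    then have "p \<notin> \<Union>F" using assms(3) by (auto simp: H_def W_def)
    then show ?thesis using \<open>p \<in> set P\<close> by blast
  qed
  moreover have "set P \<subseteq> V" using assms(3) WH by auto
  ultimately show False using maximal[of F'] sub by auto
qed

lemma path_le_sub: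
  assumes "G \<subseteq> F" "dipath E P" "set P \<subseteq> H"
  shows "ind E (\<Union>G) (hd P) + outd E (\<Union>G) (last P) \<le> card (\<Union>G)"
proof -
  have G: "fam E m G" using fam assms(1) by (rule fam_subset)
  have "(\<Sum>C\<in>G. ind E C (hd P) + outd E C (last P)) \<le> (\<Sum>C\<in>G. card C)"
    using assms by (intro sum_mono path_le) auto
  then show ?thesis
    by (simp add: fam_card_Union[OF G] fam_outd[OF G] sum.distrib)
qed

text \<open>If \<open>v\<close> is unreachable from \<open>u\<close> inside \<open>H\<close>, the
  descendants of \<open>u\<close> and the ancestors of \<open>v\<close> are disjoint, so there are
  few arcs inside \<open>H\<close> out of \<open>u\<close> and into \<open>v\<close>, and by the Ore
  condition at least \<open>card W + 2\<close> such arcs to and from \<open>W\<close>. This is too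
  many for \<open>path_le_sub\<close>, applied to a path from \<open>v\<close> to \<open>u\<close>
  or, if there is none either, to both single vertices.\<close>

lemma connected:
  assumes "u \<in> H" "v \<in> H"
  shows "\<exists>P. dipath E P \<and> set P \<subseteq> H \<and> hd P = u \<and> last P = v"
proof (rule ccontr)
  let ?R = "{(x, y). x \<in> H \<and> y \<in> H \<and> E x y}"
  have reach: "\<exists>P. dipath E P \<and> set P \<subseteq> H \<and> hd P = x \<and> last P = y"
    if "(x, y) \<in> ?R\<^sup>*" "x \<in> H" for x y using rtrancl_dipath[OF that] .
  have key: "outd E H x + ind E H y + 2 \<le> card H \<and> card V \<le> outd E V x + ind E V y"
    if xy: "x \<in> H" "y \<in> H" "(x, y) \<notin> ?R\<^sup>*" for x y
  proof
    let ?D = "{z \<in> H. (x, z) \<in> ?R\<^sup>*}" and ?A = "{z \<in> H. (z, y) \<in> ?R\<^sup>*}"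
    have "?D \<inter> ?A = {}" using xy(3) by (auto dest: rtrancl_trans)
    then have "card ?D + card ?A = card (?D \<union> ?A)"
      using finH by (subst card_Un_disjoint) auto
    also have "\<dots> \<le> card H" using finH by (intro card_mono) auto
    finally have c: "card ?D + card ?A \<le> card H" .
    have "{z \<in> H. E x z} \<subseteq> ?D - {x}" using xy irrefl by auto
    then have 1: "outd E H x \<le> card (?D - {x})" using finH by (auto simp: outd_def intro!: card_mono)
    have "{z \<in> H. E z y} \<subseteq> ?A - {y}" using xy irrefl by auto
    then have 2: "ind E H y \<le> card (?A - {y})" using finH by (auto simp: outd_def intro!: card_mono)
    have "x \<in> ?D" "y \<in> ?A" using xy by auto
    then have "card (?D - {x}) < card ?D" "card (?A - {y}) < card ?A"
      using finH by (intro psubset_card_mono; auto)+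
    then show "outd E H x + ind E H y + 2 \<le> card H" using 1 2 c by linarith
    have "\<not> E x y" "x \<noteq> y" using xy by auto
    then show "card V \<le> outd E V x + ind E V y" using xy WH by (intro oreD) auto
  qed
  assume no: "\<nexists>P. dipath E P \<and> set P \<subseteq> H \<and> hd P = u \<and> last P = v"
  then have uv: "(u, v) \<notin> ?R\<^sup>*" using reach assms by blast
  note k1 = key[OF assms uv]
  show False
  proof (cases "(v, u) \<in> ?R\<^sup>*")
    case True
    then obtain P where P: "dipath E P" "set P \<subseteq> H" "hd P = v" "last P = u"
      using reach assms by blast
    have "ind E W v + outd E W u \<le> card W" using path_le_sub[of F P] P by (simp add: W_def)
    then show False using k1 by (simp add: outd_V card_V)
  next
    case False
    note k2 = key[OF assms(2,1) False]
    have "ind E W x + outd E W x \<le> card W" if "x \<in> H" for x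
      using path_le_sub[of F "[x]"] that by (simp add: W_def)
    from this[OF assms(1)] this[OF assms(2)] show False
      using k1 k2 by (simp add: outd_V card_V)
  qed
qed

text \<open>The path used runs from \<open>v\<close> to \<open>u\<close>, so the sum bounded here is
  the one that the Ore condition bounds from below for the pair \<open>u\<close>,
  \<open>v\<close>.\<close>

lemma pair_le:
  assumes "G \<subseteq> F" "u \<in> H" "v \<in> H"
  shows "outd E (\<Union>G) u + ind E (\<Union>G) v \<le> card (\<Union>G)"
  using connected[OF assms(3,2)] path_le_sub[OF assms(1)] by force

text \<open>Since \<open>H\<close> is strongly connected, a path from \<open>u\<close> to
  \<open>v\<close> can be spliced in between the last and the first vertex of
  \<open>ys\<close>.\<close>

lemma no_insertion:
  assumes "C \<in> F" "dicyc E ys" "set ys = C" "u \<in> H" "v \<in> H" "E (last ys) u" "E v (hd ys)"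
  shows False
proof -
  obtain P where P: "dipath E P" "set P \<subseteq> H" "hd P = u" "last P = v"
    using connected assms(4,5) by blast
  have CW: "C \<subseteq> W" using assms(1) by (auto simp: W_def)
  have "dicyc E (ys @ P)"
    using dicyc_appendI[OF dicyc_dipath[OF assms(2)] P(1)] P assms CW WH by blast
  moreover have "m \<le> length (ys @ P)"
    using fam assms(1,3) dicyc_card[OF assms(2)] by (auto simp: fam_def)
  moreover have "set (ys @ P) \<inter> (\<Union>F - C) = {}" using assms(3) P(2) by (auto simp: H_def W_def)
  ultimately obtain F' where F': "fam E m F'" "card F' = card F"
    "\<Union>F' = set (ys @ P) \<union> (\<Union>F - C)"
    using fam_replace[OF fam assms(1)] by blast
  have eq: "\<Union>F' = W \<union> set P" using F'(3) assms(3) CW by (auto simp: W_def)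
  obtain p where p: "p \<in> set P" using dipath_nonempty[OF P(1)] by (meson list.set_sel(1))
  have "p \<notin> W" using P(2) WH(1) p by blast
  then have "W \<subset> \<Union>F'" using p unfolding eq by blast
  moreover have "\<Union>F' \<subseteq> V" using P(2) WH(2) unfolding eq by blast
  ultimately show False using maximal[OF F'(1,2)] by (simp add: W_def)
qed

text \<open>A shortest path through \<open>H\<close> replaces \<open>G\<close> in the cycle. The vertices of \<open>G\<close> have no arcs to or
  from \<open>H\<close>, so their degrees are large enough to insert them one at a time afterwards.\<close>

lemma bypass:
  assumes C: "C \<in> F" "dicyc E (R @ G)" "set (R @ G) = C" "R \<noteq> []"
    and w: "w \<in> H" "w' \<in> H" "E (last R) w" "E w' (hd R)"
    and gap: "\<And>s u. s \<in> set G \<Longrightarrow> u \<in> H \<Longrightarrow> \<not> E s u \<and> \<not> E u s"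
    and m: "m \<le> length R + (if w = w' then 1 else 2)"
  shows False
proof -
  obtain P where P: "dipath E P" "set P \<subseteq> H" "hd P = w" "last P = w'"
    and Pout: "outd E (set P) w \<le> (if length P \<ge> 2 then 1 else 0)"
    and Pin: "ind E (set P) w' \<le> (if length P \<ge> 2 then 1 else 0)"
    using shortest_dipath[OF connected[OF w(1,2)] irrefl] by blast
  have CW: "C \<subseteq> W" using C(1) by (auto simp: W_def)
  have finC: "finite C" using finite_subset[OF CW finW] .
  have RG: "set R \<inter> set G = {}" "distinct R" "dipath E R"
  proof -
    have "dipath E (R @ G)" using C(2) by (rule dicyc_dipath)
    then show "set R \<inter> set G = {}" "distinct R" "dipath E R"
      using C(4) by (auto simp: dipath_def successively_append_iff)
  qed
  have dRG: "distinct (R @ G)" using C(2) by (simp add: dicyc_def dipath_def)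
  have P1: "length P \<ge> 1" using dipath_nonempty[OF P(1)] by (cases P) auto
  have P2: "length P \<ge> 2" if "w \<noteq> w'"
  proof (rule ccontr)
    assume "\<not> ?thesis"
    then have "length P = 1" using P1 by simp
    then show False using that P by (auto simp: length_Suc_conv)
  qed
  define S where "S = {x \<in> C. \<exists>u\<in>H. E x u}"
  define T where "T = {x \<in> C. \<exists>u\<in>H. E u x}"
  \<comment> \<open>By \<open>no_insertion\<close> the successors of \<open>S\<close> avoid
    \<open>T\<close>. Both sets lie in \<open>R\<close>, except that the successor of
    \<open>last R\<close> may fall outside; this accounts for the 1.\<close>
  have ST: "card S + card T \<le> length R + 1"
  proof -
    obtain nx where nx: "cyc_next E nx C (R @ G)"
      using cyc_next_exists[OF dRG] C(2,3) by (auto simp: cyc_next_def)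
    have sub: "S \<subseteq> set R" "T \<subseteq> set R" using gap C(3) by (auto simp: S_def T_def)
    have "nx ` S \<inter> T = {}"
    proof (rule ccontr)
      assume "nx ` S \<inter> T \<noteq> {}"
      then obtain x u v where x: "x \<in> C" "u \<in> H" "E x u" "v \<in> H" "E v (nx x)"
        by (auto simp: S_def T_def)
      obtain ys where "cyc_next E nx C ys" "last ys = x" "hd ys = nx x"
        by (rule cyc_next_at[OF nx x(1)])
      then show False using no_insertion[OF C(1), of ys u v] x by (auto simp: cyc_next_def)
    qed
    moreover have "nx x \<in> set R" if "x \<in> set R" "x \<noteq> last R" for x
    proof -
      obtain A B where AB: "R = A @ x # B" using split_list[OF \<open>x \<in> set R\<close>] by blast
      then have "B \<noteq> []" using that(2) by auto
      then have "nx x = hd (B @ G)" using cyc_next_append(1)[of E nx C "A @ [x]" "B @ G"] nx AB by auto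
      then show ?thesis using \<open>B \<noteq> []\<close> AB by (cases B) auto
    qed
    then have "nx ` S \<union> T \<subseteq> insert (nx (last R)) (set R)" using sub by blast
    then have "card (nx ` S \<union> T) \<le> card (insert (nx (last R)) (set R))"
      by (intro card_mono) auto
    then have "card (nx ` S \<union> T) \<le> Suc (card (set R))"
      by (simp add: card_insert_if split: if_splits)
    moreover have "card (nx ` S \<union> T) = card (nx ` S) + card T"
      using \<open>nx ` S \<inter> T = {}\<close> finC by (intro card_Un_disjoint) (auto simp: S_def T_def)
    moreover have "card (nx ` S) = card S"
      using cyc_next_bij(2)[OF nx] by (intro card_image) (auto simp: S_def intro: inj_on_subset)
    moreover have "card (set R) = length R" using RG(2) by (rule distinct_card)
    ultimately show ?thesis by linarith
  qed
  have cC: "card C = length R + length G" using distinct_card[OF dRG] C(3) by simp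
  define Q where "Q = \<Union>(F - {C})"
  note rem = fam_remove[OF fam C(1)]
  have QW: "Q = W - C" using rem(3) by (simp add: Q_def W_def)
  have cW: "card W = card Q + length R + length G"
    using card_Un_disjoint[of C Q] finite_subset[of Q W] finW finC CW QW cC
    by (simp add: Un_absorb1 Diff_partition)
  have split_W: "outd E' W x = outd E' C x + outd E' Q x" for E' x
    using outd_split[OF finW CW] QW by simp
  have "outd E C w \<le> card T" "ind E C w' \<le> card S"
    using w finC by (auto simp: outd_def S_def T_def intro!: card_mono)
  moreover have "outd E Q w + ind E Q w' \<le> card Q"
    unfolding Q_def by (rule pair_le) (use w in auto)
  ultimately have uW: "outd E W w + ind E W w' \<le> card Q + length R + 1"
    using ST by (simp add: split_W)
  have cPH: "card (H - set P) = card H - length P" "length P \<le> card H"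
    using P(2) finH dipath_card[OF P(1)] card_mono[OF finH P(2)] by (auto simp: card_Diff_subset)
  define d where "d = (if length P \<ge> 2 then 1 else 0 :: nat)"
  have uH: "outd E H w \<le> card H - length P + d" "ind E H w' \<le> card H - length P + d"
    using outd_split[OF finH P(2), of E w] outd_split[OF finH P(2), of "\<lambda>x y. E y x" w']
      Pout Pin outd_le[of "H - set P" E w] outd_le[of "H - set P" "\<lambda>x y. E y x" w'] finH cPH
    by (auto simp: d_def)
  \<comment> \<open>The Ore condition for the pairs \<open>s\<close>, \<open>w'\<close> and
    \<open>w\<close>, \<open>s\<close> is added up; the whole degree of \<open>s\<close> lies in
    \<open>W\<close>.\<close>
  have deg: "2 * card W + 2 * card H \<le> outd E W s + ind E W s + (card Q + length R + 1) +
      2 * (card H - length P + d)" if s: "s \<in> set G" for s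
  proof -
    have sW: "s \<in> W" using s C(3) CW by auto
    have "outd E H s = 0" "ind E H s = 0" using gap s by (auto intro!: outd_zero)
    moreover have "card V \<le> outd E V s + ind E V w'" "card V \<le> outd E V w + ind E V s"
      using oreD[of s w'] oreD[of w s] gap[OF s] w sW WH by auto
    ultimately show ?thesis using uW uH by (simp add: outd_V card_V)
  qed
  \<comment> \<open>Induction on the number of vertices of \<open>W\<close> still uncovered. Once
    none is left, the family covers \<open>W\<close> and also \<open>P\<close>, against
    maximality.\<close>
  have fill: False if F': "fam E m F'" "card F' = card F" "Q \<union> set R \<union> set P \<subseteq> \<Union>F'"
    "\<Union>F' \<subseteq> W \<union> set P" for F'
    using that
  proof (induction "card (W - \<Union>F')" arbitrary: F' rule: less_induct)
    case less
    define L where "L = W - \<Union>F'"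
    have LG: "L \<subseteq> set G" using less.prems(3) QW C(3) by (auto simp: L_def)
    show False
    proof (cases "L = {}")
      case True
      obtain p where p: "p \<in> set P" using dipath_nonempty[OF P(1)] by (meson list.set_sel(1))
      then have "p \<notin> W" "p \<in> \<Union>F'" using less.prems(3) P(2) WH(1) by blast+
      moreover have "W \<subseteq> \<Union>F'" using True unfolding L_def by blast
      ultimately have "W \<subset> \<Union>F'" by blast
      moreover have "\<Union>F' \<subseteq> V" using less.prems(4) P(2) WH by blast
      ultimately show False using maximal[OF less.prems(1,2)] by (simp add: W_def)
    next
      case False
      then obtain s where s: "s \<in> L" by auto
      then have sG: "s \<in> set G" using LG by auto
      have finL: "finite L" using finW by (auto simp: L_def)
      have LW: "L \<subseteq> W" by (auto simp: L_def)
      have cL: "card L \<le> length G" using card_mono[OF _ LG] card_length[of G] by simp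
      have cLp: "card L \<ge> 1" using s finL by (metis One_nat_def Suc_leI card_gt_0_iff empty_iff)
      have U: "\<Union>F' = (W - L) \<union> set P"
        using less.prems(3,4) P(2) WH QW by (auto simp: L_def)
      have cU: "card (\<Union>F') = card W - card L + length P"
      proof -
        have "card (\<Union>F') = card (W - L) + card (set P)"
          unfolding U using finW P(2) WH(1) by (intro card_Un_disjoint) auto
        then show ?thesis using dipath_card[OF P(1)] LW finL by (simp add: card_Diff_subset)
      qed
      have cLW: "card L \<le> card W" using card_mono[OF finW LW] .
      \<comment> \<open>Since \<open>s\<close> itself lies in the uncovered part \<open>L\<close>,
        at most \<open>card L - 1\<close> of its neighbours are lost there.\<close>
      have big: "outd E' W s \<le> outd E' (\<Union>F') s + (card L - 1)" if "\<not> E' s s" for E'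
      proof -
        have "outd E' W s = outd E' L s + outd E' (W - L) s" using outd_split[OF finW LW] .
        moreover have "outd E' L s \<le> card L - 1" by (rule outd_le_notin) (use finL s that in auto)
        moreover have "outd E' (W - L) s \<le> outd E' (\<Union>F') s"
          using fam_finite[OF less.prems(1)] U by (intro outd_mono) auto
        ultimately show ?thesis by linarith
      qed
      have gt: "card (\<Union>F') < outd E (\<Union>F') s + ind E (\<Union>F') s"
        using deg[OF sG] big[of E] big[of "\<lambda>x y. E y x"] irrefl cU cLW cL cLp cW P1 cPH
        by (auto simp: d_def split: if_splits)
      have sn: "s \<notin> \<Union>F'" using s by (simp add: L_def)
      obtain F'' where F'': "fam E m F''" "card F'' = card F'" "\<Union>F'' = insert s (\<Union>F')"
        using fam_extend_vertex[OF less.prems(1) sn gt] by metis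
      have "W - \<Union>F'' \<subset> W - \<Union>F'" using s sn LW unfolding F''(3) by blast
      then have "card (W - \<Union>F'') < card (W - \<Union>F')" using finW by (intro psubset_card_mono) auto
      moreover have "Q \<union> set R \<union> set P \<subseteq> \<Union>F''" "\<Union>F'' \<subseteq> W \<union> set P"
        unfolding F''(3) using less.prems(3,4) s LW by blast+
      ultimately show False using less.hyps[of F''] F''(1,2) less.prems(2) by simp
    qed
  qed
  have "dicyc E (R @ P)"
  proof (rule dicyc_appendI[OF RG(3) P(1)])
    show "set R \<inter> set P = {}" using C(3) CW P(2) WH(1) by auto
  qed (use P w in auto)
  moreover have "m \<le> length (R @ P)" using m P1 P2 by (auto split: if_splits)
  moreover have "set (R @ P) \<inter> (\<Union>F - C) = {}"
    using C(3) P(2) WH(1) unfolding W_def[symmetric] by auto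
  ultimately obtain F' where F': "fam E m F'" "card F' = card F"
    "\<Union>F' = set (R @ P) \<union> (\<Union>F - C)"
    using fam_replace[OF fam C(1), of "R @ P"] by metis
  have eq: "\<Union>F' = set R \<union> set P \<union> Q" using F'(3) by (simp add: QW W_def)
  show False
  proof (rule fill[OF F'(1,2)])
    show "Q \<union> set R \<union> set P \<subseteq> \<Union>F'" unfolding eq by blast
    show "\<Union>F' \<subseteq> W \<union> set P" unfolding eq using QW C(3) CW by auto
  qed
qed

text \<open>Take a segment \<open>R\<close> of the cycle, entered from \<open>H\<close> and left to
  \<open>H\<close>, whose complement \<open>G\<close> is as short as possible. Then no vertex of
  \<open>G\<close> has an arc to or from \<open>H\<close>, so \<open>bypass\<close> applies unless
  the new cycle would be shorter than \<open>m\<close>. As \<open>m\<close> is at most 3, only a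
  single vertex joined in both directions to a single vertex of \<open>H\<close> survives.\<close>

lemma no_bypass:
  assumes C: "C \<in> F" and e: "b \<in> C" "w \<in> H" "E b w" "a \<in> C" "w' \<in> H" "E w' a"
  shows "a = b \<and> w = w' \<and> m \<ge> 3"
proof -
  define P where "P R G \<longleftrightarrow> R \<noteq> [] \<and> dicyc E (R @ G) \<and> set (R @ G) = C \<and>
    (\<exists>u\<in>H. E (last R) u) \<and> (\<exists>u\<in>H. E u (hd R))" for R G
  have split: "\<exists>R G. P R G \<and> hd R = a \<and> last R = b"
  proof -
    obtain xs where xs: "dicyc E xs" "set xs = C" using C fam by (auto simp: fam_def hcyc_def)
    then obtain A B where AB: "xs = A @ (a # B)" using e(4) by (auto simp: in_set_conv_decomp)
    then have 1: "dicyc E (a # B @ A)" "set (a # B @ A) = C"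
      using xs dicyc_swap[of E A "a # B"] by auto
    then have "b \<in> set (a # B @ A)" using e(1) by simp
    then obtain R1 R2 where R: "a # B @ A = R1 @ b # R2"
      by (auto simp only: in_set_conv_decomp)
    have "hd (R1 @ [b]) = a" using R by (cases R1) auto
    moreover have "P (R1 @ [b]) R2" unfolding P_def using 1 e \<open>hd (R1 @ [b]) = a\<close> unfolding R by auto
    ultimately show ?thesis by (intro exI[of _ "R1 @ [b]"] exI[of _ R2]) simp
  qed
  obtain R G where RG: "P R G" and min: "\<And>R' G'. P R' G' \<Longrightarrow> length G \<le> length G'"
  proof -
    obtain R0 G0 where "P R0 G0" using split by blast
    then have "\<exists>x. P (fst x) (snd x)" by (intro exI[of _ "(R0, G0)"]) simp
    then obtain x where "is_arg_min (\<lambda>x. length (snd x)) (\<lambda>x. P (fst x) (snd x)) x"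
      by (metis is_arg_min_arg_min_nat)
    then show ?thesis using that[of "fst x" "snd x"] by (auto simp: is_arg_min_linorder)
  qed
  have gap: "\<not> E s u \<and> \<not> E u s" if "s \<in> set G" "u \<in> H" for s u
  proof -
    obtain G1 G2 where G: "G = G1 @ s # G2" using split_list[OF \<open>s \<in> set G\<close>] by blast
    have "\<not> E s u"
    proof
      assume "E s u"
      then have "P (R @ G1 @ [s]) G2" using RG G that(2) by (auto simp: P_def)
      then show False using min[of "R @ G1 @ [s]" G2] G by simp
    qed
    moreover have "\<not> E u s"
    proof
      assume "E u s"
      have "dicyc E ((s # G2 @ R) @ G1)"
        using dicyc_swap[of E "R @ G1" "s # G2"] RG G by (simp add: P_def)
      then have "P (s # G2 @ R) G1" using RG G that(2) \<open>E u s\<close> by (auto simp: P_def)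
      then show False using min[of "s # G2 @ R" G1] G by simp
    qed
    ultimately show ?thesis by simp
  qed
  have len: "card C = length R + length G" using RG dicyc_card[of E "R @ G"] by (auto simp: P_def)
  have small: "\<not> m \<le> length R + (if u = u' then 1 else 2)"
    if "u \<in> H" "u' \<in> H" "E (last R) u" "E u' (hd R)" for u u'
  proof
    assume m: "m \<le> length R + (if u = u' then 1 else 2)"
    have "dicyc E (R @ G)" "set (R @ G) = C" "R \<noteq> []" using RG by (simp_all add: P_def)
    then show False using bypass[OF C _ _ _ that gap m] by blast
  qed
  obtain u u' where "u \<in> H" "u' \<in> H" "E (last R) u" "E u' (hd R)" using RG by (auto simp: P_def)
  from small[OF this] have "\<not> m \<le> length R + 1" by (auto split: if_splits)
  moreover have "length R \<ge> 1" using RG by (cases R) (auto simp: P_def)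
  ultimately have mR: "m = 3" "length R = 1" using m3 by linarith+
  \<comment> \<open>If \<open>a\<close> and \<open>b\<close> differed, the segment from
    \<open>a\<close> to \<open>b\<close> would have at least two vertices, hence a complement
    shorter than the minimal one.\<close>
  have ab: "a = b"
  proof (rule ccontr)
    assume "a \<noteq> b"
    obtain R' G' where R': "P R' G'" "hd R' = a" "last R' = b" using split by blast
    then have "length R' \<ge> 2" using \<open>a \<noteq> b\<close> by (cases R'; cases "tl R'") (auto simp: P_def)
    moreover have "length G \<le> length G'" using min R'(1) by blast
    moreover have "card C = length R' + length G'"
      using R'(1) dicyc_card[of E "R' @ G'"] by (auto simp: P_def)
    ultimately show False using len mR by linarith
  qed
  obtain r where "R = [r]" using mR(2) by (auto simp: length_Suc_conv)
  moreover have "a \<in> set (R @ G)" "a \<notin> set G" using gap e RG by (auto simp: P_def)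
  ultimately have "R = [a]" by auto
  then have "w = w'" using small[of w w'] e ab mR by (auto split: if_splits)
  then show ?thesis using ab mR by simp
qed

end

text \<open>Otherwise a covered vertex has out-degree at most \<open>card W - 1\<close> and an
  uncovered one in-degree at most \<open>card H - 1\<close>, too little for the Ore
  condition.\<close>

lemma (in stuck) arc_to_H:
  assumes "F \<noteq> {}" "1 \<le> m"
  shows "\<exists>c\<in>W. \<exists>u\<in>H. E c u"
proof (rule ccontr)
  assume no: "\<not> ?thesis"
  obtain C where C: "C \<in> F" using assms(1) by auto
  then have "C \<noteq> {}" using fam hcyc_nonempty by (auto simp: fam_def)
  then obtain c where c: "c \<in> W" using C by (auto simp: W_def)
  obtain u where u: "u \<in> H" using H_ne by auto
  have "outd E H c = 0" "ind E W u = 0" using no c u by (auto intro!: outd_zero)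
  moreover have "outd E W c \<le> card W - 1" "ind E H u \<le> card H - 1"
    using outd_le_notin[OF finW c, of E] outd_le_notin[OF finH u, of "\<lambda>x y. E y x"] irrefl by auto
  moreover have "card W \<ge> 1" "card H \<ge> 1" using c u finW finH by (metis One_nat_def Suc_leI card_gt_0_iff empty_iff)+
  moreover have "card V \<le> outd E V c + ind E V u"
    using no c u WH by (intro oreD) auto
  ultimately show False by (simp add: outd_V card_V)
qed

lemma (in stuck) arc_from_H:
  assumes "F \<noteq> {}" "1 \<le> m"
  shows "\<exists>c\<in>W. \<exists>u\<in>H. E u c"
proof -
  interpret r: stuck "\<lambda>x y. E y x" V m F by (rule stuck_rev)
  show ?thesis using r.arc_to_H[OF assms] by simp
qed

lemma extend_maximal:
  assumes "ore E V" "fam E m F0" "\<Union>F0 \<subseteq> V" "m \<le> 3"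
  obtains F where "fam E m F" "card F = card F0" "\<Union>F0 \<subseteq> \<Union>F" "\<Union>F \<subseteq> V"
    "\<Union>F = V \<or> stuck E V m F"
proof -
  have fin: "finite V" using assms(1) by (simp add: ore_def)
  let ?Q = "\<lambda>F. fam E m F \<and> card F = card F0 \<and> \<Union>F0 \<subseteq> \<Union>F \<and> \<Union>F \<subseteq> V"
  have "?Q F0" using assms by simp
  moreover have "\<forall>F. ?Q F \<longrightarrow> card (\<Union>F) < Suc (card V)"
    using fin by (auto simp: less_Suc_eq_le intro: card_mono)
  ultimately obtain F where F: "?Q F" and max: "\<forall>F'. ?Q F' \<longrightarrow> card (\<Union>F') \<le> card (\<Union>F)"
    using ex_has_greatest_nat[of ?Q F0 "\<lambda>F. card (\<Union>F)" "Suc (card V)"] by auto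
  have "stuck E V m F" if "\<Union>F \<noteq> V"
  proof
    fix F' assume F': "fam E m F'" "card F' = card F" "\<Union>F \<subset> \<Union>F'"
    show "\<not> \<Union>F' \<subseteq> V"
    proof
      assume "\<Union>F' \<subseteq> V"
      then have "card (\<Union>F') \<le> card (\<Union>F)" using max F F' by auto
      moreover have "card (\<Union>F) < card (\<Union>F')"
        using F' fam_finite[OF F'(1)] by (intro psubset_card_mono)
      ultimately show False by simp
    qed
  qed (use F that assms in auto)
  then have "\<Union>F = V \<or> stuck E V m F" by metis
  with F that[of F] show ?thesis by simp
qed

text \<open>The process starts from one vertex, a cycle in the sense of \<open>dicyc\<close>. If it
  gets stuck, arcs in both directions join the cycle to the rest, and \<open>no_bypass\<close> would
  force the minimum length 1 to be at least 3.\<close>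

theorem woodall:
  assumes "ore E V" "V \<noteq> {}"
  shows "hcyc E V"
proof -
  obtain v where v: "v \<in> V" using assms(2) by auto
  have f0: "fam E 1 {{v}}"
    using dicyc_single[of E v] by (auto simp: fam_def hcyc_def intro!: exI[of _ "[v]"])
  have "\<Union>{{v}} \<subseteq> V" "(1::nat) \<le> 3" using v by simp_all
  then obtain F where F: "fam E 1 F" "card F = card {{v}}" "\<Union>F = V \<or> stuck E V 1 F"
    using extend_maximal[OF assms(1) f0] by metis
  obtain C where C: "F = {C}" using F(2) by (metis card_1_singletonE is_singletonI is_singleton_altdef)
  show ?thesis
  proof (cases "\<Union>F = V")
    case True
    then show ?thesis using F(1) C by (auto simp: fam_def)
  next
    case False
    then interpret stuck E V 1 F using F(3) by simp
    have "W = C" unfolding W_def by (simp add: C)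
    have ne: "F \<noteq> {}" and CF: "C \<in> F" using C by simp_all
    obtain b w where b: "b \<in> W" "w \<in> H" "E b w" using arc_to_H[OF ne] by auto
    obtain a w' where a: "a \<in> W" "w' \<in> H" "E w' a" using arc_from_H[OF ne] by auto
    have "b \<in> C" "a \<in> C" using a b \<open>W = C\<close> by metis+
    from no_bypass[OF CF this(1) b(2,3) this(2) a(2,3)] show ?thesis by simp
  qed
qed

section \<open>Families missing only vertices of large degree\<close>

lemma fam_of_lists:
  assumes "\<And>zs. zs \<in> set zss \<Longrightarrow> dicyc E zs \<and> m \<le> length zs" "distinct (concat zss)"
  shows "fam E m (set ` set zss) \<and> card (set ` set zss) = length zss"
  using assms
proof (induction zss)
  case (Cons zs zss)
  have "fam E m (set ` set zss)" "card (set ` set zss) = length zss"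
    using Cons by auto
  moreover have "set zs \<inter> \<Union>(set ` set zss) = {}" using Cons.prems(2) by auto
  ultimately show ?case using fam_insert(1,2)[of E m "set ` set zss" zs] Cons.prems(1)[of zs] by simp
qed simp

lemma fam_Un:
  assumes "fam E m F" "fam E m G" "\<Union>F \<inter> \<Union>G = {}"
  shows "fam E m (F \<union> G) \<and> card (F \<union> G) = card F + card G"
proof -
  have disj: "C \<inter> D = {}" if "C \<in> F" "D \<in> G" for C D using assms(3) that by blast
  have "F \<inter> G = {}"
  proof (rule ccontr)
    assume "F \<inter> G \<noteq> {}"
    then obtain C where "C \<in> F" "C \<in> G" by auto
    then show False using disj[of C C] assms(1) hcyc_nonempty by (auto simp: fam_def)
  qed
  moreover have "pairwise disjnt (F \<union> G)"
    using assms(1,2) disj unfolding fam_def pairwise_def disjnt_def by (metis Int_commute Un_iff)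
  ultimately show ?thesis using assms(1,2) by (auto simp: fam_def card_Un_disjoint)
qed

text \<open>Applied to a cycle listed so that it ends in a given vertex. An arc from there to
  \<open>y\<close> splits off a cycle of at least three vertices and leaves a non-empty rest
  \<open>A\<close>; if every such split is impossible, only the first vertex and the last but one
  remain as targets.\<close>

lemma end_arcs:
  assumes "\<And>A y B. ys = A @ y # B \<Longrightarrow> A \<noteq> [] \<Longrightarrow> 3 \<le> length (y # B) \<Longrightarrow> \<not> E (last ys) y"
    and "\<not> E (last ys) (last ys)"
  shows "outd E (set ys) (last ys) \<le> 2"
proof -
  have "{y \<in> set ys. E (last ys) y} \<subseteq> {hd ys, ys ! (length ys - 2)}"
  proof
    fix y assume y: "y \<in> {y \<in> set ys. E (last ys) y}"
    then obtain A B where AB: "ys = A @ y # B" by (auto dest: split_list)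
    show "y \<in> {hd ys, ys ! (length ys - 2)}"
    proof (cases "A = []")
      case False
      then have "\<not> 3 \<le> length (y # B)" using assms(1)[OF AB] y by auto
      moreover have "B \<noteq> []" using AB y assms(2) by auto
      ultimately have "length B = 1" by (cases B) (auto simp: Suc_le_eq)
      then show ?thesis using AB by (simp add: nth_append)
    qed (use AB in simp)
  qed
  then have "outd E (set ys) (last ys) \<le> card {hd ys, ys ! (length ys - 2)}"
    unfolding outd_def by (intro card_mono) auto
  also have "\<dots> \<le> 2" by (simp add: card_insert_if)
  finally show ?thesis .
qed

text \<open>These assumptions are inconsistent, see \<open>contradiction\<close> below.\<close>

locale heavy = stuck E V 3 F for E :: "'a \<Rightarrow> 'a \<Rightarrow> bool" and V F +
  fixes nx :: "'a \<Rightarrow> 'a"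
  assumes F_ne: "F \<noteq> {}" and nx: "\<And>C. C \<in> F \<Longrightarrow> \<exists>xs. cyc_next E nx C xs"
    and heavy_H: "\<And>u. u \<in> H \<Longrightarrow> card V \<le> outd E V u + ind E V u"
    and size: "12 * card F + 3 \<le> card V"
begin

lemma heavy_rev:
  obtains nx' :: "'a \<Rightarrow> 'a" where "heavy (\<lambda>x y. E y x) V F nx'"
proof -
  interpret r: stuck "\<lambda>x y. E y x" V 3 F by (rule stuck_rev)
  obtain nx' where "\<And>C. C \<in> F \<Longrightarrow> \<exists>xs. cyc_next (\<lambda>x y. E y x) nx' C xs"
    using fam_next[OF r.fam] by metis
  then have "heavy (\<lambda>x y. E y x) V F nx'"
    using F_ne heavy_H size by unfold_locales (auto simp: add.commute)
  then show ?thesis using that by blast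
qed

lemma C_sub: "C \<in> F \<Longrightarrow> C \<subseteq> W"
  by (auto simp: W_def)

lemma C_fin: "C \<in> F \<Longrightarrow> finite C"
  using C_sub finW finite_subset by blast

lemma C_card: "C \<in> F \<Longrightarrow> 3 \<le> card C"
  using fam by (auto simp: fam_def)

lemma at:
  assumes "C \<in> F" "z \<in> C"
  obtains ys where "cyc_next E nx C ys" "dicyc E ys" "set ys = C" "length ys = card C"
    "last ys = z" "hd ys = nx z"
proof -
  obtain xs where "cyc_next E nx C xs" using nx[OF assms(1)] by blast
  then obtain ys where "cyc_next E nx C ys" "last ys = z" "hd ys = nx z"
    using cyc_next_at assms(2) by metis
  then show ?thesis using that dicyc_card[of E ys] by (auto simp: cyc_next_def)
qed

text \<open>The form in which maximality is used from here on: some cycles are dissolved together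
  with all of \<open>H\<close> and recombined, and only their number has to be kept.\<close>

lemma rebuild:
  assumes "G \<subseteq> F" "length zss = card G" "distinct (concat zss)"
    and "\<And>zs. zs \<in> set zss \<Longrightarrow> dicyc E zs \<and> 3 \<le> length zs"
    and "set (concat zss) = \<Union>G \<union> H"
  shows False
proof -
  have un: "\<Union>(set ` set zss) = \<Union>G \<union> H" using assms(5) by simp
  have disj: "\<Union>(F - G) \<inter> \<Union>G = {}"
  proof (rule Int_emptyI)
    fix x assume "x \<in> \<Union>(F - G)" "x \<in> \<Union>G"
    then obtain C D where "x \<in> C" "C \<in> F - G" "x \<in> D" "D \<in> G" by auto
    then show False using fam_disj[OF fam, of C D] assms(1) by auto
  qed
  have "\<Union>(F - G) \<subseteq> W" by (auto simp: W_def)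
  then have "\<Union>(F - G) \<inter> H = {}" using WH(1) by auto
  with disj have "\<Union>(F - G) \<inter> \<Union>(set ` set zss) = {}" unfolding un by (simp add: Int_Un_distrib)
  then have "fam E 3 (F - G \<union> set ` set zss)"
    "card (F - G \<union> set ` set zss) = card (F - G) + length zss"
    using fam_Un[of E 3 "F - G" "set ` set zss"] fam_subset[OF fam, of "F - G"]
      fam_of_lists[of zss E 3] assms(3,4) by auto
  moreover have "card (F - G) + length zss = card F"
    using assms(1,2) fam by (auto simp: fam_def card_Diff_subset finite_subset card_mono)
  moreover have "\<Union>(F - G \<union> set ` set zss) = V"
  proof -
    have "\<Union>(F - G) \<union> \<Union>G = W" using assms(1) by (auto simp: W_def)
    then show ?thesis using un WH(2) by (simp add: Un_assoc[symmetric])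
  qed
  ultimately show False using maximal[of "F - G \<union> set ` set zss"] sub proper by auto
qed

lemma nx_nx: assumes "C \<in> F" "z \<in> C" shows "nx (nx z) \<noteq> z"
proof
  assume e: "nx (nx z) = z"
  obtain ys where ys: "cyc_next E nx C ys" "length ys = card C" "last ys = z" "hd ys = nx z"
    "dicyc E ys" "set ys = C"
    by (rule at[OF assms])
  have "3 \<le> length ys" using C_card[OF assms(1)] ys(2) by simp
  then obtain a b c r where r: "ys = a # b # c # r"
    by (cases ys; cases "tl ys"; cases "tl (tl ys)") auto
  have "nx a = b" using cyc_next_append(1)[of E nx C "[a]" "b # c # r"] ys r by simp
  then have "b = last ys" using ys r e by auto
  moreover have "distinct ys" using ys by (simp add: dicyc_def dipath_def)
  ultimately show False using r by (cases r rule: rev_cases) auto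
qed

lemma nx_W: "nx ` W = W" "inj_on nx W" and nx_C: "C \<in> F \<Longrightarrow> nx ` C = C"
proof -
  show C: "nx ` C = C" if "C \<in> F" for C using nx[OF that] cyc_next_bij(1) by metis
  have "nx ` W = (\<Union>C\<in>F. nx ` C)" by (auto simp: W_def)
  also have "\<dots> = (\<Union>C\<in>F. C)" using C by (intro SUP_cong) auto
  finally show "nx ` W = W" by (simp add: W_def)
  show "inj_on nx W"
  proof (rule inj_onI)
    fix x y assume xy: "x \<in> W" "y \<in> W" "nx x = nx y"
    then obtain C D where CD: "C \<in> F" "x \<in> C" "D \<in> F" "y \<in> D" by (auto simp: W_def)
    then have "nx x \<in> C" "nx y \<in> D" using C by blast+
    then have "C = D" using fam_disj[OF fam CD(1,3)] xy(3) by auto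
    then show "x = y" using CD nx[of C] cyc_next_bij(2) xy(3) by (metis inj_onD)
  qed
qed

text \<open>A detour from \<open>z\<close> to \<open>u\<close> through another cycle: enter
  \<open>D\<close> at \<open>nx b\<close>, run around it to \<open>b\<close>, go on to
  \<open>u\<close>. By the Ore condition there are at least \<open>card W + 1\<close> arcs from
  \<open>z\<close> to \<open>W\<close> and from \<open>W\<close> to \<open>u\<close>. The
  out-neighbours of \<open>z\<close> and the shifted in-neighbours of \<open>u\<close> lie in
  \<open>W - {z}\<close>, so they meet at least twice, but inside \<open>C\<close> only in
  \<open>nx (nx z)\<close>.\<close>

lemma exit:
  assumes C: "C \<in> F" "z \<in> C" and u: "u \<in> H" and "\<And>w. w \<in> H \<Longrightarrow> \<not> E z w"
    and bk: "\<And>b. b \<in> C \<Longrightarrow> E b u \<Longrightarrow> b = nx z"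
  shows "\<exists>D\<in>F. D \<noteq> C \<and> (\<exists>b\<in>D. E b u \<and> E z (nx b))"
proof (rule ccontr)
  assume no: "\<not> ?thesis"
  define B where "B = {b \<in> W. E b u}"
  define N where "N = {y \<in> W. E z y}"
  have zW: "z \<in> W" using C C_sub by auto
  have "outd E H z = 0" using assms(4) by (auto intro!: outd_zero)
  moreover have "ind E H u \<le> card H - 1" using outd_le_notin[OF finH u, of "\<lambda>x y. E y x"] irrefl by simp
  moreover have "card H \<ge> 1" using u finH by (metis One_nat_def Suc_leI card_gt_0_iff empty_iff)
  moreover have "card V \<le> outd E V z + ind E V u"
    using assms(4) u zW WH by (intro oreD) auto
  ultimately have "card W + 1 \<le> outd E W z + ind E W u"
    by (simp add: outd_V card_V)
  then have big: "card W + 1 \<le> card N + card B"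
    unfolding N_def B_def outd_def .
  have B: "B \<subseteq> W" "card (nx ` B) = card B"
    using nx_W(2) by (auto simp: B_def intro!: card_image intro: inj_on_subset)
  have zB: "z \<notin> nx ` B"
  proof
    assume "z \<in> nx ` B"
    then obtain b where b: "b \<in> W" "E b u" "z = nx b" by (auto simp: B_def)
    have "b \<in> C"
    proof -
      obtain D where D: "D \<in> F" "b \<in> D" using b(1) by (auto simp: W_def)
      then have "z \<in> D" using nx_C b(3) by blast
      then show ?thesis using fam_disj[OF fam C(1) D(1)] C(2) D(2) by auto
    qed
    then have "b = nx z" using bk b(2) by blast
    then show False using nx_nx[OF C] b(3) by simp
  qed
  have "nx ` B \<inter> N \<subseteq> {nx (nx z)}"
  proof
    fix y assume "y \<in> nx ` B \<inter> N"
    then obtain b where b: "b \<in> W" "E b u" "y = nx b" "E z y" by (auto simp: B_def N_def)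
    then obtain D where D: "D \<in> F" "b \<in> D" by (auto simp: W_def)
    then have "D = C" using no b by auto
    then show "y \<in> {nx (nx z)}" using bk b D by simp
  qed
  then have "card (nx ` B \<inter> N) \<le> 1" using card_mono[of "{nx (nx z)}"] by simp
  moreover have "card (nx ` B \<union> N) \<le> card (W - {z})"
    using finW zB B nx_W(1) irrefl by (intro card_mono) (auto simp: N_def)
  moreover have "card (nx ` B) + card N = card (nx ` B \<union> N) + card (nx ` B \<inter> N)"
    using finW B by (intro card_Un_Int) (auto simp: N_def intro: finite_subset)
  moreover have "card (W - {z}) < card W" using finW zW by (intro psubset_card_mono) auto
  ultimately show False using big B(2) by linarith
qed

text \<open>The arc from \<open>u'\<close> to \<open>nx z\<close> yields both hypotheses of
  \<open>exit\<close>: an arc from \<open>z\<close> to \<open>H\<close> would allow an insertion,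
  and by \<open>no_bypass\<close> an arc from \<open>C\<close> to \<open>u\<close> can only start at
  \<open>nx z\<close>.\<close>

lemma merge_exit:
  assumes "C \<in> F" "z \<in> C" "u \<in> H" "u' \<in> H" "E u' (nx z)"
  shows "\<exists>D\<in>F. D \<noteq> C \<and> (\<exists>b\<in>D. E b u \<and> E z (nx b))"
proof (rule exit[OF assms(1-3)])
  obtain ys where ys: "cyc_next E nx C ys" "last ys = z" "hd ys = nx z"
    "dicyc E ys" "set ys = C" by (rule at[OF assms(1,2)])
  show "\<not> E z w" if "w \<in> H" for w
    using no_insertion[OF assms(1) ys(4,5) that assms(4)] ys assms(5) by auto
  have "nx z \<in> C" using nx_C[OF assms(1)] assms(2) by blast
  then show "b = nx z" if "b \<in> C" "E b u" for b
    using no_bypass[OF assms(1) that(1) assms(3) that(2) _ assms(4,5)] by simp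
qed

text \<open>If \<open>u\<close> had no arc to \<open>W\<close>, the Ore condition would give every
  covered vertex an arc from \<open>H\<close>. On a cycle that also sends an arc to
  \<open>H\<close>, \<open>no_bypass\<close> would then identify all vertices.\<close>

lemma arc_out:
  assumes "u \<in> H" shows "\<exists>a\<in>W. E u a"
proof (rule ccontr)
  assume no: "\<not> ?thesis"
  obtain b w where b: "b \<in> W" "w \<in> H" "E b w" using arc_to_H F_ne by auto
  then obtain C where C: "C \<in> F" "b \<in> C" by (auto simp: W_def)
  have "a = b" if a: "a \<in> C" for a
  proof -
    have aW: "a \<in> W" using C_sub[OF C(1)] a by auto
    have "\<exists>w'\<in>H. E w' a"
    proof (rule ccontr)
      assume "\<not> ?thesis"
      then have "ind E H a = 0" by (auto intro!: outd_zero)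
      moreover have "outd E W u = 0" using no by (auto intro!: outd_zero)
      moreover have "ind E W a \<le> card W - 1" using outd_le_notin[OF finW aW, of "\<lambda>x y. E y x"] irrefl by simp
      moreover have "outd E H u \<le> card H - 1" using outd_le_notin[OF finH assms, of E] irrefl by simp
      moreover have "card W \<ge> 1" "card H \<ge> 1"
        using aW assms finW finH by (metis One_nat_def Suc_leI card_gt_0_iff empty_iff)+
      moreover have "card V \<le> outd E V u + ind E V a"
        using no aW assms WH by (intro oreD) auto
      ultimately show False by (simp add: outd_V card_V)
    qed
    then show ?thesis using no_bypass[OF C(1,2) b(2,3) a] by auto
  qed
  then have "C \<subseteq> {b}" by auto
  then have "card C \<le> 1" using card_mono[of "{b}" C] by simp
  then show False using C_card[OF C(1)] by simp
qed

lemma pair_le_W: "u \<in> H \<Longrightarrow> v \<in> H \<Longrightarrow> outd E W u + ind E W v \<le> card W"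
  using pair_le[of F u v] by (simp add: W_def)

section \<open>Size and degrees of the uncovered set\<close>

lemma H_ge2: "2 \<le> card H"
proof (rule ccontr)
  assume "\<not> ?thesis"
  then have "card H \<le> 1" by simp
  obtain u where u: "u \<in> H" using H_ne by auto
  then have "H = {u}" using \<open>card H \<le> 1\<close> finH card_le_Suc0_iff_eq[OF finH] by auto
  then have "outd E H u = 0" "ind E H u = 0" using irrefl by (auto intro!: outd_zero)
  then show False using heavy_H[OF u] pair_le_W[OF u u] \<open>H = {u}\<close> by (simp add: outd_V card_V)
qed

text \<open>By \<open>pair_le_W\<close> each Ore sum loses at most \<open>card W\<close> when
  restricted to \<open>H\<close>, so \<open>H\<close> inherits the Ore condition.\<close>

lemma H_cycle:
  assumes "u \<in> H"
  obtains hs where "dicyc E hs" "set hs = H" "length hs = card H" "last hs = u"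
proof -
  have "ore E H"
    unfolding ore_def
  proof (intro conjI ballI impI allI)
    fix x y assume xy: "x \<in> H" "y \<in> H" "x \<noteq> y" "\<not> E x y"
    then have "card V \<le> outd E V x + ind E V y" using WH by (intro oreD) auto
    then show "card H \<le> outd E H x + ind E H y" using pair_le_W[OF xy(1,2)] by (simp add: outd_V card_V)
  qed (use finH irrefl in auto)
  then have "hcyc E H" using H_ne by (rule woodall)
  then obtain xs where xs: "dicyc E xs" "set xs = H" by (auto simp: hcyc_def)
  then have "u \<in> set xs" using assms by simp
  then obtain A B where "xs = A @ u # B" using split_list[of u xs] by blast
  then have AB: "xs = (A @ [u]) @ B" by simp
  have "dicyc E (B @ A @ [u])" using dicyc_swap[of E "A @ [u]" B] xs(1) AB by simp
  moreover have "set (B @ A @ [u]) = H" using AB xs(2) by auto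
  moreover have "last (B @ A @ [u]) = u" by simp
  ultimately show ?thesis using that dicyc_card by metis
qed

text \<open>An out-neighbour \<open>y\<close> of \<open>v\<close> beyond the two allowed by
  \<open>end_arcs\<close> would split the Hamiltonian cycle of \<open>H\<close> into a cycle through
  \<open>y\<close> and a rest \<open>A\<close>. The rest is absorbed: an arc leads from its last
  vertex into \<open>C\<close>, and \<open>merge_exit\<close> leads from \<open>C\<close> through
  \<open>D\<close> back to its first vertex.\<close>

lemma outd_H: assumes "v \<in> H" shows "outd E H v \<le> 2"
proof -
  obtain hs where hs: "dicyc E hs" "set hs = H" "last hs = v" by (rule H_cycle[OF assms])
  have "outd E (set hs) (last hs) \<le> 2"
  proof (rule end_arcs)
    fix A y B assume AB: "hs = A @ y # B" "A \<noteq> []" "3 \<le> length (y # B)"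
    show "\<not> E (last hs) y"
    proof
      assume e: "E (last hs) y"
      have AyB: "dicyc E (A @ y # B)" using hs(1) AB(1) by simp
      note dA = dicyc_appendD(1-3)[OF AyB AB(2) list.distinct(2)]
      have sets: "set A \<subseteq> H" "set (y # B) \<subseteq> H" unfolding hs(2)[symmetric] AB(1) by auto
      have mem: "hd A \<in> H" "last A \<in> H" using sets(1) hd_in_set[OF AB(2)] last_in_set[OF AB(2)] by auto
      obtain a where a: "a \<in> W" "E (last A) a" using arc_out[OF mem(2)] by auto
      obtain z where z: "z \<in> W" "a = nx z" using a(1) nx_W(1) by blast
      then obtain C where C: "C \<in> F" "z \<in> C" by (auto simp: W_def)
      obtain D b where D: "D \<in> F" "D \<noteq> C" "b \<in> D" "E b (hd A)" "E z (nx b)"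
        using merge_exit[OF C mem(1,2)] a(2) z(2) by auto
      obtain ys where ys: "dicyc E ys" "set ys = C" "last ys = z" "hd ys = nx z" by (rule at[OF C])
      obtain xs where xs: "dicyc E xs" "set xs = D" "last xs = b" "hd xs = nx b" by (rule at[OF D(1,3)])
      have disj: "C \<inter> D = {}" "set A \<inter> (C \<union> D) = {}" "set (y # B) \<inter> (C \<union> D) = {}"
        using fam_disj[OF fam C(1) D(1)] D(2) C_sub[OF C(1)] C_sub[OF D(1)] WH(1) sets by blast+
      have ne: "ys \<noteq> []" "xs \<noteq> []" using ys(1) xs(1) by (auto simp: dicyc_def dipath_def)
      have p: "dipath E (ys @ xs)"
        unfolding dipath_append[OF ne] using ys xs D(5) disj(1) dicyc_dipath by metis
      have c1: "dicyc E (A @ ys @ xs)"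
      proof (rule dicyc_appendI[OF dA(1) p])
        show "set A \<inter> set (ys @ xs) = {}" using disj(2) ys(2) xs(2) by simp
      qed (use ys xs ne a(2) z(2) D(4) in simp_all)
      have c2: "dicyc E (y # B)" using dA(2) e AB(1) by (simp add: dicyc_def)
      show False
      proof (rule rebuild[of "{C, D}" "[A @ ys @ xs, y # B]"])
        show "distinct (concat [A @ ys @ xs, y # B])"
          using c1 c2 disj dA(3) ys(2) xs(2) by (auto simp: dicyc_def dipath_def)
        show "dicyc E zs \<and> 3 \<le> length zs" if "zs \<in> set [A @ ys @ xs, y # B]" for zs
          using that c1 c2 AB(3) C_card[OF C(1)] dicyc_card[OF ys(1)] ys(2) by auto
        show "set (concat [A @ ys @ xs, y # B]) = \<Union>{C, D} \<union> H"
          unfolding hs(2)[symmetric] AB(1) using ys(2) xs(2) by auto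
      qed (use C D in auto)
    qed
  qed (use irrefl in auto)
  then show ?thesis using hs by simp
qed

lemma ind_H: "v \<in> H \<Longrightarrow> ind E H v \<le> 2"
proof -
  assume v: "v \<in> H"
  obtain nx' where "heavy (\<lambda>x y. E y x) V F nx'" by (rule heavy_rev)
  then interpret r: heavy "\<lambda>x y. E y x" V F nx' .
  show ?thesis using r.outd_H[OF v] .
qed


end

context heavy
begin

lemma deg_H: "u \<in> H \<Longrightarrow> outd E H u + ind E H u \<le> (if card H = 2 then 2 else 4)"
  using outd_H[of u] ind_H[of u] outd_le_notin[OF finH, of u E]
    outd_le_notin[OF finH, of u "\<lambda>x y. E y x"] irrefl by auto

lemma H_le4: "card H \<le> 4"
proof -
  obtain u where u: "u \<in> H" using H_ne by auto
  show ?thesis using deg_H[OF u] heavy_H[OF u] pair_le_W[OF u u] by (simp add: outd_V card_V split: if_splits)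
qed

text \<open>The degree of \<open>u\<close> is at least \<open>card V\<close>; the other cycles take
  at most their size of it by \<open>pair_le\<close>, and \<open>H\<close> takes at most 2 or 4, so
  the remainder falls to \<open>C\<close>.\<close>

lemma deg_C:
  assumes "C \<in> F" "u \<in> H"
  shows "card C + card H \<le> outd E C u + ind E C u + (if card H = 2 then 2 else 4)"
proof -
  note rem = fam_remove[OF fam assms(1)]
  have eq: "\<Union>(F - {C}) = W - C" using rem(3) by (simp add: W_def)
  have "outd E (W - C) u + ind E (W - C) u \<le> card (W - C)"
    using pair_le[of "F - {C}" u u] assms(2) unfolding eq by auto
  moreover have "outd E' W u = outd E' C u + outd E' (W - C) u" for E'
    using outd_split[OF finW C_sub[OF assms(1)]] .
  moreover have "card W = card C + card (W - C)"
    using C_sub[OF assms(1)] finW C_fin[OF assms(1)]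
    by (metis card_Diff_subset card_mono le_add_diff_inverse)
  ultimately show ?thesis using deg_H[OF assms(2)] heavy_H[OF assms(2)]
    by (simp add: outd_V card_V)
qed

text \<open>Reversal of all arcs exchanges the two types, so most results are proved for type A
  only.\<close>

definition "typeA C \<longleftrightarrow> C \<in> F \<and> (\<forall>c\<in>C. \<forall>u\<in>H. \<not> E c u)"
definition "typeB C \<longleftrightarrow> C \<in> F \<and> (\<forall>c\<in>C. \<forall>u\<in>H. \<not> E u c)"

text \<open>A cycle of neither type is the exceptional case of \<open>no_bypass\<close>, where all
  arcs between it and \<open>H\<close> use the same \<open>w\<close>. A second vertex
  \<open>u\<close> of \<open>H\<close> then has none, against \<open>deg_C\<close>.\<close>

lemma types: "C \<in> F \<Longrightarrow> typeA C \<or> typeB C"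
proof (rule ccontr)
  assume C: "C \<in> F" and "\<not> (typeA C \<or> typeB C)"
  then obtain b w a w' where e: "b \<in> C" "w \<in> H" "E b w" "a \<in> C" "w' \<in> H" "E w' a"
    by (auto simp: typeA_def typeB_def)
  have "H \<noteq> {w}" using H_ge2 by auto
  then obtain u where u: "u \<in> H" "u \<noteq> w" using e(2) by auto
  have "\<not> E u c \<and> \<not> E c u" if "c \<in> C" for c
    using no_bypass[OF C e(1-3) that u(1)] no_bypass[OF C that u(1) _ e(4-6)]
      no_bypass[OF C e] u(2) by auto
  then have "outd E C u = 0" "ind E C u = 0" by (auto intro!: outd_zero)
  then show False using deg_C[OF C u(1)] C_card[OF C] H_ge2 by (auto split: if_splits)
qed

lemma typeA_deg: "typeA C \<Longrightarrow> u \<in> H \<Longrightarrow> card C + card H \<le> outd E C u + (if card H = 2 then 2 else 4)"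
  using deg_C[of C u] by (simp add: typeA_def outd_zero)

lemma typeB_deg: "typeB C \<Longrightarrow> u \<in> H \<Longrightarrow> card C + card H \<le> ind E C u + (if card H = 2 then 2 else 4)"
  using deg_C[of C u] by (simp add: typeB_def outd_zero)

lemma exit_A:
  assumes "typeA C" "z \<in> C" "u \<in> H"
  obtains D b where "D \<in> F" "D \<noteq> C" "b \<in> D" "E b u" "E z (nx b)"
  using exit[of C z u] assms unfolding typeA_def by metis

text \<open>The chord would close \<open>B\<close> to a cycle of its own. The rest \<open>A\<close>
  forms a cycle with all of \<open>H\<close>: from \<open>u\<close> into \<open>hd A\<close>, and
  from \<open>last A\<close> through the cycle \<open>D\<close> of \<open>exit_A\<close> back to
  \<open>H\<close>.\<close>

lemma no_chord:
  assumes C: "typeA C" "cyc_next E nx C (A @ B)" "A \<noteq> []" "3 \<le> length B"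
    and u: "u \<in> H" "E u (hd A)"
  shows "\<not> E (last B) (hd B)"
proof
  assume e: "E (last B) (hd B)"
  have CF: "C \<in> F" using C(1) by (simp add: typeA_def)
  have B: "B \<noteq> []" using C(4) by auto
  have AB: "dicyc E (A @ B)" "set (A @ B) = C" using C(2) by (auto simp: cyc_next_def)
  note sp = dicyc_appendD[OF AB(1) C(3) B]
  obtain hs where hs: "dicyc E hs" "set hs = H" "length hs = card H" "last hs = u" by (rule H_cycle[OF u(1)])
  have hne: "hs \<noteq> []" using hs(1) by (auto simp: dicyc_def dipath_def)
  have h0: "hd hs \<in> H" using hd_in_set[OF hne] hs(2) by simp
  have sA: "set A \<subseteq> C" "set B \<subseteq> C" unfolding AB(2)[symmetric] by auto
  have "last A \<in> C" using sA(1) last_in_set[OF C(3)] by auto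
  then obtain D b where D: "D \<in> F" "D \<noteq> C" "b \<in> D" "E b (hd hs)" "E (last A) (nx b)"
    by (rule exit_A[OF C(1) _ h0])
  obtain xs where xs: "dicyc E xs" "set xs = D" "last xs = b" "hd xs = nx b" by (rule at[OF D(1,3)])
  have xne: "xs \<noteq> []" using xs(1) by (auto simp: dicyc_def dipath_def)
  have disj: "C \<inter> D = {}" "C \<inter> H = {}" "D \<inter> H = {}"
    using fam_disj[OF fam CF D(1)] D(2) C_sub[OF CF] C_sub[OF D(1)] WH(1) by blast+
  have dAx: "set A \<inter> set xs = {}" using sA(1) disj(1) xs(2) by blast
  have p: "dipath E (A @ xs)"
    unfolding dipath_append[OF C(3) xne] using sp(1) dicyc_dipath[OF xs(1)] xs D(5) dAx by metis
  have c1: "dicyc E (hs @ A @ xs)"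
  proof (rule dicyc_appendI[OF dicyc_dipath[OF hs(1)] p])
    show "set hs \<inter> set (A @ xs) = {}" using hs(2) xs(2) sA(1) disj by auto
  qed (use hs xs xne C(3) u(2) D(4) in simp_all)
  have c2: "dicyc E B" using sp(2) e by (simp add: dicyc_def)
  show False
  proof (rule rebuild[of "{C, D}" "[hs @ A @ xs, B]"])
    show "distinct (concat [hs @ A @ xs, B])"
      using dipath_distinct[OF dicyc_dipath[OF c1]] dipath_distinct[OF sp(2)] disj sp(3) hs(2) xs(2) sA
      by auto
    show "dicyc E zs \<and> 3 \<le> length zs" if "zs \<in> set [hs @ A @ xs, B]" for zs
      using that c1 c2 C(4) C_card[OF D(1)] dicyc_card[OF xs(1)] xs(2) by auto
    show "set (concat [hs @ A @ xs, B]) = \<Union>{C, D} \<union> H"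
      using hs(2) AB(2) xs(2) by auto
  qed (use CF D in auto)
qed

text \<open>Crossing arcs merge \<open>C\<close> and \<open>D\<close> into one cycle, and
  \<open>H\<close>, now long enough to be a cycle of the family, makes up for the lost one.\<close>

lemma no_crossing:
  assumes "3 \<le> card H" "C \<in> F" "D \<in> F" "C \<noteq> D"
    and "dicyc E ys" "set ys = C" "dicyc E xs" "set xs = D"
    and "E (last ys) (hd xs)"
  shows "\<not> E (last xs) (hd ys)"
proof
  assume e: "E (last xs) (hd ys)"
  obtain u where "u \<in> H" using H_ne by auto
  then obtain hs where hs: "dicyc E hs" "set hs = H" "length hs = card H" by (rule H_cycle)
  have disj: "C \<inter> D = {}" "C \<inter> H = {}" "D \<inter> H = {}"
    using fam_disj[OF fam assms(2-4)] C_sub[OF assms(2)] C_sub[OF assms(3)] WH(1) by blast+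
  have c: "dicyc E (ys @ xs)"
    by (rule dicyc_appendI[OF dicyc_dipath[OF assms(5)] dicyc_dipath[OF assms(7)]])
      (use disj(1) assms(6,8,9) e in simp_all)
  show False
  proof (rule rebuild[of "{C, D}" "[ys @ xs, hs]"])
    show "distinct (concat [ys @ xs, hs])"
      using dipath_distinct[OF dicyc_dipath[OF c]] dipath_distinct[OF dicyc_dipath[OF hs(1)]]
        hs(2) disj assms(6,8) by auto
    show "dicyc E zs \<and> 3 \<le> length zs" if "zs \<in> set [ys @ xs, hs]" for zs
      using that c hs assms(1) C_card[OF assms(2)] dicyc_card[OF assms(5)] assms(6) by auto
  qed (use assms hs in auto)
qed

text \<open>Cut \<open>C\<close> into two segments whose closing arcs are both forbidden by
  \<open>no_chord\<close>; the Ore condition bounds the degrees of these two pairs from below. The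
  same four degrees, paired as a vertex and its successor on \<open>C\<close>, are too small: few
  arcs run inside \<open>C\<close>, none to \<open>H\<close>, and the other cycles do not cross. The
  bound 10 only has to stay below the 12 per cycle available in \<open>H_eq2\<close>.\<close>

lemma no_long_A:
  assumes h: "3 \<le> card H" and C: "typeA C" shows "card C \<le> 10"
proof (rule ccontr)
  assume "\<not> card C \<le> 10"
  then have big: "11 \<le> card C" by simp
  have CF: "C \<in> F" using C by (simp add: typeA_def)
  obtain u where u: "u \<in> H" using H_ne by auto
  define bad where "bad = {c \<in> C. \<not> E u c}"
  have "card bad + outd E C u = card C"
  proof -
    have "card C = card bad + card {c \<in> C. E u c}"
      using C_fin[OF CF] card_Un_disjoint[of bad "{c \<in> C. E u c}"]
      by (subst card_Un_disjoint[symmetric]) (auto simp: bad_def intro: arg_cong[of _ _ card])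
    then show ?thesis by (simp add: outd_def)
  qed
  \<comment> \<open>By \<open>typeA_deg\<close> at most \<open>4 - card H\<close> vertices of
    \<open>C\<close> receive no arc from \<open>u\<close>.\<close>
  then have cbad: "card bad \<le> 1" using typeA_deg[OF C u] h by (auto split: if_splits)
  have finbad: "finite bad" using C_fin[OF CF] by (simp add: bad_def)
  have bad1: "x = y" if "x \<in> bad" "y \<in> bad" for x y
    using cbad that card_le_Suc0_iff_eq[OF finbad] by auto
  have bound: "outd E V v + ind E V (nx v) < card V" if v: "v \<in> C" "E u (nx v)" for v
  proof -
    obtain ys where ys: "cyc_next E nx C ys" "dicyc E ys" "set ys = C" "length ys = card C"
      "last ys = v" "hd ys = nx v" by (rule at[OF CF v(1)])
    have "outd E (set ys) (last ys) \<le> 2"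
    proof (rule end_arcs)
      fix A y B assume AB: "ys = A @ y # B" "A \<noteq> []" "3 \<le> length (y # B)"
      then show "\<not> E (last ys) y"
        using no_chord[OF C, of A "y # B" u] ys(1,6) u v(2) by auto
    qed (use irrefl in auto)
    then have o: "outd E C v \<le> 2" using ys by simp
    \<comment> \<open>An in-neighbour of \<open>nx v\<close> other than \<open>v\<close> and the
      vertex following \<open>nx v\<close> must itself be followed by a vertex that \<open>u\<close>
      misses; otherwise \<open>no_chord\<close> forbids the arc.\<close>
    have "{x \<in> C. E x (nx v)} \<subseteq> {v, ys ! 1} \<union> {x \<in> C. nx x \<in> bad}"
    proof
      fix x assume "x \<in> {x \<in> C. E x (nx v)}"
      then have x: "x \<in> C" "E x (nx v)" by auto
      then obtain A B where "ys = A @ x # B" using ys(3) by (metis split_list)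
      then have AB: "ys = (A @ [x]) @ B" by simp
      show "x \<in> {v, ys ! 1} \<union> {x \<in> C. nx x \<in> bad}"
      proof (rule ccontr)
        assume n: "x \<notin> {v, ys ! 1} \<union> {x \<in> C. nx x \<in> bad}"
        then have B: "B \<noteq> []" using AB ys(5) by auto
        have "length A \<noteq> 0" using AB ys(6) x(2) irrefl by auto
        moreover have "length A \<noteq> 1" using AB n by (auto simp: nth_append)
        ultimately have "3 \<le> length (A @ [x])" by (cases A; cases "tl A") auto
        moreover have "nx x = hd B" using cyc_next_append(1)[of E nx C "A @ [x]" B] ys(1) AB B by auto
        moreover from this have "E u (hd B)"
          using n x(1) imageI[OF x(1), of nx] unfolding nx_C[OF CF] by (auto simp: bad_def)
        moreover have "cyc_next E nx C (B @ A @ [x])"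
          by (rule cyc_next_swap) (use ys(1) AB in simp)
        ultimately have "\<not> E x (hd (A @ [x]))"
          using no_chord[OF C, of B "A @ [x]" u] B u by auto
        moreover have "hd (A @ [x]) = nx v" using AB ys(6) by (cases A) auto
        ultimately show False using x(2) by simp
      qed
    qed
    moreover have "card {x \<in> C. nx x \<in> bad} \<le> 1"
    proof -
      have "x = y" if "x \<in> {x \<in> C. nx x \<in> bad}" "y \<in> {x \<in> C. nx x \<in> bad}" for x y
        using that bad1 nx_W(2) C_sub[OF CF] by (auto dest: inj_onD)
      then show ?thesis using card_le_Suc0_iff_eq[of "{x \<in> C. nx x \<in> bad}"] C_fin[OF CF] by auto
    qed
    moreover have "card ({v, ys ! 1} \<union> {x \<in> C. nx x \<in> bad}) \<le> card {v, ys ! 1} + card {x \<in> C. nx x \<in> bad}"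
      by (rule card_Un_le)
    moreover have "card {v, ys ! 1} \<le> 2" by (simp add: card_insert_if)
    moreover have "ind E C (nx v) \<le> card ({v, ys ! 1} \<union> {x \<in> C. nx x \<in> bad})"
      unfolding outd_def using calculation(1) C_fin[OF CF] by (intro card_mono) auto
    ultimately have i: "ind E C (nx v) \<le> 3" by linarith
    have eq: "\<Union>(F - {C}) = W - C" using fam_remove(3)[OF fam CF] by (simp add: W_def)
    have FC: "fam E 3 (F - {C})" using fam_subset[OF fam] by auto
    have "(\<Sum>D\<in>F - {C}. ind E D (nx v) + outd E D v) \<le> (\<Sum>D\<in>F - {C}. card D)"
    proof (rule sum_mono, rule ccontr)
      fix D assume D: "D \<in> F - {C}" and "\<not> ind E D (nx v) + outd E D v \<le> card D"
      then have lt: "card D < ind E D (nx v) + outd E D v" by simp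
      obtain ds where "dicyc E ds" "set ds = D" using fam D by (auto simp: fam_def hcyc_def)
      then obtain xs where xs: "dicyc E xs" "set xs = D" "E (last xs) (nx v)" "E v (hd xs)"
        by (rule insert_place[OF _ _ lt])
      then show False using no_crossing[OF h CF _ _ ys(2,3) xs(1,2)] D ys by auto
    qed
    then have rest: "outd E (W - C) v + ind E (W - C) (nx v) \<le> card (W - C)"
      using fam_card_Union[OF FC] fam_outd[OF FC] unfolding eq by (simp add: sum.distrib)
    have "outd E H v = 0" using C v by (auto simp: typeA_def intro!: outd_zero)
    moreover have "ind E H (nx v) \<le> card H" using finH by (rule outd_le)
    moreover have "outd E' W x = outd E' C x + outd E' (W - C) x" for E' x
      using outd_split[OF finW C_sub[OF CF]] .
    moreover have "card W = card C + card (W - C)"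
      using C_sub[OF CF] finW C_fin[OF CF] by (metis card_Diff_subset card_mono le_add_diff_inverse)
    ultimately show ?thesis using o i rest big by (simp add: outd_V card_V)
  qed
  \<comment> \<open>With length 3 both segments are long enough to be closed up. Shifting the cut by
    one place avoids the bad vertex, of which there is at most one.\<close>
  have "\<exists>A B. cyc_next E nx C (A @ B) \<and> length A = 3 \<and> hd A \<notin> bad \<and> hd B \<notin> bad"
  proof -
    obtain xs where xs: "cyc_next E nx C xs" using nx[OF CF] by blast
    then have "length xs = card C" "distinct xs" using dicyc_card[of E xs] by (auto simp: cyc_next_def dicyc_def dipath_def)
    then obtain a b c d e r where r: "xs = a # b # c # d # e # r"
      using big by (cases xs; cases "tl xs"; cases "tl (tl xs)"; cases "tl (tl (tl xs))"; cases "tl (tl (tl (tl xs)))") auto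
    have d: "a \<noteq> b" "a \<noteq> e" "d \<noteq> b" "d \<noteq> e" using \<open>distinct xs\<close> r by auto
    show ?thesis
    proof (cases "a \<in> bad \<or> d \<in> bad")
      case True
      then have "b \<notin> bad" "e \<notin> bad" using bad1 d by blast+
      moreover have "cyc_next E nx C ([b, c, d] @ e # r @ [a])"
        using cyc_next_swap[of E nx C "[a]" "b # c # d # e # r"] xs r by simp
      ultimately show ?thesis by (intro exI[of _ "[b, c, d]"] exI[of _ "e # r @ [a]"]) auto
    next
      case False
      then show ?thesis using xs r by (intro exI[of _ "[a, b, c]"] exI[of _ "d # e # r"]) auto
    qed
  qed
  then obtain A B where AB: "cyc_next E nx C (A @ B)" "length A = 3" "hd A \<notin> bad" "hd B \<notin> bad"
    by blast
  have dc: "dicyc E (A @ B)" "set (A @ B) = C" using AB(1) by (auto simp: cyc_next_def)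
  then have lB: "3 \<le> length B" using dicyc_card[OF dc(1)] AB(2) big by auto
  have ne: "A \<noteq> []" "B \<noteq> []" using AB(2) lB by auto
  have dist: "distinct (A @ B)" using dc(1) by (simp add: dicyc_def dipath_def)
  have "set A \<subseteq> C" "set B \<subseteq> C" unfolding dc(2)[symmetric] by auto
  then have in_C: "last A \<in> C" "last B \<in> C" "hd A \<in> C" "hd B \<in> C"
    using hd_in_set[OF ne(1)] hd_in_set[OF ne(2)] last_in_set[OF ne(1)] last_in_set[OF ne(2)] by auto
  have uA: "E u (hd A)" "E u (hd B)" using AB(3,4) in_C by (auto simp: bad_def)
  have n: "nx (last A) = hd B" "nx (last B) = hd A" using cyc_next_append[OF AB(1) ne] by auto
  have "\<not> E (last B) (hd B)" using no_chord[OF C AB(1) ne(1) lB u uA(1)] .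
  moreover have "\<not> E (last A) (hd A)"
    using no_chord[OF C cyc_next_swap[OF AB(1)] ne(2) _ u uA(2)] AB(2) by simp
  moreover have "last B \<noteq> hd B" using dist lB by (cases B) (auto split: if_splits)
  moreover have "last A \<noteq> hd A" using dist AB(2) by (cases A) (auto split: if_splits)
  ultimately have "card V \<le> outd E V (last B) + ind E V (hd B)"
    "card V \<le> outd E V (last A) + ind E V (hd A)"
    using in_C C_sub[OF CF] W_sub by (auto intro!: oreD)
  moreover have "outd E V (last A) + ind E V (hd B) < card V"
    "outd E V (last B) + ind E V (hd A) < card V"
    using bound[OF in_C(1)] bound[OF in_C(2)] n uA by auto
  ultimately show False by linarith
qed

text \<open>For three or four vertices in \<open>H\<close>, every cycle has at most 10 vertices by
  \<open>no_long_A\<close> and its mirror image, so the order is at most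
  \<open>10 * card F + 4\<close>, less than \<open>12 * card F + 3\<close>.\<close>

lemma H_eq2: "card H = 2"
proof (rule ccontr)
  assume "card H \<noteq> 2"
  then have h: "3 \<le> card H" using H_ge2 by simp
  obtain nx' where "heavy (\<lambda>x y. E y x) V F nx'" by (rule heavy_rev)
  then interpret r: heavy "\<lambda>x y. E y x" V F nx' .
  have "card C \<le> 10" if "C \<in> F" for C
  proof (cases "typeA C")
    case True
    then show ?thesis using no_long_A h by simp
  next
    case False
    then have "r.typeA C" using types[OF that] by (auto simp: typeB_def r.typeA_def)
    then show ?thesis using r.no_long_A h by simp
  qed
  then have "card W \<le> (\<Sum>C\<in>F. 10)"
    unfolding W_def fam_card_Union[OF fam] by (intro sum_mono)
  moreover have "card F \<ge> 1" using F_ne fam by (metis One_nat_def Suc_leI card_gt_0_iff fam_def)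
  ultimately show False using H_le4 size by (simp add: card_V)
qed

end

section \<open>Counting arcs between cycles\<close>

lemma card_nth_filter:
  assumes "distinct xs"
  shows "card {x \<in> set xs. Q x} = card {t. t < length xs \<and> Q (xs ! t)}"
proof -
  have "{x \<in> set xs. Q x} = (!) xs ` {t. t < length xs \<and> Q (xs ! t)}"
    by (auto simp: in_set_conv_nth)
  moreover have "inj_on ((!) xs) {t. t < length xs \<and> Q (xs ! t)}"
    using assms by (auto simp: inj_on_def nth_eq_iff_index_eq)
  ultimately show ?thesis by (simp add: card_image)
qed

text \<open>Inside the window \<open>I\<close> lies at or after its minimum and \<open>J\<close> at
  or before it, so together they have at most one element more than the window. Outside only the
  trivial bound is used.\<close>

lemma window_count:
  fixes I J :: "nat set"
  assumes "I \<subseteq> {..<l}" "J \<subseteq> {..<l}" "a \<le> c" "c < l"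
    and no: "\<And>s t. s \<in> I \<Longrightarrow> t \<in> J \<Longrightarrow> a \<le> s \<Longrightarrow> s < t \<Longrightarrow> t \<le> c \<Longrightarrow> False"
  shows "card I + card J + (c - a) \<le> 2 * l"
proof -
  have fin: "finite I" "finite J" using assms(1,2) finite_subset by auto
  have len: "card ({..<l} - {a..c}) = l - (c + 1 - a)"
    using assms(3,4) by (subst card_Diff_subset) auto
  have "card (I - {a..c}) \<le> l - (c + 1 - a)" "card (J - {a..c}) \<le> l - (c + 1 - a)"
    using assms(1,2) len card_mono[of "{..<l} - {a..c}" "I - {a..c}"]
      card_mono[of "{..<l} - {a..c}" "J - {a..c}"] by auto
  moreover have "card I = card (I \<inter> {a..c}) + card (I - {a..c})" "card J = card (J \<inter> {a..c}) + card (J - {a..c})"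
    using fin by (auto simp: card_Int_Diff)
  moreover have "card (I \<inter> {a..c}) + card (J \<inter> {a..c}) \<le> c + 2 - a"
  proof (cases "I \<inter> {a..c} = {}")
    case True
    have "card (J \<inter> {a..c}) \<le> card {a..c}" by (intro card_mono) auto
    then show ?thesis unfolding True by simp
  next
    case False
    define m where "m = Min (I \<inter> {a..c})"
    have m: "m \<in> I" "a \<le> m" "m \<le> c" using Min_in[OF _ False] by (auto simp: m_def)
    have "I \<inter> {a..c} \<subseteq> {m..c}" by (auto simp: m_def)
    then have "card (I \<inter> {a..c}) \<le> card {m..c}" by (intro card_mono) auto
    moreover have "J \<inter> {a..c} \<subseteq> {a..m}" using no[OF m(1) _ m(2)] by (auto simp: not_less[symmetric])
    then have "card (J \<inter> {a..c}) \<le> card {a..m}" by (intro card_mono) auto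
    ultimately show ?thesis using m by simp
  qed
  ultimately show ?thesis using assms(3,4) by linarith
qed

text \<open>All pairs lie in the row and the column of any one of them.\<close>

lemma card_star:
  assumes "finite C" "finite D" "R \<subseteq> C \<times> D"
    and star: "\<And>z y z' y'. (z, y) \<in> R \<Longrightarrow> (z', y') \<in> R \<Longrightarrow> z = z' \<or> y = y'"
  shows "card R \<le> card C + card D"
proof (cases "R = {}")
  case False
  then obtain z y where zy: "(z, y) \<in> R" by auto
  have "R \<subseteq> {z} \<times> D \<union> C \<times> {y}"
  proof
    fix q assume "q \<in> R"
    moreover obtain z' y' where "q = (z', y')" by (cases q)
    ultimately show "q \<in> {z} \<times> D \<union> C \<times> {y}" using star[OF zy, of z' y'] assms(3) by auto
  qed
  then have "card R \<le> card ({z} \<times> D \<union> C \<times> {y})" using assms(1,2) by (intro card_mono) auto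
  also have "\<dots> \<le> card ({z} \<times> D) + card (C \<times> {y})" by (rule card_Un_le)
  finally show ?thesis using assms(1,2) by (simp add: card_cartesian_product)
qed simp

definition arcs :: "('a \<Rightarrow> 'a \<Rightarrow> bool) \<Rightarrow> 'a set \<Rightarrow> 'a set \<Rightarrow> nat" where
  "arcs E C D = (\<Sum>z\<in>C. outd E D z)"

lemma arcs_card:
  assumes "finite C" "finite D"
  shows "arcs E C D = card {(z, y). z \<in> C \<and> y \<in> D \<and> E z y}"
proof -
  have "{(z, y). z \<in> C \<and> y \<in> D \<and> E z y} = (SIGMA z:C. {y \<in> D. E z y})" by auto
  then show ?thesis using assms by (simp add: arcs_def outd_def)
qed

lemma arcs_ind:
  assumes "finite C" "finite D"
  shows "arcs E C D = (\<Sum>y\<in>D. ind E C y)"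
proof -
  have "arcs E C D = (\<Sum>z\<in>C. \<Sum>y\<in>D. if E z y then 1 else 0)"
    using assms by (simp add: arcs_def outd_def sum.If_cases Int_def conj_commute)
  also have "\<dots> = (\<Sum>y\<in>D. \<Sum>z\<in>C. if E z y then 1 else 0)" by (rule sum.swap)
  also have "\<dots> = (\<Sum>y\<in>D. ind E C y)"
    using assms by (simp add: outd_def sum.If_cases Int_def conj_commute)
  finally show ?thesis .
qed

lemma arcs_Union:
  assumes "fam E' m F" "fam E' m G"
  shows "arcs E (\<Union>F) (\<Union>G) = (\<Sum>C\<in>F. \<Sum>D\<in>G. arcs E C D)"
proof -
  have "arcs E (\<Union>F) (\<Union>G) = (\<Sum>C\<in>F. \<Sum>z\<in>C. outd E (\<Union>G) z)"
    unfolding arcs_def using assms(1) fam_cyc_finite[OF assms(1)]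
    by (subst sum.Union_disjoint) (auto simp: fam_def pairwise_def disjnt_def)
  also have "\<dots> = (\<Sum>C\<in>F. \<Sum>z\<in>C. \<Sum>D\<in>G. outd E D z)"
    by (simp add: fam_outd[OF assms(2)])
  also have "\<dots> = (\<Sum>C\<in>F. \<Sum>D\<in>G. arcs E C D)"
    unfolding arcs_def by (subst sum.swap) simp
  finally show ?thesis .
qed

context heavy
begin

section \<open>Arcs between cycles of given types\<close>

lemma A_full: assumes "typeA C" "u \<in> H" "c \<in> C" shows "E u c"
proof -
  have "card C \<le> outd E C u" using typeA_deg[OF assms(1,2)] H_eq2 by simp
  moreover have "finite C" using assms(1) C_fin by (simp add: typeA_def)
  ultimately have "{y \<in> C. E u y} = C" by (intro card_seteq) (auto simp: outd_def)
  then show ?thesis using assms(3) by auto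
qed

lemma B_full: assumes "typeB C" "u \<in> H" "c \<in> C" shows "E c u"
proof -
  have "card C \<le> ind E C u" using typeB_deg[OF assms(1,2)] H_eq2 by simp
  moreover have "finite C" using assms(1) C_fin by (simp add: typeB_def)
  ultimately have "{y \<in> C. E y u} = C" by (intro card_seteq) (auto simp: outd_def)
  then show ?thesis using assms(3) by auto
qed

lemma A_not_B: "typeA C \<Longrightarrow> \<not> typeB C"
proof
  assume C: "typeA C" "typeB C"
  obtain u where u: "u \<in> H" using H_ne by auto
  have "C \<noteq> {}" using C_card C(1) by (force simp: typeA_def)
  then show False using A_full[OF C(1) u] C(2) u by (auto simp: typeB_def)
qed

text \<open>The two vertices of \<open>H\<close> send arcs to all of \<open>C\<close> and receive
  arcs from all of \<open>D\<close>. Each of them closes a cycle that runs along a part of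
  \<open>C\<close>, crosses by one of the two arcs and runs along a part of \<open>D\<close>;
  cutting at the ends of the arcs uses up both cycles.\<close>

lemma no_disjoint_arcs:
  assumes C: "typeA C" and D: "typeB D" and "z \<in> C" "z' \<in> C" "y \<in> D" "y' \<in> D" "E z y" "E z' y'"
  shows "z = z' \<or> y = y'"
proof (rule ccontr)
  assume "\<not> ?thesis"
  then have ne: "z \<noteq> z'" "y \<noteq> y'" by auto
  have CF: "C \<in> F" and DF: "D \<in> F" using C D by (auto simp: typeA_def typeB_def)
  have CD: "C \<noteq> D" using C D A_not_B by auto
  obtain u u' where u: "u \<in> H" "u' \<in> H" "u \<noteq> u'" "H = {u, u'}"
    using H_eq2 by (auto simp: card_2_iff)
  obtain ys where ys: "dicyc E ys" "set ys = C" "last ys = z" by (rule at[OF CF assms(3)])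
  obtain P Q where PQ: "ys = P @ z' # Q" using assms(4) ys(2) by (metis split_list)
  have Q: "Q \<noteq> []" using PQ ys(3) ne(1) by auto
  define X where "X = P @ [z']"
  have X: "ys = X @ Q" "X \<noteq> []" "last X = z'" "last Q = z" using PQ Q ys(3) by (auto simp: X_def)
  obtain xs where xs: "dicyc E xs" "set xs = D" using fam DF by (auto simp: fam_def hcyc_def)
  obtain R S where RS: "xs = R @ y # S" using assms(5) xs(2) by (metis split_list)
  have 1: "dicyc E (y # S @ R)" "set (y # S @ R) = D"
    using dicyc_swap[of E R "y # S"] xs RS by auto
  then have "y' \<in> set (S @ R)" using assms(6) ne(2) by auto
  then obtain S' R' where SR: "S @ R = S' @ y' # R'" by (metis split_list)
  have 2: "dicyc E ((y # S') @ (y' # R'))" "set ((y # S') @ (y' # R')) = D" using 1 SR by auto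
  have 3: "dicyc E (X @ Q)" "set (X @ Q) = C" using X(1) ys by auto
  note sp = dicyc_appendD(1-3)[OF 2(1) list.distinct(2) list.distinct(2)]
  note sq = dicyc_appendD(1-3)[OF 3(1) X(2) Q]
  have disj: "C \<inter> D = {}" "C \<inter> H = {}" "D \<inter> H = {}"
    using fam_disj[OF fam CF DF CD] C_sub[OF CF] C_sub[OF DF] WH(1) by blast+
  have sub: "set X \<subseteq> C" "set Q \<subseteq> C" "set (y # S') \<subseteq> D" "set (y' # R') \<subseteq> D"
    unfolding 2(2)[symmetric] 3(2)[symmetric] by auto
  have cyc: "dicyc E (v # A @ B)"
    if "dipath E A" "dipath E B" "set A \<subseteq> C" "set B \<subseteq> D" "E (last A) (hd B)" "v \<in> H" for v A B
  proof -
    have n: "A \<noteq> []" "B \<noteq> []" using that(1,2) by (auto simp: dipath_def)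
    have m: "hd A \<in> C" "last B \<in> D" using that(3,4) hd_in_set[OF n(1)] last_in_set[OF n(2)] by auto
    have "dipath E (A @ B)" unfolding dipath_append[OF n] using that disj(1) by auto
    then have "dicyc E ([v] @ (A @ B))"
    proof (rule dicyc_appendI[OF dipath_single])
      show "set [v] \<inter> set (A @ B) = {}" using that(3,4,6) disj by auto
      show "E (last [v]) (hd (A @ B))" using A_full[OF C that(6) m(1)] n by simp
      show "E (last (A @ B)) (hd [v])" using B_full[OF D that(6) m(2)] n by simp
    qed
    then show ?thesis by simp
  qed
  have c1: "dicyc E (u # X @ (y' # R'))"
    by (rule cyc) (use sp sq sub X assms(8) u in auto)
  have c2: "dicyc E (u' # Q @ (y # S'))"
    by (rule cyc) (use sp sq sub X assms(7) u in auto)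
  show False
  proof (rule rebuild[of "{C, D}" "[u # X @ (y' # R'), u' # Q @ (y # S')]"])
    show "distinct (concat [u # X @ (y' # R'), u' # Q @ (y # S')])"
      using dipath_distinct[OF dicyc_dipath[OF c1]] dipath_distinct[OF dicyc_dipath[OF c2]]
        sub disj u sp(3) sq(3) by auto
    show "dicyc E zs \<and> 3 \<le> length zs" if "zs \<in> set [u # X @ (y' # R'), u' # Q @ (y # S')]" for zs
      using that c1 c2 X(2) Q by (cases X; cases Q) auto
    show "set (concat [u # X @ (y' # R'), u' # Q @ (y # S')]) = \<Union>{C, D} \<union> H"
      using 2(2) 3(2) u(4) by auto
  qed (use CF DF CD in auto)
qed

lemma arcs_AB: "typeA C \<Longrightarrow> typeB D \<Longrightarrow> arcs E C D \<le> card C + card D"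
proof -
  assume CD: "typeA C" "typeB D"
  then have fin: "finite C" "finite D" using C_fin by (auto simp: typeA_def typeB_def)
  show ?thesis unfolding arcs_card[OF fin]
    by (rule card_star[OF fin]) (use no_disjoint_arcs[OF CD] in auto)
qed

lemma arcs_diag: assumes "typeA C" shows "arcs E C C \<le> 2 * card C"
proof -
  have CF: "C \<in> F" using assms by (simp add: typeA_def)
  obtain u where u: "u \<in> H" using H_ne by auto
  have "outd E C z \<le> 2" if z: "z \<in> C" for z
  proof -
    obtain ys where ys: "cyc_next E nx C ys" "set ys = C" "last ys = z" by (rule at[OF CF z])
    have "outd E (set ys) (last ys) \<le> 2"
    proof (rule end_arcs)
      fix A y B assume AB: "ys = A @ y # B" "A \<noteq> []" "3 \<le> length (y # B)"
      have "hd A \<in> C" using ys(2) AB(1) hd_in_set[OF AB(2)] by auto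
      then have "E u (hd A)" using A_full[OF assms u] by simp
      then show "\<not> E (last ys) y"
        using no_chord[OF assms _ AB(2,3) u] ys(1) AB(1) by simp
    qed (use irrefl in auto)
    then show ?thesis using ys by simp
  qed
  then have "arcs E C C \<le> (\<Sum>z\<in>C. 2)" unfolding arcs_def by (intro sum_mono)
  then show ?thesis by simp
qed

text \<open>The four arcs recombine the outer parts of \<open>C\<close> with the parts of
  \<open>D\<close> into two cycles. The middle part \<open>X2\<close> is joined to \<open>H\<close>
  and a further cycle \<open>B\<close> from \<open>exit_A\<close>, which sends an arc to
  \<open>H\<close> and hence differs from \<open>D\<close>. So three cycles replace three.\<close>

lemma no_double_split:
  assumes C: "typeA C" and D: "typeA D" and CD: "C \<noteq> D"
    and c: "cyc_next E nx C (X1 @ X2 @ X3)" "X1 \<noteq> []" "X2 \<noteq> []" "X3 \<noteq> []"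
    and d: "cyc_next E nx D (Y1 @ Y2)" "Y1 \<noteq> []" "Y2 \<noteq> []"
    and e: "E (last X3) (hd Y1)" "E (last Y2) (hd X1)" "E (last X1) (hd Y2)" "E (last Y1) (hd X3)"
    and len: "3 \<le> length X1 + length Y2" "3 \<le> length X3 + length Y1"
  shows False
proof -
  have CF: "C \<in> F" and DF: "D \<in> F" using C D by (auto simp: typeA_def)
  have dc: "dicyc E (X1 @ X2 @ X3)" "set (X1 @ X2 @ X3) = C"
    and dd: "dicyc E (Y1 @ Y2)" "set (Y1 @ Y2) = D" using c(1) d(1) by (auto simp: cyc_next_def)
  have X23: "X2 @ X3 \<noteq> []" using c(3) by simp
  note s1 = dicyc_appendD(1-3)[OF dc(1) c(2) X23]
  have s2: "dipath E X2" "dipath E X3" "set X2 \<inter> set X3 = {}"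
    using s1(2) unfolding dipath_append[OF c(3,4)] by auto
  note t = dicyc_appendD(1-3)[OF dd(1) d(2,3)]
  obtain u where u: "u \<in> H" using H_ne by auto
  obtain hs where hs: "dicyc E hs" "set hs = H" "last hs = u" by (rule H_cycle[OF u])
  have hne: "hs \<noteq> []" using hs(1) by (auto simp: dicyc_def dipath_def)
  have h0: "hd hs \<in> H" using hd_in_set[OF hne] hs(2) by simp
  have sub: "set X1 \<subseteq> C" "set X2 \<subseteq> C" "set X3 \<subseteq> C" "set Y1 \<subseteq> D" "set Y2 \<subseteq> D"
    unfolding dc(2)[symmetric] dd(2)[symmetric] by auto
  have mem: "hd X2 \<in> C" "last X2 \<in> C" using sub(2) hd_in_set[OF c(3)] last_in_set[OF c(3)] by auto
  obtain B b where B: "B \<in> F" "B \<noteq> C" "b \<in> B" "E b (hd hs)" "E (last X2) (nx b)"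
    by (rule exit_A[OF C mem(2) h0])
  have BD: "B \<noteq> D" using B(3,4) D h0 by (auto simp: typeA_def)
  obtain xs where xs: "dicyc E xs" "set xs = B" "last xs = b" "hd xs = nx b" by (rule at[OF B(1,3)])
  have xne: "xs \<noteq> []" using xs(1) by (auto simp: dicyc_def dipath_def)
  have disj: "C \<inter> D = {}" "C \<inter> H = {}" "D \<inter> H = {}" "C \<inter> B = {}" "D \<inter> B = {}" "B \<inter> H = {}"
  proof -
    show "C \<inter> D = {}" "C \<inter> B = {}" "D \<inter> B = {}"
      using fam_disj[OF fam CF DF CD] fam_disj[OF fam CF B(1)] fam_disj[OF fam DF B(1)] B(2) BD by simp_all
    have "Z \<inter> H = {}" if "Z \<in> F" for Z using C_sub[OF that] WH(1) by blast
    then show "C \<inter> H = {}" "D \<inter> H = {}" "B \<inter> H = {}" using CF DF B(1) by auto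
  qed
  have p: "dipath E (X2 @ xs)"
    unfolding dipath_append[OF c(3) xne]
    using s2(1) dicyc_dipath[OF xs(1)] xs B(5) sub(2) disj(4) by auto
  have k1: "dicyc E (hs @ X2 @ xs)"
  proof (rule dicyc_appendI[OF dicyc_dipath[OF hs(1)] p])
    show "set hs \<inter> set (X2 @ xs) = {}" using hs(2) xs(2) sub(2) disj by auto
    show "E (last hs) (hd (X2 @ xs))" using A_full[OF C u mem(1)] hs(3) c(3) by simp
    show "E (last (X2 @ xs)) (hd hs)" using xs(3) xne B(4) by simp
  qed
  have k2: "dicyc E (X1 @ Y2)"
    by (rule dicyc_appendI[OF s1(1) t(2) _ e(3,2)]) (use sub disj(1) in auto)
  have k3: "dicyc E (X3 @ Y1)"
    by (rule dicyc_appendI[OF s2(2) t(1) _ e(1,4)]) (use sub disj(1) in auto)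
  show False
  proof (rule rebuild[of "{C, D, B}" "[hs @ X2 @ xs, X1 @ Y2, X3 @ Y1]"])
    show "distinct (concat [hs @ X2 @ xs, X1 @ Y2, X3 @ Y1])"
      using dipath_distinct[OF dicyc_dipath[OF k1]] dipath_distinct[OF dicyc_dipath[OF k2]]
        dipath_distinct[OF dicyc_dipath[OF k3]] sub disj hs(2) xs(2) s1(3) s2(3) t(3) by auto
    show "dicyc E zs \<and> 3 \<le> length zs" if "zs \<in> set [hs @ X2 @ xs, X1 @ Y2, X3 @ Y1]" for zs
      using that k1 k2 k3 len C_card[OF B(1)] dicyc_card[OF xs(1)] xs(2) by auto
    show "set (concat [hs @ X2 @ xs, X1 @ Y2, X3 @ Y1]) = \<Union>{C, D, B} \<union> H"
      using dc(2) dd(2) hs(2) xs(2) by auto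
    show "length [hs @ X2 @ xs, X1 @ Y2, X3 @ Y1] = card {C, D, B}" using CD B(2) BD by auto
  qed (use CF DF B in auto)
qed

text \<open>Since \<open>nx\<close> permutes \<open>D\<close>, the heads in \<open>D\<close> may be
  shifted by it. Each summand then collects the arcs usable when \<open>D\<close> is cut open
  between \<open>y\<close> and \<open>nx y\<close>.\<close>

lemma arcs_shift:
  assumes "C \<in> F" "D \<in> F"
  shows "arcs E C D + arcs E D C = (\<Sum>y\<in>D. ind E C (nx y) + outd E C y)"
proof -
  have "inj_on nx D" using nx_W(2) C_sub[OF assms(2)] inj_on_subset by blast
  then have "(\<Sum>y\<in>D. ind E C (nx y)) = (\<Sum>y\<in>nx ` D. ind E C y)" by (simp add: sum.reindex)
  then show ?thesis
    using arcs_ind[of C D E] C_fin assms nx_C[OF assms(2)] by (simp add: arcs_def sum.distrib)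
qed

text \<open>The arcs at \<open>i\<close> and \<open>j\<close> fix one place where \<open>C\<close>
  and \<open>D\<close> cross. For any other cut of \<open>D\<close>, after \<open>y\<close>, an arc
  to \<open>nx y\<close> from position \<open>s\<close> of \<open>C\<close> and an arc from
  \<open>y\<close> to the successor of a later position \<open>t\<close> give the configuration of
  \<open>no_double_split\<close>, unless a new cycle is too short. So \<open>window_count\<close>
  applies to nearly all positions.\<close>

lemma arcs_AA_half:
  assumes C: "typeA C" and D: "typeA D" and CD: "C \<noteq> D"
    and ij: "i \<in> C" "j \<in> D" "E i (nx j)" "E j (nx i)"
  shows "arcs E C D + arcs E D C \<le> card C * card D + 3 * card D + card C"
proof -
  have CF: "C \<in> F" and DF: "D \<in> F" using C D by (auto simp: typeA_def)
  obtain cs where cs: "cyc_next E nx C cs" "dicyc E cs" "set cs = C" "length cs = card C"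
    "last cs = i" "hd cs = nx i" by (rule at[OF CF ij(1)])
  obtain ds where ds: "cyc_next E nx D ds" "set ds = D" "length ds = card D"
    "last ds = j" "hd ds = nx j" by (rule at[OF DF ij(2)])
  have dist: "distinct cs" using cs(2) by (simp add: dicyc_def dipath_def)
  have l3: "3 \<le> card C" "3 \<le> card D" using C_card CF DF by auto
  have main: "ind E C (nx y) + outd E C y \<le> card C + 3" if y: "y \<in> D" "y \<noteq> j" for y
  proof -
    obtain P Q where PQ: "ds = P @ y # Q" using y(1) ds(2) by (metis split_list)
    define Y1 where "Y1 = P @ [y]"
    have Y: "ds = Y1 @ Q" "Y1 \<noteq> []" "Q \<noteq> []" "last Y1 = y" "last Q = j" "hd Y1 = nx j"
      using PQ ds(4,5) y(2) by (auto simp: Y1_def split: if_splits) (cases P; auto)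
    have hQ: "hd Q = nx y" using cyc_next_append(1)[of E nx D Y1 Q] ds(1) Y by simp
    define I where "I = {t. t < length cs \<and> E (cs ! t) (nx y)}"
    define J where "J = {t. t < length cs \<and> E y (nx (cs ! t))}"
    have cI: "ind E C (nx y) = card I"
      unfolding outd_def I_def cs(3)[symmetric] by (rule card_nth_filter[OF dist])
    have "outd E C y = card {p \<in> C. E y (nx p)}"
    proof -
      have "{q \<in> C. E y q} = nx ` {p \<in> C. E y (nx p)}" using nx_C[OF CF] by auto
      moreover have "inj_on nx {p \<in> C. E y (nx p)}" using nx_W(2) C_sub[OF CF] by (auto intro: inj_on_subset)
      ultimately show ?thesis by (simp add: outd_def card_image)
    qed
    also have "\<dots> = card J"
      unfolding J_def cs(3)[symmetric] by (rule card_nth_filter[OF dist])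
    finally have cJ: "outd E C y = card J" .
    have ban: False if st: "s \<in> I" "t \<in> J" "s < t" "t < card C - 1"
      and len: "3 \<le> Suc s + length Q" "3 \<le> card C - 1 - t + length Y1" for s t
    proof -
      define X1 where "X1 = take (Suc s) cs"
      define X2 where "X2 = take (t - s) (drop (Suc s) cs)"
      define X3 where "X3 = drop (Suc t) cs"
      have split: "cs = X1 @ X2 @ X3"
      proof -
        have "X3 = drop (t - s) (drop (Suc s) cs)" using st(3) by (simp add: X3_def)
        then have "X2 @ X3 = drop (Suc s) cs" unfolding X2_def by (simp only: append_take_drop_id)
        then show ?thesis unfolding X1_def by simp
      qed
      have lens: "length X1 = Suc s" "length X2 = t - s" "length X3 = card C - 1 - t"
        using st cs(4) by (auto simp: X1_def X2_def X3_def)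
      then have ne: "X1 \<noteq> []" "X2 \<noteq> []" "X3 \<noteq> []" using st by auto
      have l1: "last X1 = cs ! s" using st cs(4) by (simp add: X1_def take_Suc_conv_app_nth)
      have l2: "last X2 = cs ! t" using ne(2) lens(2) st cs(4) by (simp add: last_conv_nth X2_def)
      have "cyc_next E nx C ((X1 @ X2) @ X3)" using cs(1) split by simp
      from cyc_next_append(1)[OF this] have h3: "hd X3 = nx (cs ! t)" using ne l2 by simp
      have "cyc_next E nx C (X1 @ X2 @ X3)" "cyc_next E nx D (Y1 @ Q)" using cs(1) split ds(1) Y(1) by simp_all
      moreover have "last X3 = i" "hd X1 = nx i" using cs(5,6) split ne by auto
      ultimately show False
        using no_double_split[OF C D CD _ ne _ Y(2,3)] Y l1 h3 hQ st ij len lens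
        by (auto simp: I_def J_def)
    qed
    have sub: "I \<subseteq> {..<card C}" "J \<subseteq> {..<card C}" using cs(4) by (auto simp: I_def J_def)
    \<comment> \<open>In both windows the difference of the ends is \<open>card C - 3\<close>, which
      yields the excess 3. They are placed according to which part of \<open>D\<close> may be a
      single vertex, since the part of \<open>C\<close> joined to it then needs two.\<close>
    show ?thesis
    proof (cases "2 \<le> length Q")
      case True
      have "card I + card J + (card C - 3 - 0) \<le> 2 * card C"
      proof (rule window_count[OF sub])
        fix s t assume "s \<in> I" "t \<in> J" "s < t" "t \<le> card C - 3"
        moreover have "1 \<le> length Y1" using Y(2) by (cases Y1) auto
        ultimately show False using ban[of s t] True l3 by linarith
      qed (use l3 in auto)
      then show ?thesis using cI cJ l3 by linarith
    next
      case False
      then have "2 \<le> length Y1" using ds(3) l3 Y(1) by auto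
      have "card I + card J + (card C - 2 - 1) \<le> 2 * card C"
      proof (rule window_count[OF sub])
        fix s t assume "s \<in> I" "t \<in> J" "1 \<le> s" "s < t" "t \<le> card C - 2"
        moreover have "1 \<le> length Q" using Y(3) by (cases Q) auto
        ultimately show False using ban[of s t] \<open>2 \<le> length Y1\<close> l3 by linarith
      qed (use l3 in auto)
      then show ?thesis using cI cJ l3 by linarith
    qed
  qed
  have "(\<Sum>y\<in>D. ind E C (nx y) + outd E C y) =
      (ind E C (nx j) + outd E C j) + (\<Sum>y\<in>D - {j}. ind E C (nx y) + outd E C y)"
    using C_fin[OF DF] ij(2) by (intro sum.remove)
  \<comment> \<open>The cut after \<open>j\<close> itself is not covered by \<open>main\<close> and
    gets the trivial bound.\<close>
  also have "\<dots> \<le> 2 * card C + (\<Sum>y\<in>D - {j}. card C + 3)"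
  proof (rule add_mono)
    show "ind E C (nx j) + outd E C j \<le> 2 * card C"
      using outd_le[OF C_fin[OF CF], of E j] outd_le[OF C_fin[OF CF], of "\<lambda>x y. E y x" "nx j"] by simp
    show "(\<Sum>y\<in>D - {j}. ind E C (nx y) + outd E C y) \<le> (\<Sum>y\<in>D - {j}. card C + 3)"
      by (rule sum_mono) (use main in blast)
  qed
  also have "\<dots> = 2 * card C + (card D - 1) * (card C + 3)" using C_fin[OF DF] ij(2) by simp
  also have "\<dots> \<le> card C * card D + 3 * card D + card C"
    using l3 by (cases "card D") (auto simp: algebra_simps)
  finally show ?thesis using arcs_shift[OF CF DF] by simp
qed

text \<open>If distinct \<open>C\<close> and \<open>D\<close> cross nowhere,
  \<open>insert_at\<close> bounds every summand of \<open>arcs_shift\<close> by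
  \<open>card C\<close>. Otherwise \<open>arcs_AA_half\<close> and its version with \<open>C\<close>
  and \<open>D\<close> exchanged are averaged to a symmetric bound.\<close>

lemma arcs_AA:
  assumes C: "typeA C" and D: "typeA D"
  shows "arcs E C D + arcs E D C \<le> card C * card D + 2 * card C + 2 * card D"
proof (cases "C = D")
  case True
  then show ?thesis using arcs_diag[OF C] by simp
next
  case CD: False
  have CF: "C \<in> F" and DF: "D \<in> F" using C D by (auto simp: typeA_def)
  show ?thesis
  proof (cases "\<exists>i\<in>C. \<exists>j\<in>D. E i (nx j) \<and> E j (nx i)")
    case True
    then obtain i j where ij: "i \<in> C" "j \<in> D" "E i (nx j)" "E j (nx i)" by auto
    show ?thesis using arcs_AA_half[OF C D CD ij] arcs_AA_half[OF D C CD[symmetric] ij(2,1,4,3)]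
      by (simp add: mult.commute)
  next
    case False
    have "ind E C (nx y) + outd E C y \<le> card C" if y: "y \<in> D" for y
    proof (rule ccontr)
      assume "\<not> ?thesis"
      then have lt: "card C < ind E C (nx y) + outd E C y" by simp
      obtain xs where "cyc_next E nx C xs" using nx[OF CF] by blast
      then obtain x where "x \<in> C" "E x (nx y)" "E y (nx x)" using insert_at[OF _ lt] by metis
      then show False using False y by auto
    qed
    then have "(\<Sum>y\<in>D. ind E C (nx y) + outd E C y) \<le> (\<Sum>y\<in>D. card C)" by (intro sum_mono)
    then show ?thesis using arcs_shift[OF CF DF] by (simp add: mult.commute)
  qed
qed

text \<open>Let the \<open>p\<close> cycles of type A have \<open>a\<close> vertices and the
  \<open>q\<close> cycles of type B have \<open>b <= a\<close>. A vertex of \<open>H\<close> has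
  in-degree at most \<open>b + 1\<close>, so every type A vertex has out-degree at least
  \<open>a + 1\<close>. Counting arcs gives
  \<open>2 * a * (a + 1) <= a * a + (6 * p + 2 * q) * a\<close>, but \<open>2 * a\<close> is at
  least \<open>12 * (p + q) + 1\<close>.\<close>

lemma A_smaller: "card (\<Union>{C\<in>F. typeA C}) < card (\<Union>{C\<in>F. typeB C})"
proof (rule ccontr)
  define FA where "FA = {C\<in>F. typeA C}"
  define FB where "FB = {C\<in>F. typeB C}"
  define p where "p = card FA"
  define q where "q = card FB"
  define a where "a = card (\<Union>FA)"
  define b where "b = card (\<Union>FB)"
  assume "\<not> ?thesis"
  then have ab: "b \<le> a" by (simp add: a_def b_def FA_def FB_def)
  have fA: "fam E 3 FA" and fB: "fam E 3 FB" using fam_subset[OF fam] by (auto simp: FA_def FB_def)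
  have finF: "finite F" "finite FA" "finite FB" using fam fA fB by (auto simp: fam_def)
  have FAB: "F = FA \<union> FB" "FA \<inter> FB = {}" using types A_not_B by (auto simp: FA_def FB_def)
  then have k: "card F = p + q" using finF by (simp add: p_def q_def card_Un_disjoint)
  have a: "a = (\<Sum>C\<in>FA. card C)" and b: "b = (\<Sum>C\<in>FB. card C)"
    using fam_card_Union fA fB by (auto simp: a_def b_def)
  have "(\<Sum>C\<in>FA \<union> FB. card C) = a + b" unfolding a b using finF FAB(2) by (intro sum.union_disjoint)
  then have W: "card W = a + b" using fam_card_Union[OF fam] FAB(1) unfolding W_def by simp
  have "\<Union>(FA \<union> FB) = \<Union>FA \<union> \<Union>FB" by (rule Union_Un_distrib)
  then have WAB: "W = \<Union>FA \<union> \<Union>FB" using FAB(1) unfolding W_def by simp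
  have disjAB: "\<Union>FA \<inter> \<Union>FB = {}"
  proof (rule Int_emptyI)
    fix x assume "x \<in> \<Union>FA" "x \<in> \<Union>FB"
    then obtain C D where "x \<in> C" "C \<in> FA" "x \<in> D" "D \<in> FB" by auto
    then show False using fam_disj[OF fam, of C D] A_not_B by (auto simp: FA_def FB_def)
  qed
  obtain u where u: "u \<in> H" using H_ne by auto
  have "ind E W u \<le> b"
  proof -
    have "{x \<in> W. E x u} \<subseteq> \<Union>FB" using u unfolding WAB by (auto simp: FA_def typeA_def)
    then show ?thesis unfolding outd_def b_def by (rule card_mono[OF fam_finite[OF fB]])
  qed
  moreover have "ind E H u \<le> 1"
    using outd_le_notin[OF finH u, of "\<lambda>x y. E y x"] irrefl H_eq2 by simp
  ultimately have iu: "ind E V u \<le> b + 1" by (simp add: outd_V)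
  have deg: "a + 1 \<le> outd E (\<Union>FA) z + outd E (\<Union>FB) z" if z: "z \<in> \<Union>FA" for z
  proof -
    have no: "\<not> E z w" if "w \<in> H" for w using z that by (auto simp: FA_def typeA_def)
    have zW: "z \<in> W" using z WAB by simp
    have "card V \<le> outd E V z + ind E V u" using no[OF u] zW u WH by (intro oreD) auto
    moreover have "outd E H z = 0" using no by (rule outd_zero)
    moreover have "outd E W z = outd E (\<Union>FA) z + outd E (\<Union>FB) z"
      unfolding WAB by (rule outd_Un[OF fam_finite[OF fA] fam_finite[OF fB] disjAB])
    ultimately show ?thesis using iu W H_eq2 by (simp add: outd_V card_V)
  qed
  have "a * (a + 1) = (\<Sum>z\<in>\<Union>FA. a + 1)" by (simp add: a_def)
  also have "\<dots> \<le> (\<Sum>z\<in>\<Union>FA. outd E (\<Union>FA) z + outd E (\<Union>FB) z)"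
    using deg by (intro sum_mono)
  also have "\<dots> = arcs E (\<Union>FA) (\<Union>FA) + arcs E (\<Union>FA) (\<Union>FB)"
    by (simp add: arcs_def sum.distrib)
  finally have 1: "a * (a + 1) \<le> arcs E (\<Union>FA) (\<Union>FA) + arcs E (\<Union>FA) (\<Union>FB)" .
  have "arcs E (\<Union>FA) (\<Union>FB) \<le> (\<Sum>C\<in>FA. \<Sum>D\<in>FB. card C + card D)"
    unfolding arcs_Union[OF fA fB] by (intro sum_mono arcs_AB) (auto simp: FA_def FB_def)
  also have "\<dots> = q * a + p * b"
    by (simp add: sum.distrib a b p_def q_def sum_distrib_left)
  finally have 2: "arcs E (\<Union>FA) (\<Union>FB) \<le> q * a + p * b" .
  have "2 * arcs E (\<Union>FA) (\<Union>FA) = (\<Sum>C\<in>FA. \<Sum>D\<in>FA. arcs E C D + arcs E D C)"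
  proof -
    have "(\<Sum>C\<in>FA. \<Sum>D\<in>FA. arcs E D C) = (\<Sum>C\<in>FA. \<Sum>D\<in>FA. arcs E C D)" by (rule sum.swap)
    then show ?thesis unfolding arcs_Union[OF fA fA] by (simp add: sum.distrib)
  qed
  also have "\<dots> \<le> (\<Sum>C\<in>FA. \<Sum>D\<in>FA. card C * card D + 2 * card C + 2 * card D)"
    by (intro sum_mono arcs_AA) (auto simp: FA_def)
  also have "\<dots> = a * a + 4 * p * a"
  proof -
    have "(\<Sum>C\<in>FA. \<Sum>D\<in>FA. card C * card D) = a * a" by (simp add: a sum_product)
    moreover have "(\<Sum>C\<in>FA. \<Sum>D\<in>FA. 2 * card C) = 2 * p * a"
    proof -
      have "(\<Sum>C\<in>FA. \<Sum>D\<in>FA. 2 * card C) = (\<Sum>C\<in>FA. (2 * p) * card C)" by (simp add: p_def mult_ac)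
      then show ?thesis unfolding a by (simp only: sum_distrib_left)
    qed
    moreover have "(\<Sum>C\<in>FA. \<Sum>D\<in>FA. 2 * card D) = 2 * p * a"
    proof -
      have "(\<Sum>D\<in>FA. 2 * card D) = 2 * a" unfolding a by (simp only: sum_distrib_left)
      then show ?thesis by (simp add: p_def)
    qed
    ultimately show ?thesis by (simp add: sum.distrib)
  qed
  finally have 3: "2 * arcs E (\<Union>FA) (\<Union>FA) \<le> a * a + 4 * p * a" .
  have "2 * (a * (a + 1)) \<le> 2 * arcs E (\<Union>FA) (\<Union>FA) + 2 * arcs E (\<Union>FA) (\<Union>FB)" using 1 by simp
  also have "\<dots> \<le> a * a + 4 * p * a + 2 * (q * a + p * b)" using 2 3 by (intro add_mono) auto
  also have "\<dots> \<le> a * a + 4 * p * a + 2 * (q * a + p * a)" using ab by simp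
  finally have "a * (a + 2) \<le> a * (6 * p + 2 * q)" by (simp add: algebra_simps)
  moreover have "12 * (p + q) + 1 \<le> 2 * a" using size W H_eq2 ab k by (simp add: card_V)
  then have "a * (6 * p + 2 * q) < a * (a + 2)" by (intro mult_strict_left_mono) auto
  ultimately show False by simp
qed

text \<open>Reversal exchanges the types, so \<open>A_smaller\<close> would hold in both
  directions.\<close>

lemma contradiction: False
proof -
  obtain nx' where "heavy (\<lambda>x y. E y x) V F nx'" by (rule heavy_rev)
  then interpret r: heavy "\<lambda>x y. E y x" V F nx' .
  have "r.typeA C = typeB C" "r.typeB C = typeA C" for C
    by (auto simp: typeA_def typeB_def r.typeA_def r.typeB_def)
  then show False using A_smaller r.A_smaller by simp
qed

end

section \<open>Disjoint short cycles\<close>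

definition short_fam :: "('a \<Rightarrow> 'a \<Rightarrow> bool) \<Rightarrow> 'a set \<Rightarrow> 'a set set \<Rightarrow> bool" where
  "short_fam E U F \<longleftrightarrow> fam E 3 F \<and> (\<forall>C\<in>F. card C \<le> 4) \<and> \<Union>F \<subseteq> U"

lemma card_two_points:
  assumes "finite S" "2 \<le> card S" shows "\<exists>c\<in>S. c \<noteq> d"
proof (rule ccontr)
  assume "\<not> ?thesis"
  then have "S \<subseteq> {d}" by auto
  then show False using assms card_mono[of "{d}" S] by auto
qed

lemma dicyc3: "E x y \<Longrightarrow> E y z \<Longrightarrow> E z x \<Longrightarrow> distinct [x, y, z] \<Longrightarrow> dicyc E [x, y, z]"
  by (simp add: dicyc_def dipath_def)

lemma dicyc4:
  "E x y \<Longrightarrow> E y z \<Longrightarrow> E z w \<Longrightarrow> E w x \<Longrightarrow> distinct [x, y, z, w] \<Longrightarrow> dicyc E [x, y, z, w]"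
  by (simp add: dicyc_def dipath_def)

text \<open>The vertices \<open>R\<close> missed by a largest family of short cycles, with a part \<open>R1\<close> that
  contains no path whose ends have few arcs into \<open>R\<close>.\<close>

locale residue =
  fixes E :: "'a \<Rightarrow> 'a \<Rightarrow> bool" and R R1 :: "'a set" and k :: nat
  assumes finR: "finite R" and R1: "R1 \<subseteq> R" and irrefl: "\<not> E x x"
    and k: "2 \<le> k" and size: "5 * k + 12 \<le> card R1"
    and no_cycle: "dicyc E zs \<Longrightarrow> set zs \<subseteq> R \<Longrightarrow> 3 \<le> length zs \<Longrightarrow> length zs \<le> 4 \<Longrightarrow> False"
    and ends: "dipath E P \<Longrightarrow> set P \<subseteq> R1 \<Longrightarrow> 2 \<le> length P \<Longrightarrow> length P \<le> 3 \<Longrightarrow>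
      \<not> E (last P) (hd P) \<Longrightarrow> card R < outd E R (last P) + ind E R (hd P) + k + 4"
begin

section \<open>Digraphs without cycles of length 3 and 4\<close>

lemma finR1: "finite R1"
  using finR R1 finite_subset by blast

lemma residue_rev: "residue (\<lambda>x y. E y x) R R1 k"
proof (rule residue.intro)
  show False if "dicyc (\<lambda>x y. E y x) zs" "set zs \<subseteq> R" "3 \<le> length zs" "length zs \<le> 4" for zs
    using no_cycle[of "rev zs"] that dicyc_rev[of "\<lambda>x y. E y x" zs] by simp
  show "card R < ind E R (last P) + outd E R (hd P) + k + 4"
    if "dipath (\<lambda>x y. E y x) P" "set P \<subseteq> R1" "2 \<le> length P" "length P \<le> 3" "\<not> E (hd P) (last P)" for P
  proof -
    have "P \<noteq> []" using that(3) by auto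
    then show ?thesis
      using ends[of "rev P"] that dipath_rev[of "\<lambda>x y. E y x" P] by (simp add: hd_rev last_rev)
  qed
qed (use finR R1 irrefl k size in auto)

text \<open>The out-neighbours \<open>X\<close> of \<open>x\<close> are nearly complete to one
  another: for \<open>z\<close> in \<open>X\<close> the path \<open>y\<close>, \<open>x\<close>,
  \<open>z\<close> has ends of large degree by \<open>ends\<close>, and the out-neighbours of
  \<open>z\<close> avoid the in-neighbours of \<open>y\<close>, as there is no cycle of length 4.
  With at least \<open>2 * k + 5\<close> vertices, such a set contains a cycle of length 3.\<close>

lemma large_out:
  assumes xy: "x \<in> R1" "y \<in> R1" "E y x" "\<not> E x y" and big: "2 * k + 5 \<le> outd E R1 x"
  shows False
proof -
  define X where "X = {z \<in> R1. E x z}"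
  define B where "B = {z \<in> R. E z y}"
  have finX: "finite X" and finB: "finite B" using finR1 finR by (auto simp: X_def B_def)
  have ne: "x \<noteq> y" using xy by auto
  have XR: "X \<subseteq> R" and xR: "x \<in> R" "y \<in> R" using R1 xy by (auto simp: X_def)
  have XB: "X \<inter> B = {}"
  proof (rule Int_emptyI)
    fix z assume z: "z \<in> X" "z \<in> B"
    then show False using no_cycle[OF dicyc3[of E y x z]] xy xR XR irrefl by (auto simp: X_def B_def)
  qed
  have deg: "card X \<le> outd E X z + k + 2" if z: "z \<in> X" for z
  proof -
    have zy: "z \<noteq> y" "z \<noteq> x" "E x z" "z \<in> R1" using z xy irrefl by (auto simp: X_def)
    have nzy: "\<not> E z y" using XB z XR by (auto simp: B_def)
    have "dipath E [y, x, z]" using zy ne xy by (simp add: dipath_def)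
    then have big: "card R < outd E R z + ind E R y + k + 4"
      using ends[of "[y, x, z]"] zy nzy xy by simp
    have no: "\<not> E z w" if "w \<in> B" for w
    proof
      assume w: "E z w"
      have "E w y" "w \<in> R" using that by (auto simp: B_def)
      then show False using no_cycle[OF dicyc4[of E y x z w]] w xy xR zy ne z XR irrefl by auto
    qed
    let ?N = "{w \<in> R. E z w}"
    let ?A = "X - ?N - {z}"
    have "?A \<inter> ?N = {}" "?A \<inter> B = {}" "?N \<inter> B = {}" using XB no by auto
    then have "card (?A \<union> ?N \<union> B) = card ?A + outd E R z + ind E R y"
      using finX finR finB by (simp add: card_Un_disjoint Int_Un_distrib2 outd_def B_def)
    moreover have "?A \<union> ?N \<union> B \<subseteq> R - {y, z}" using XR nzy xy irrefl XB z by (auto simp: B_def X_def)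
    then have "card (?A \<union> ?N \<union> B) \<le> card (R - {y, z})" using finR by (intro card_mono) auto
    moreover have "card (R - {y, z}) = card R - 2" using zy(1) xR z XR finR by (simp add: card_Diff_subset subset_iff)
    moreover have "2 \<le> card R" using zy(1) xR z XR finR card_mono[of R "{y, z}"] by auto
    ultimately have "card ?A \<le> k + 1" using big by linarith
    moreover have "X \<subseteq> ?A \<union> {w \<in> X. E z w} \<union> {z}" using XR by auto
    then have "card X \<le> card (?A \<union> {w \<in> X. E z w} \<union> {z})" using finX by (intro card_mono) auto
    moreover have "\<dots> \<le> card ?A + outd E X z + 1"
      unfolding outd_def by (intro order_trans[OF card_Un_le] add_mono card_Un_le) auto
    ultimately show ?thesis by linarith
  qed
  have sX: "2 * k + 5 \<le> card X" using big by (simp add: outd_def X_def)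
  \<comment> \<open>In-degrees and out-degrees inside \<open>X\<close> have the same sum, so some
    vertex has a large in-degree as well.\<close>
  obtain z0 where z0: "z0 \<in> X" "card X \<le> ind E X z0 + k + 2"
  proof (rule ccontr)
    assume n: "\<not> thesis"
    have "(\<Sum>z\<in>X. ind E X z + k + 2) < (\<Sum>z\<in>X. card X)"
      using that n sX finX by (intro sum_strict_mono) (auto simp: not_le[symmetric])
    also have "\<dots> \<le> (\<Sum>z\<in>X. outd E X z + k + 2)" using deg by (intro sum_mono) auto
    also have "\<dots> = (\<Sum>z\<in>X. ind E X z + k + 2)"
      using arcs_ind[OF finX finX, of E] unfolding arcs_def sum.distrib by (simp only:)
    finally show False by simp
  qed
  have "outd E X z0 \<noteq> 0" using deg[OF z0(1)] sX by linarith
  then obtain z1 where z1: "z1 \<in> X" "E z0 z1" unfolding outd_def by (metis (no_types, lifting) card.empty empty_Collect_eq)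
  have "{w \<in> X. E z1 w} \<inter> {w \<in> X. E w z0} \<noteq> {}"
  proof
    assume e: "{w \<in> X. E z1 w} \<inter> {w \<in> X. E w z0} = {}"
    have "outd E X z1 + ind E X z0 = card ({w \<in> X. E z1 w} \<union> {w \<in> X. E w z0})"
      unfolding outd_def using e finX by (intro card_Un_disjoint[symmetric]) auto
    also have "\<dots> \<le> card X" using finX by (intro card_mono) auto
    finally show False using deg[OF z1(1)] z0(2) sX by linarith
  qed
  then obtain z2 where "z2 \<in> X" "E z1 z2" "E z2 z0" by auto
  then show False using no_cycle[OF dicyc3[of E z0 z1 z2]] z0(1) z1 XR irrefl by auto
qed

text \<open>No \<open>c\<close> closes a triangle with a one-way arc, so outside \<open>R1\<close>
  the two ends have few arcs and their degrees inside \<open>R1\<close> add up to at least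
  \<open>card R1 - k - 3\<close>. This is at least \<open>4 * k + 9\<close>, so one of them reaches
  \<open>2 * k + 5\<close>, as needed for \<open>large_out\<close> or its mirror image.\<close>

lemma sym:
  assumes xy: "x \<in> R1" "y \<in> R1" "E y x" shows "E x y"
proof (rule ccontr)
  assume n: "\<not> E x y"
  have ne: "x \<noteq> y" using xy irrefl by auto
  have big: "card R < outd E R x + ind E R y + k + 4"
    using ends[of "[y, x]"] xy n ne by (simp add: dipath_def)
  have "outd E (R - R1) x + ind E (R - R1) y \<le> card (R - R1)"
  proof -
    have "outd E (R - R1) x + ind E (R - R1) y = card ({c \<in> R - R1. E x c} \<union> {c \<in> R - R1. E c y})"
      unfolding outd_def
    proof (rule card_Un_disjoint[symmetric])
      show "{c \<in> R - R1. E x c} \<inter> {c \<in> R - R1. E c y} = {}"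
      proof (rule Int_emptyI)
        fix c assume "c \<in> {c \<in> R - R1. E x c}" "c \<in> {c \<in> R - R1. E c y}"
        then show False using no_cycle[OF dicyc3[of E y x c]] xy n ne R1 irrefl by auto
      qed
    qed (use finR in auto)
    also have "\<dots> \<le> card (R - R1)" using finR by (intro card_mono) auto
    finally show ?thesis .
  qed
  then have "card R1 \<le> outd E R1 x + ind E R1 y + k + 3"
    using big outd_split[OF finR R1, of E x] outd_split[OF finR R1, of "\<lambda>x y. E y x" y]
      card_Diff_subset[OF finR1 R1] card_mono[OF finR R1] by linarith
  then have "2 * k + 5 \<le> outd E R1 x \<or> 2 * k + 5 \<le> ind E R1 y" using size by linarith
  then show False
  proof
    assume "2 * k + 5 \<le> outd E R1 x" then show False using large_out[OF xy n] by simp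
  next
    assume b: "2 * k + 5 \<le> ind E R1 y"
    interpret r: residue "\<lambda>x y. E y x" R R1 k by (rule residue_rev)
    show False using r.large_out[of y x] xy n b by simp
  qed
qed

text \<open>By \<open>sym\<close>, \<open>z'\<close>, \<open>x\<close>, \<open>z\<close> is a path.
  An arc between \<open>z\<close> and \<open>z'\<close> would give a cycle of length 3, a second
  common neighbour one of length 4.\<close>

lemma nbrs:
  assumes z: "x \<in> R1" "z \<in> R1" "z' \<in> R1" "E x z" "E x z'" "z \<noteq> z'"
  shows "card R1 \<le> outd E R1 z + outd E R1 z' + k + 3"
    "{w \<in> R1. E z w} \<inter> {w \<in> R1. E z' w} = {x}"
proof -
  have s: "E z x" "E z' x" using z sym by auto
  have ne: "z \<noteq> x" "z' \<noteq> x" using z irrefl by auto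
  have inR: "x \<in> R" "z \<in> R" "z' \<in> R" using z R1 by auto
  have n: "\<not> E z z'" using no_cycle[OF dicyc3[of E x z z']] z s ne inR by auto
  have common: "c = x" if "c \<in> R" "E z c" "E c z'" for c
    using no_cycle[OF dicyc4[of E x z c z']] that z s ne inR n irrefl by auto
  have big: "card R < outd E R z + ind E R z' + k + 4"
    using ends[of "[z', x, z]"] z s n ne by (simp add: dipath_def)
  have "outd E (R - R1) z + ind E (R - R1) z' \<le> card (R - R1)"
  proof -
    have "outd E (R - R1) z + ind E (R - R1) z' = card ({c \<in> R - R1. E z c} \<union> {c \<in> R - R1. E c z'})"
      unfolding outd_def
      by (rule card_Un_disjoint[symmetric]) (use finR common z(1) in auto)
    also have "\<dots> \<le> card (R - R1)" using finR by (intro card_mono) auto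
    finally show ?thesis .
  qed
  then have "card R1 \<le> outd E R1 z + ind E R1 z' + k + 3"
    using big outd_split[OF finR R1, of E z] outd_split[OF finR R1, of "\<lambda>x y. E y x" z']
      card_Diff_subset[OF finR1 R1] card_mono[OF finR R1] by linarith
  moreover have "{w \<in> R1. E w z'} = {w \<in> R1. E z' w}" using sym z(3) by auto
  ultimately show "card R1 \<le> outd E R1 z + outd E R1 z' + k + 3" by (simp add: outd_def)
  show "{w \<in> R1. E z w} \<inter> {w \<in> R1. E z' w} = {x}"
  proof
    show "{w \<in> R1. E z w} \<inter> {w \<in> R1. E z' w} \<subseteq> {x}"
      using common sym[OF _ z(3)] R1 by blast
  qed (use s z(1) in simp)
qed

text \<open>Two neighbours of \<open>x\<close> have large degrees by \<open>nbrs\<close>, so some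
  \<open>v\<close> has three neighbours. Their neighbourhoods meet only in \<open>v\<close>, and
  adding the three bounds of \<open>nbrs\<close> gives \<open>card R1 <= 3 * k + 15\<close>, less
  than \<open>5 * k + 12\<close> for \<open>k >= 2\<close>.\<close>

lemma out_le_1:
  assumes "x \<in> R1" shows "outd E R1 x \<le> 1"
proof (rule ccontr)
  assume "\<not> ?thesis"
  then obtain z z' where z: "z \<in> R1" "z' \<in> R1" "E x z" "E x z'" "z \<noteq> z'"
    unfolding outd_def using finR1 card_le_Suc0_iff_eq[of "{y \<in> R1. E x y}"] by auto
  have "3 \<le> outd E R1 z \<or> 3 \<le> outd E R1 z'" using nbrs(1)[OF assms z] size by linarith
  then obtain v where v: "v \<in> R1" "3 \<le> outd E R1 v" using z by auto
  then obtain T where "T \<subseteq> {y \<in> R1. E v y}" "card T = 3"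
    unfolding outd_def by (meson obtain_subset_with_card_n)
  then obtain a b c where abc: "a \<in> R1" "b \<in> R1" "c \<in> R1" "E v a" "E v b" "E v c"
    "a \<noteq> b" "a \<noteq> c" "b \<noteq> c" by (auto simp: card_3_iff)
  let ?N = "\<lambda>z. {w \<in> R1. E z w}"
  note ab = nbrs[OF v(1) abc(1,2,4,5,7)] and ac = nbrs[OF v(1) abc(1,3,4,6,8)]
    and bc = nbrs[OF v(1) abc(2,3,5,6,9)]
  have vN: "v \<in> ?N a" "v \<in> ?N b" "v \<in> ?N c" using ab(2) ac(2) by auto
  have "card ((?N a - {v}) \<union> (?N b - {v}) \<union> (?N c - {v})) \<le> card R1"
    using finR1 by (intro card_mono) auto
  moreover have "card ((?N a - {v}) \<union> (?N b - {v}) \<union> (?N c - {v})) =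
      card (?N a - {v}) + card (?N b - {v}) + card (?N c - {v})"
  proof -
    have "(?N a - {v}) \<inter> (?N b - {v}) = {}" "((?N a - {v}) \<union> (?N b - {v})) \<inter> (?N c - {v}) = {}"
      using ab(2) ac(2) bc(2) by blast+
    then show ?thesis using finR1 by (simp add: card_Un_disjoint)
  qed
  moreover have *: "outd E R1 w = Suc (card (?N w - {v}))" if "v \<in> ?N w" for w
    unfolding outd_def using that finR1 by (intro card.remove) auto
  ultimately show False
    using ab(1) ac(1) bc(1) *[OF vN(1)] *[OF vN(2)] *[OF vN(3)] size k by linarith
qed

end

text \<open>\<open>Y\<close> stands for the vertices to be avoided, the ends of the light path and
  the return path. A largest family of short cycles with fewer than \<open>k - 1\<close> members is
  assumed and refuted.\<close>

locale packing =
  fixes E :: "'a \<Rightarrow> 'a \<Rightarrow> bool" and V Y :: "'a set" and k :: nat and F :: "'a set set"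
  assumes ore: "ore E V" and Y: "Y \<subseteq> V" "card Y \<le> 5" and size: "12 * k + 3 \<le> card V"
    and F: "short_fam E (V - Y) F" and few: "card F + 2 \<le> k"
    and most: "\<And>F'. short_fam E (V - Y) F' \<Longrightarrow> card F' \<le> card F"
begin

section \<open>A largest family of short cycles and the vertices it misses\<close>

definition "R = V - Y - \<Union>F"

lemma fam: "fam E 3 F" and F_sub: "\<Union>F \<subseteq> V - Y" and F_card: "C \<in> F \<Longrightarrow> card C \<le> 4"
  using F by (auto simp: short_fam_def)

lemma finV: "finite V" and finY: "finite Y" and finF: "finite F" and finR: "finite R"
  and irrefl: "\<not> E x x"
  using ore Y fam by (auto simp: ore_def fam_def R_def intro: finite_subset)

lemma outd_V: "outd E' V x = outd E' Y x + outd E' R x + (\<Sum>C\<in>F. outd E' C x)"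
proof -
  have "outd E' (V - Y) x = outd E' (\<Union>F) x + outd E' R x"
    unfolding R_def using finV F_sub by (intro outd_split) auto
  then show ?thesis using outd_split[OF finV Y(1), of E' x] fam_outd[OF fam, of E' x] by simp
qed

lemma card_V: "card V = card Y + card R + (\<Sum>C\<in>F. card C)"
proof -
  have "card V = card Y + card (V - Y)" using Y(1) finV finY by (simp add: card_Diff_subset card_mono)
  moreover have "card (V - Y) = card (\<Union>F) + card R"
    unfolding R_def using F_sub finV fam_finite[OF fam] by (simp add: card_Diff_subset card_mono)
  ultimately show ?thesis using fam_card_Union[OF fam] by simp
qed

lemma card_R: "8 * k + 6 \<le> card R"
proof -
  have "(\<Sum>C\<in>F. card C) \<le> card F * 4" using sum_bounded_above[of F card 4] F_card by simp
  then show ?thesis using card_V Y(2) size few by linarith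
qed

lemma no_cycle:
  assumes "dicyc E zs" "set zs \<subseteq> R" "3 \<le> length zs" "length zs \<le> 4"
  shows False
proof -
  have d: "set zs \<inter> \<Union>F = {}" using assms(2) by (auto simp: R_def)
  note i = fam_insert[OF fam assms(1,3) d]
  have "short_fam E (V - Y) (insert (set zs) F)"
    using i(1,3) F_sub F_card assms(2,4) dicyc_card[OF assms(1)] by (auto simp: short_fam_def R_def)
  then show False using most i(2) by fastforce
qed

text \<open>The slack \<open>k + 4\<close> exceeds \<open>card Y + card F\<close>, which is at most
  \<open>5 + (k - 2)\<close>. So the degree missing in \<open>R\<close> must be found on the cycles
  of \<open>F\<close>, with an average excess of more than one per cycle.\<close>

definition good :: "'a list \<Rightarrow> bool" where
  "good P \<longleftrightarrow> dipath E P \<and> set P \<subseteq> R \<and> 2 \<le> length P \<and> length P \<le> 3 \<and> \<not> E (last P) (hd P) \<and>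
     outd E R (last P) + ind E R (hd P) + k + 4 \<le> card R"

lemma good_hits:
  assumes "good P"
  obtains C where "C \<in> F" "2 \<le> card {c \<in> C. E (last P) c \<and> E c (hd P)}"
proof -
  let ?x = "last P" and ?y = "hd P"
  have P: "dipath E P" "set P \<subseteq> R" "2 \<le> length P" "\<not> E ?x ?y"
    "outd E R ?x + ind E R ?y + k + 4 \<le> card R" using assms by (auto simp: good_def)
  have ne: "P \<noteq> []" using P(3) by auto
  have "?x \<noteq> ?y" using P(1,3) by (cases P) (auto simp: dipath_def)
  moreover have "?x \<in> V" "?y \<in> V" using P(2) hd_in_set[OF ne] last_in_set[OF ne] unfolding R_def by blast+
  ultimately have V: "card V \<le> outd E V ?x + ind E V ?y" using ore P(4) by (auto simp: ore_def)
  have "\<exists>C\<in>F. 2 \<le> card {c \<in> C. E ?x c \<and> E c ?y}"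
  proof (rule ccontr)
    assume no: "\<not> ?thesis"
    have "outd E C ?x + ind E C ?y \<le> card C + 1" if C: "C \<in> F" for C
    proof -
      have fin: "finite C" using fam_cyc_finite[OF fam C] .
      have "outd E C ?x + ind E C ?y = card ({c \<in> C. E ?x c} \<union> {c \<in> C. E c ?y}) +
          card ({c \<in> C. E ?x c} \<inter> {c \<in> C. E c ?y})"
        unfolding outd_def using fin by (intro card_Un_Int) auto
      moreover have "card ({c \<in> C. E ?x c} \<union> {c \<in> C. E c ?y}) \<le> card C"
        using fin by (intro card_mono) auto
      moreover have "{c \<in> C. E ?x c} \<inter> {c \<in> C. E c ?y} = {c \<in> C. E ?x c \<and> E c ?y}" by auto
      ultimately show ?thesis using no C by (auto simp: not_le)
    qed
    then have "(\<Sum>C\<in>F. outd E C ?x + ind E C ?y) \<le> (\<Sum>C\<in>F. card C + 1)" by (intro sum_mono)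
    then have "(\<Sum>C\<in>F. outd E C ?x) + (\<Sum>C\<in>F. ind E C ?y) \<le> (\<Sum>C\<in>F. card C) + card F"
      by (simp only: sum.distrib) simp
    then show False
      using V P(5) outd_V[of E ?x] outd_V[of "\<lambda>x y. E y x" ?y] card_V Y(2) few
        outd_le[OF finY, of E ?x] outd_le[OF finY, of "\<lambda>x y. E y x" ?y] by linarith
  qed
  then show ?thesis using that by auto
qed

lemma good_close:
  assumes "good P" "C \<in> F" "c \<in> C" "E (last P) c" "E c (hd P)"
  shows "dicyc E (P @ [c])" "3 \<le> length (P @ [c])" "length (P @ [c]) \<le> 4" "set P \<inter> \<Union>F = {}" "set P \<subseteq> V - Y"
proof -
  show s: "set P \<inter> \<Union>F = {}" "set P \<subseteq> V - Y" using assms(1) by (auto simp: good_def R_def)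
  show "dicyc E (P @ [c])"
    by (rule dicyc_appendI) (use assms s in \<open>auto simp: good_def\<close>)
qed (use assms(1) in \<open>auto simp: good_def\<close>)

text \<open>Closing \<open>P\<close> and \<open>Q\<close> through two different vertices of
  \<open>C\<close> gives two short cycles in place of one, against the choice of
  \<open>F\<close>.\<close>

lemma two_good:
  assumes P: "good P" "good Q" "set P \<inter> set Q = {}" and C: "C \<in> F"
    and "2 \<le> card {c \<in> C. E (last P) c \<and> E c (hd P)}" "2 \<le> card {c \<in> C. E (last Q) c \<and> E c (hd Q)}"
  shows False
proof -
  have fin: "finite C" using fam_cyc_finite[OF fam C] .
  obtain c where c: "c \<in> C" "E (last P) c" "E c (hd P)"
    using card_two_points[OF _ assms(5), of undefined] fin by auto
  obtain d where d: "d \<in> C" "E (last Q) d" "E d (hd Q)" "d \<noteq> c"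
    using card_two_points[OF _ assms(6), of c] fin by auto
  note cp = good_close[OF P(1) C c] and dq = good_close[OF P(2) C d(1-3)]
  note rm = fam_remove[OF fam C]
  have 1: "set (P @ [c]) \<inter> \<Union>(F - {C}) = {}" using cp(4) c(1) rm(3) by auto
  note i1 = fam_insert[OF rm(1) cp(1,2) 1]
  have 2: "set (Q @ [d]) \<inter> \<Union>(insert (set (P @ [c])) (F - {C})) = {}"
    unfolding i1(3) rm(3) using cp(4) dq(4) c(1) d(1,4) P(3) C by auto
  note i2 = fam_insert[OF i1(1) dq(1,2) 2]
  have "short_fam E (V - Y) (insert (set (Q @ [d])) (insert (set (P @ [c])) (F - {C})))"
    unfolding short_fam_def i2(3) i1(3) rm(3)
  proof (intro conjI ballI)
    show "card D \<le> 4" if "D \<in> insert (set (Q @ [d])) (insert (set (P @ [c])) (F - {C}))" for D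
      using that F_card dicyc_card[OF cp(1)] dicyc_card[OF dq(1)] cp(3) dq(3) by auto
    show "set (Q @ [d]) \<union> (set (P @ [c]) \<union> (\<Union>F - C)) \<subseteq> V - Y"
      using F_sub cp(5) dq(5) c(1) d(1) C by auto
  qed (rule i2(1))
  from most[OF this] show False using i2(2) i1(2) rm(2) by simp
qed

lemma few_good:
  assumes "\<And>P. P \<in> PS \<Longrightarrow> good P" "pairwise (\<lambda>P Q. set P \<inter> set Q = {}) PS"
  shows "finite PS \<and> card PS \<le> card F"
proof -
  have "\<forall>P\<in>PS. \<exists>C. C \<in> F \<and> 2 \<le> card {c \<in> C. E (last P) c \<and> E c (hd P)}"
    using good_hits assms(1) by metis
  then obtain f where f: "\<And>P. P \<in> PS \<Longrightarrow> f P \<in> F \<and> 2 \<le> card {c \<in> f P. E (last P) c \<and> E c (hd P)}"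
    by metis
  have "inj_on f PS"
  proof (rule inj_onI, rule ccontr)
    fix P Q assume PQ: "P \<in> PS" "Q \<in> PS" "f P = f Q" "P \<noteq> Q"
    then have "set P \<inter> set Q = {}" using assms(2) by (auto simp: pairwise_def)
    then show False using two_good[of P Q "f P"] assms(1) f[of P] f[of Q] PQ by auto
  qed
  moreover have "f ` PS \<subseteq> F" using f by auto
  ultimately show ?thesis using finF inj_on_finite card_inj_on_le by metis
qed

text \<open>Delete a largest set of disjoint good paths: these are at most \<open>k - 2\<close>, of
  at most three vertices each, so at least \<open>8 * k + 6 - 3 * (k - 2) = 5 * k + 12\<close>
  vertices are left and no good path among them.\<close>

lemma residue_exists: "\<exists>R1. residue E R R1 k"
proof -
  let ?Q = "\<lambda>PS. (\<forall>P\<in>PS. good P) \<and> pairwise (\<lambda>P Q. set P \<inter> set Q = {}) PS"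
  have "?Q {}" by simp
  moreover have "\<forall>PS. ?Q PS \<longrightarrow> card PS < Suc (card F)" using few_good by (simp add: less_Suc_eq_le)
  ultimately obtain PS where PS: "?Q PS" and max: "\<forall>PS'. ?Q PS' \<longrightarrow> card PS' \<le> card PS"
    using ex_has_greatest_nat[of ?Q "{}" card "Suc (card F)"] by blast
  have fin: "finite PS" "card PS \<le> card F" using few_good PS by auto
  define D where "D = (\<Union>P\<in>PS. set P)"
  have "card D \<le> (\<Sum>P\<in>PS. card (set P))" unfolding D_def using fin(1) by (rule card_UN_le)
  also have "\<dots> \<le> (\<Sum>P\<in>PS. 3)"
    using PS by (intro sum_mono order_trans[OF card_length]) (auto simp: good_def)
  finally have D: "card D \<le> 3 * card PS" by simp
  have finD: "finite D" using fin(1) by (simp add: D_def)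
  have "residue E R (R - D) k"
  proof
    show "5 * k + 12 \<le> card (R - D)" using card_R D fin(2) few diff_card_le_card_Diff[OF finD, of R] by linarith
    show "card R < outd E R (last P) + ind E R (hd P) + k + 4"
      if P: "dipath E P" "set P \<subseteq> R - D" "2 \<le> length P" "length P \<le> 3" "\<not> E (last P) (hd P)" for P
    proof (rule ccontr)
      assume "\<not> ?thesis"
      then have g: "good P" using P by (auto simp: good_def)
      have disj: "set P \<inter> set Q = {}" if "Q \<in> PS" for Q using that P(2) by (auto simp: D_def)
      have "P \<notin> PS" using disj[of P] P(3) by auto
      moreover have "?Q (insert P PS)"
      proof
        show "pairwise (\<lambda>P Q. set P \<inter> set Q = {}) (insert P PS)"
          using PS disj unfolding pairwise_insert by (simp add: Int_commute)
      qed (use PS g in simp)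
      then have "card (insert P PS) \<le> card PS" using max by blast
      ultimately show False using fin(1) by simp
    qed
    show "2 \<le> k" using few by simp
  qed (use finR irrefl no_cycle in auto)
  then show ?thesis ..
qed

text \<open>The cycles are built anew rather than by improving \<open>F\<close>. As degrees inside
  \<open>R1\<close> are at most 1, two vertices of \<open>R1\<close> without arcs between them have
  many connections of length 2 in both directions outside \<open>R1\<close>, enough for a cycle of
  length 4. Each cycle uses two vertices of \<open>R1\<close> and two others.\<close>

lemma greedy:
  assumes "residue E R R1 k" "j + 1 \<le> k"
  shows "\<exists>F'. short_fam E (V - Y) F' \<and> card F' = j \<and> card (\<Union>F' \<inter> R1) \<le> 2 * j \<and> card (\<Union>F' - R1) \<le> 2 * j"
  using assms(2)
proof (induction j)
  case 0
  then show ?case by (intro exI[of _ "{}"]) (simp add: short_fam_def)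
next
  case (Suc j)
  interpret residue E R R1 k by (rule assms(1))
  interpret r: residue "\<lambda>x y. E y x" R R1 k by (rule residue_rev)
  obtain F' where F': "short_fam E (V - Y) F'" "card F' = j" "card (\<Union>F' \<inter> R1) \<le> 2 * j" "card (\<Union>F' - R1) \<le> 2 * j"
    using Suc by auto
  have f': "fam E 3 F'" "\<Union>F' \<subseteq> V - Y" using F'(1) by (auto simp: short_fam_def)
  have finF': "finite (\<Union>F')" using fam_finite[OF f'(1)] .
  have R1V: "R1 \<subseteq> V" "R1 \<inter> Y = {}" using R1 by (auto simp: R_def)
  have "card (R1 - \<Union>F') = card R1 - card (\<Union>F' \<inter> R1)"
    using finR1 by (metis card_Diff_subset_Int finF' finite_Int inf_commute)
  then have large: "3 \<le> card (R1 - \<Union>F')" using F'(3) size Suc.prems by linarith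
  then obtain x where x: "x \<in> R1" "x \<notin> \<Union>F'" by (metis DiffE card.empty ex_in_conv not_numeral_le_zero)
  have "card ({x} \<union> {w \<in> R1. E x w}) \<le> 2"
    using card_Un_le[of "{x}" "{w \<in> R1. E x w}"] out_le_1[OF x(1)] by (simp add: outd_def)
  moreover have "finite ({x} \<union> {w \<in> R1. E x w})" using finR1 by auto
  ultimately have "\<not> R1 - \<Union>F' \<subseteq> {x} \<union> {w \<in> R1. E x w}"
    using card_mono[of "{x} \<union> {w \<in> R1. E x w}" "R1 - \<Union>F'"] large by linarith
  then obtain y where y: "y \<in> R1" "y \<notin> \<Union>F'" "y \<noteq> x" "\<not> E x y" by blast
  have nyx: "\<not> E y x" using sym[of x y] x y by auto
  define T where "T = Y \<union> (\<Union>F' - R1)"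
  define S where "S = V - R1 - T"
  have finT: "finite T" and finS: "finite S" using finY finF' finV by (auto simp: T_def S_def)
  have cT: "card T \<le> 5 + 2 * j" using F'(4) Y(2) card_Un_le[of Y "\<Union>F' - R1"] by (simp add: T_def)
  have TV: "T \<subseteq> V - R1" using Y R1V f'(2) by (auto simp: T_def)
  have dS: "outd E' V v = outd E' R1 v + outd E' T v + outd E' S v" for E' :: "'a \<Rightarrow> 'a \<Rightarrow> bool" and v
  proof -
    have "outd E' (V - R1) v = outd E' T v + outd E' S v"
      unfolding S_def using finV TV by (intro outd_split) auto
    then show ?thesis using outd_split[OF finV R1V(1), of E' v] by simp
  qed
  have cS: "card S + card R1 \<le> card V"
  proof -
    have "S \<inter> R1 = {}" "S \<union> R1 \<subseteq> V" using R1V(1) by (auto simp: S_def)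
    then show ?thesis
      using card_mono[OF finV, of "S \<union> R1"] card_Un_disjoint[OF finS finR1] by simp
  qed
  \<comment> \<open>Of at least \<open>card V\<close> arcs at most 2 stay in \<open>R1\<close> and
    at most \<open>2 * card T\<close> meet \<open>T\<close>; those left for \<open>S\<close> exceed
    \<open>card S\<close> by at least \<open>card R1 - 2 - 2 * card T\<close>.\<close>
  have common: "2 \<le> card {c \<in> S. E p c \<and> E c q}" if pq: "p \<in> R1" "q \<in> R1" "p \<noteq> q" "\<not> E p q" for p q
  proof -
    have "card V \<le> outd E V p + ind E V q" using ore pq R1V(1) by (auto simp: ore_def)
    moreover have "outd E S p + ind E S q = card ({c \<in> S. E p c} \<union> {c \<in> S. E c q}) +
        card ({c \<in> S. E p c} \<inter> {c \<in> S. E c q})"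
      unfolding outd_def using finS by (intro card_Un_Int) auto
    moreover have "card ({c \<in> S. E p c} \<union> {c \<in> S. E c q}) \<le> card S"
      using finS by (intro card_mono) auto
    moreover have "{c \<in> S. E p c} \<inter> {c \<in> S. E c q} = {c \<in> S. E p c \<and> E c q}" by auto
    ultimately show ?thesis
      using dS[of E p] dS[of "\<lambda>x y. E y x" q] out_le_1[OF pq(1)] r.out_le_1[OF pq(2)]
        outd_le[OF finT, of E p] outd_le[OF finT, of "\<lambda>x y. E y x" q] cT cS size Suc.prems
      by simp
  qed
  obtain c where c: "c \<in> S" "E x c" "E c y"
    using card_two_points[OF _ common[of x y], of x] x y finS by auto
  obtain d where d: "d \<in> S" "E y d" "E d x" "d \<noteq> c"
    using card_two_points[OF _ common[of y x], of c] x y nyx finS by auto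
  have dist: "distinct [x, c, y, d]" using x y c d by (auto simp: S_def)
  note cyc = dicyc4[OF c(2,3) d(2,3) dist]
  have sub: "set [x, c, y, d] \<inter> \<Union>F' = {}" "set [x, c, y, d] \<subseteq> V - Y"
    using x y c d R1V by (auto simp: S_def T_def)
  have l: "3 \<le> length [x, c, y, d]" by simp
  note i = fam_insert[OF f'(1) cyc l sub(1)]
  show ?case
  proof (intro exI conjI)
    show "short_fam E (V - Y) (insert (set [x, c, y, d]) F')"
      unfolding short_fam_def i(3) using i(1) F'(1) sub(2) dicyc_card[OF cyc] by (auto simp: short_fam_def)
    show "card (insert (set [x, c, y, d]) F') = Suc j" using i(2) F'(2) by simp
    have "\<Union>(insert (set [x, c, y, d]) F') \<inter> R1 = {x, y} \<union> (\<Union>F' \<inter> R1)"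
      unfolding i(3) using x y c(1) d(1) by (auto simp: S_def)
    then show "card (\<Union>(insert (set [x, c, y, d]) F') \<inter> R1) \<le> 2 * Suc j"
      using card_Un_le[of "{x, y}" "\<Union>F' \<inter> R1"] F'(3) y(3) by simp
    have "\<Union>(insert (set [x, c, y, d]) F') - R1 = {c, d} \<union> (\<Union>F' - R1)"
      unfolding i(3) using x y c(1) d(1) by (auto simp: S_def)
    then show "card (\<Union>(insert (set [x, c, y, d]) F') - R1) \<le> 2 * Suc j"
      using card_Un_le[of "{c, d}" "\<Union>F' - R1"] F'(4) d(4) by simp
  qed
qed

lemma contradiction: False
proof -
  obtain R1 where "residue E R R1 k" using residue_exists by auto
  then obtain F' where "short_fam E (V - Y) F'" "card F' = k - 1"
    using greedy[of R1 "k - 1"] few by auto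
  then show False using most few by fastforce
qed

end

lemma short_fam_exists:
  assumes "ore E V" "Y \<subseteq> V" "card Y \<le> 5" "12 * k + 3 \<le> card V"
  obtains F where "short_fam E (V - Y) F" "card F + 1 = k \<or> k = 0"
proof -
  let ?Q = "\<lambda>F. short_fam E (V - Y) F \<and> card F + 1 \<le> k"
  show ?thesis
  proof (cases "k = 0")
    case True
    then show ?thesis using that[of "{}"] by (simp add: short_fam_def)
  next
    case False
    then have "?Q {}" by (simp add: short_fam_def)
    moreover have "\<forall>F. ?Q F \<longrightarrow> card F < k" by simp
    ultimately obtain F where F: "?Q F" and max: "\<forall>F'. ?Q F' \<longrightarrow> card F' \<le> card F"
      using ex_has_greatest_nat[of ?Q "{}" card k] by blast
    show ?thesis
    proof (cases "card F + 1 = k")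
      case False
      have "packing E V Y k F"
      proof
        show "card F + 2 \<le> k" using F False by simp
        fix F' assume F': "short_fam E (V - Y) F'"
        show "card F' \<le> card F"
        proof (rule ccontr)
          assume "\<not> ?thesis"
          then have "Suc (card F) \<le> card F'" by simp
          then obtain G where G: "G \<subseteq> F'" "card G = Suc (card F)" by (meson obtain_subset_with_card_n)
          then have "?Q G" using F' F False fam_subset[of E 3 F' G] by (auto simp: short_fam_def)
          then show False using max G(2) by fastforce
        qed
      qed (use assms F in auto)
      then have False by (rule packing.contradiction)
      then show ?thesis ..
    qed (use F that in auto)
  qed
qed

section \<open>Cycle factors of digraphs\<close>

text \<open>The out-neighbours of \<open>x\<close> and the in-neighbours of \<open>y\<close> all
  avoid both \<open>x\<close> and \<open>y\<close>, so at least \<open>card V\<close> of them share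
  \<open>card V - 2\<close> places.\<close>

lemma two_common:
  assumes "ore E V" "x \<in> V" "y \<in> V" "x \<noteq> y" "\<not> E x y"
  shows "2 \<le> card {c \<in> V. E x c \<and> E c y}"
proof -
  have fin: "finite V" and irrefl: "\<And>x. \<not> E x x" using assms(1) by (auto simp: ore_def)
  have "card V \<le> outd E V x + ind E V y" using assms by (auto simp: ore_def)
  moreover have "outd E V x + ind E V y = card ({c \<in> V. E x c} \<union> {c \<in> V. E c y}) +
      card ({c \<in> V. E x c} \<inter> {c \<in> V. E c y})"
    unfolding outd_def using fin by (intro card_Un_Int) auto
  moreover have "card ({c \<in> V. E x c} \<union> {c \<in> V. E c y}) \<le> card (V - {x, y})"
    using fin irrefl assms(5) by (intro card_mono) auto
  moreover have "card (V - {x, y}) = card V - 2" using assms by (simp add: card_Diff_subset)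
  moreover have "2 \<le> card V" using card_mono[OF fin, of "{x, y}"] assms by simp
  ultimately have "2 \<le> card ({c \<in> V. E x c} \<inter> {c \<in> V. E c y})" by linarith
  moreover have "{c \<in> V. E x c} \<inter> {c \<in> V. E c y} = {c \<in> V. E x c \<and> E c y}" by auto
  ultimately show ?thesis by simp
qed

lemma two_out:
  assumes "ore E V" "x \<in> V" "3 \<le> card V"
  shows "2 \<le> card {c \<in> V. E x c}"
proof (cases "\<exists>y\<in>V. x \<noteq> y \<and> \<not> E x y")
  case True
  then obtain y where "2 \<le> card {c \<in> V. E x c \<and> E c y}" using two_common[OF assms(1,2)] by blast
  moreover have "card {c \<in> V. E x c \<and> E c y} \<le> card {c \<in> V. E x c}"
    using assms(1) by (intro card_mono) (auto simp: ore_def)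
  ultimately show ?thesis by linarith
next
  case False
  then have "card (V - {x}) \<le> card {c \<in> V. E x c}"
    using assms(1) by (intro card_mono) (auto simp: ore_def)
  then show ?thesis using assms(2,3) by simp
qed

text \<open>Each end has two candidates for its neighbour on the path, so an unwanted vertex can be
  avoided, and two chosen neighbours without an arc are linked by \<open>two_common\<close>. For
  \<open>a = b\<close> a single inner vertex would close a cycle of length 2 only, hence the extra
  condition.\<close>

lemma return_path:
  assumes ore: "ore E V" and V: "3 \<le> card V" and ab: "a \<in> V" "b \<in> V"
  obtains P where "dipath E P" "set P \<subseteq> V - {a, b}" "length P \<le> 3" "a = b \<Longrightarrow> 2 \<le> length P"
    "E a (hd P)" "E (last P) b"
proof -
  have fin: "finite V" and irrefl: "\<And>x. \<not> E x x" using ore by (auto simp: ore_def)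
  have "ore (\<lambda>x y. E y x) V" using ore ore_rev[of E V] by simp
  note in2 = two_out[OF this _ V]
  have "\<exists>y\<in>{c \<in> V. E a c}. y \<noteq> b"
    by (rule card_two_points) (use fin two_out[OF ore ab(1) V] in auto)
  then obtain y where y: "y \<in> V" "E a y" "y \<noteq> b" by auto
  \<comment> \<open>For \<open>a = b\<close>, avoiding \<open>y\<close> guarantees two inner
    vertices; otherwise \<open>a\<close> has to be avoided.\<close>
  have "\<exists>z\<in>{c \<in> V. E c b}. z \<noteq> (if a = b then y else a)"
    by (rule card_two_points) (use fin in2[OF ab(2)] in auto)
  then obtain z where z: "z \<in> V" "E z b" "z \<noteq> (if a = b then y else a)" by auto
  have ne: "y \<noteq> a" "z \<noteq> b" "z \<noteq> a" using y z irrefl by (auto split: if_splits)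
  consider "y = z" "a \<noteq> b" | "y \<noteq> z" "E y z" | "y \<noteq> z" "\<not> E y z" using z(3) by (auto split: if_splits)
  then show ?thesis
  proof cases
    case 1
    then show ?thesis using that[of "[y]"] y z ne by simp
  next
    case 2
    then show ?thesis using that[of "[y, z]"] y z ne by (simp add: dipath_def)
  next
    case 3
    have "\<exists>w\<in>{c \<in> V. E y c \<and> E c z}. w \<noteq> a"
      by (rule card_two_points) (use fin two_common[OF ore y(1) z(1) 3] in auto)
    then obtain w where w: "w \<in> V" "E y w" "E w z" "w \<noteq> a" by auto
    show ?thesis
    proof (cases "w = b")
      case True
      then show ?thesis using that[of "[y]"] y w ne by simp
    next
      case False
      have "w \<noteq> y" "w \<noteq> z" using w irrefl by auto
      then show ?thesis using that[of "[y, w, z]"] y z w ne 3 False by (simp add: dipath_def)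
    qed
  qed
qed

lemma hd_filter: "xs \<noteq> [] \<Longrightarrow> Q (hd xs) \<Longrightarrow> hd (filter Q xs) = hd xs"
  by (cases xs) auto

lemma last_filter: "xs \<noteq> [] \<Longrightarrow> Q (last xs) \<Longrightarrow> last (filter Q xs) = last xs"
  by (cases xs rule: rev_cases) auto

text \<open>Among the vertices of total degree less than \<open>card V\<close>, sorting by out-degree puts an arc
  from each vertex to all later ones, so they lie on a path even after deleting some of them.\<close>

lemma light_chain:
  assumes ore: "ore E V" and "V \<noteq> {}"
  obtains xs where "xs \<noteq> []" "distinct xs" "set xs \<subseteq> V" "sorted_wrt E xs"
    "\<And>v. v \<in> V \<Longrightarrow> v \<notin> set xs \<Longrightarrow> card V \<le> outd E V v + ind E V v"
proof -
  have fin: "finite V" using ore by (simp add: ore_def)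
  let ?L = "{v \<in> V. outd E V v + ind E V v < card V}"
  show ?thesis
  proof (cases "?L = {}")
    case True
    obtain u where "u \<in> V" using assms(2) by auto
    then show ?thesis using that[of "[u]"] True by (auto simp: not_less[symmetric])
  next
    case False
    obtain ys where ys: "set ys = ?L" "distinct ys" using finite_distinct_list[of ?L] fin by auto
    define xs where "xs = sort_key (outd E V) ys"
    have xs: "set xs = ?L" "distinct xs" using ys by (simp_all add: xs_def)
    have "sorted_wrt (\<lambda>x y. outd E V x \<le> outd E V y) xs"
      using sorted_sort_key[of "outd E V" ys] by (simp add: xs_def sorted_map)
    then have "sorted_wrt (\<lambda>x y. outd E V x \<le> outd E V y \<and> x \<noteq> y) xs"
      using xs(2) by (induction xs) auto
    then have "sorted_wrt E xs"
    proof (rule sorted_wrt_mono_rel[rotated])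
      fix x y assume "x \<in> set xs" "y \<in> set xs" and le: "outd E V x \<le> outd E V y \<and> x \<noteq> y"
      then have "x \<in> ?L" "y \<in> ?L" using xs(1) by auto
      then show "E x y" using ore le by (fastforce simp: ore_def)
    qed
    then show ?thesis using that[of xs] xs False by (force simp: not_less[symmetric])
  qed
qed

text \<open>The short cycles may use light vertices, since the chain stays a path after deletions.
  Only its two ends and the return path must survive, at most \<open>2 + 3\<close> vertices, and
  these form the set that \<open>short_fam_exists\<close> avoids.\<close>

lemma cover_light:
  assumes ore: "ore E V" and k: "1 \<le> k" and V: "12 * k + 3 \<le> card V"
  obtains F where "fam E 3 F" "card F = k" "\<Union>F \<subseteq> V"
    "\<And>v. v \<in> V - \<Union>F \<Longrightarrow> card V \<le> outd E V v + ind E V v"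
proof -
  have "V \<noteq> {}" using V k by auto
  obtain xs where xs: "xs \<noteq> []" "distinct xs" "set xs \<subseteq> V" "sorted_wrt E xs"
    and heavy: "\<And>v. v \<in> V \<Longrightarrow> v \<notin> set xs \<Longrightarrow> card V \<le> outd E V v + ind E V v"
    by (rule light_chain[OF ore \<open>V \<noteq> {}\<close>]) blast
  define a where "a = last xs"
  define b where "b = hd xs"
  have ab: "a \<in> set xs" "b \<in> set xs" using xs(1) by (auto simp: a_def b_def)
  then have abV: "a \<in> V" "b \<in> V" using xs(3) by auto
  have V3: "3 \<le> card V" using V by simp
  obtain P where P: "dipath E P" "set P \<subseteq> V - {a, b}" "length P \<le> 3" "a = b \<Longrightarrow> 2 \<le> length P"
    "E a (hd P)" "E (last P) b"
    by (rule return_path[OF ore V3 abV]) blast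
  let ?Y = "{a, b} \<union> set P"
  have "card ?Y \<le> card {a, b} + card (set P)" by (rule card_Un_le)
  also have "\<dots> \<le> 2 + 3" by (intro add_mono order_trans[OF card_length P(3)]) (simp add: card_insert_if)
  finally have "card ?Y \<le> 5" by simp
  moreover have "?Y \<subseteq> V" using abV P(2) by auto
  ultimately obtain F where F: "short_fam E (V - ?Y) F" "card F + 1 = k"
    using short_fam_exists[OF ore, of ?Y k] V k by (metis not_one_le_zero)
  have fam: "fam E 3 F" "\<Union>F \<subseteq> V - ?Y" using F(1) by (auto simp: short_fam_def)
  let ?Q = "\<lambda>v. v \<notin> \<Union>F \<and> v \<notin> set P"
  define ys where "ys = filter ?Q xs"
  have Q: "?Q a" "?Q b" using fam(2) P(2) by auto
  have ys: "hd ys = b" "last ys = a" "set ys \<subseteq> V" "a \<in> set ys" "b \<in> set ys"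
    using hd_filter[OF xs(1), of ?Q] last_filter[OF xs(1), of ?Q] Q ab xs(3)
    by (auto simp: ys_def a_def b_def)
  have "sorted_wrt E ys" using xs(4) by (simp add: ys_def sorted_wrt_filter)
  then have "successively E ys" by (rule successively_if_sorted_wrt)
  moreover have "ys \<noteq> []" using ys(4) by auto
  moreover have "distinct ys" using xs(2) by (simp add: ys_def)
  ultimately have path: "dipath E ys" by (simp add: dipath_def)
  have cyc: "dicyc E (ys @ P)"
    by (rule dicyc_appendI[OF path P(1)]) (use ys P(5,6) in \<open>auto simp: ys_def\<close>)
  have "3 \<le> length (ys @ P)"
  proof (cases "a = b")
    case True
    have "1 \<le> length ys" using ys(4) by (cases ys) auto
    then show ?thesis using P(4)[OF True] by simp
  next
    case False
    then have "card {a, b} \<le> card (set ys)" using ys(4,5) by (intro card_mono) auto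
    moreover have "1 \<le> length P" using P(1) by (cases P) (auto simp: dipath_def)
    ultimately show ?thesis using False card_length[of ys] by simp
  qed
  moreover have "set (ys @ P) \<inter> \<Union>F = {}" using fam(2) by (auto simp: ys_def)
  ultimately have i: "fam E 3 (insert (set (ys @ P)) F)" "card (insert (set (ys @ P)) F) = Suc (card F)"
    "\<Union>(insert (set (ys @ P)) F) = set (ys @ P) \<union> \<Union>F"
    using fam_insert[OF fam(1) cyc] by blast+
  show ?thesis
  proof (rule that[OF i(1)])
    show "card (insert (set (ys @ P)) F) = k" using i(2) F(2) by simp
    show "\<Union>(insert (set (ys @ P)) F) \<subseteq> V" unfolding i(3) using ys(3) P(2) fam(2) by auto
    fix v assume "v \<in> V - \<Union>(insert (set (ys @ P)) F)"
    then have "v \<in> V" "v \<notin> set (ys @ P)" "v \<notin> \<Union>F" unfolding i(3) by auto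
    then show "card V \<le> outd E V v + ind E V v" by (intro heavy) (auto simp: ys_def)
  qed
qed

theorem digraph_cycle_factor:
  assumes ore: "ore E V" and "1 \<le> k" "12 * k + 3 \<le> card V"
  obtains F where "fam E 3 F" "card F = k" "\<Union>F = V"
proof -
  obtain G where G: "fam E 3 G" "card G = k" "\<Union>G \<subseteq> V"
    and heavy: "\<And>v. v \<in> V - \<Union>G \<Longrightarrow> card V \<le> outd E V v + ind E V v"
    by (rule cover_light[OF assms]) blast
  obtain F where F: "fam E 3 F" "card F = card G" "\<Union>G \<subseteq> \<Union>F" "\<Union>F \<subseteq> V" "\<Union>F = V \<or> stuck E V 3 F"
    by (rule extend_maximal[OF ore G(1,3)]) auto
  show ?thesis
  proof (cases "\<Union>F = V")
    case False
    then interpret stuck E V 3 F using F(5) by simp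
    obtain nx where "\<And>C. C \<in> F \<Longrightarrow> \<exists>xs. cyc_next E nx C xs" using fam_next[OF F(1)] by metis
    then have "heavy E V F nx"
    proof unfold_locales
      show "F \<noteq> {}" using F(2) G(2) assms(2) by auto
      show "card V \<le> outd E V u + ind E V u" if "u \<in> H" for u
        using that F(3) by (intro heavy) (auto simp: H_def W_def)
      show "12 * card F + 3 \<le> card V" using F(2) G(2) assms(3) by simp
    qed
    then have False by (rule heavy.contradiction)
    then show ?thesis ..
  qed (use that F G in auto)
qed

section \<open>Contracting a perfect matching\<close>

definition mate :: "'a set set \<Rightarrow> 'a \<Rightarrow> 'a" where
  "mate M x = (THE y. {x, y} \<in> M)"

locale matched =
  fixes X Y :: "'a set" and E M :: "'a set set"
  assumes bip: "bipartite_graph X Y E" and pm: "perfect_matching (X \<union> Y) E M"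
    and eq: "card X = card Y"
begin

section \<open>Mates and the degrees in the contracted digraph\<close>

lemma finX: "finite X" and finY: "finite Y" and XY: "X \<inter> Y = {}"
  using bip by (auto simp: bipartite_graph_def)

lemma edgeE: assumes "e \<in> E" obtains x y where "x \<in> X" "y \<in> Y" "e = {x, y}"
  using bip assms by (auto simp: bipartite_graph_def)

lemma edge_unique: "e \<in> M \<Longrightarrow> e' \<in> M \<Longrightarrow> v \<in> e \<Longrightarrow> v \<in> e' \<Longrightarrow> v \<in> X \<union> Y \<Longrightarrow> e = e'"
  using pm unfolding perfect_matching_def by blast

lemma mate:
  assumes "x \<in> X" shows "{x, mate M x} \<in> M" "mate M x \<in> Y"
proof -
  obtain e where e: "e \<in> M" "x \<in> e" using pm assms unfolding perfect_matching_def by blast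
  then obtain x' y where xy: "x' \<in> X" "y \<in> Y" "e = {x', y}"
    using pm edgeE unfolding perfect_matching_def by blast
  then have "x' = x" using e(2) assms XY by auto
  then have y: "{x, y} \<in> M" using e xy by simp
  have "mate M x = y"
    unfolding mate_def
  proof (rule the_equality)
    fix z assume "{x, z} \<in> M"
    then have "{x, z} = {x, y}" using y assms by (intro edge_unique[of _ _ x]) auto
    then show "z = y" by (auto simp: doubleton_eq_iff)
  qed (rule y)
  then show "{x, mate M x} \<in> M" "mate M x \<in> Y" using y xy(2) by auto
qed

lemma mate_inj: "inj_on (mate M) X"
proof (rule inj_onI)
  fix x x' assume x: "x \<in> X" "x' \<in> X" "mate M x = mate M x'"
  then have "{x, mate M x} = {x', mate M x}"
    using mate[OF x(1)] mate[OF x(2)] by (intro edge_unique[of _ _ "mate M x"]) auto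
  then show "x = x'" by (auto simp: doubleton_eq_iff)
qed

lemma mate_image: "mate M ` X = Y"
  using mate(2) card_image[OF mate_inj] eq finY by (intro card_subset_eq) auto

lemma M_edge: assumes "e \<in> M" obtains x where "x \<in> X" "e = {x, mate M x}"
proof -
  obtain x y where xy: "x \<in> X" "y \<in> Y" "e = {x, y}"
    using pm edgeE assms unfolding perfect_matching_def by blast
  then have "e = {x, mate M x}" using assms mate(1) by (intro edge_unique[of _ _ x]) auto
  then show ?thesis using that xy(1) by blast
qed

text \<open>Contracting each matching edge to its end in \<open>X\<close> turns cycles alternating between
  matching and other edges into directed cycles.\<close>

definition arc :: "'a \<Rightarrow> 'a \<Rightarrow> bool" where
  "arc x x' \<longleftrightarrow> x \<noteq> x' \<and> {x, mate M x'} \<in> E"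

lemma M_sub: "M \<subseteq> E"
  using pm by (simp add: perfect_matching_def)

text \<open>The additional 1 is the matching edge at \<open>x\<close>, which contraction would turn
  into a loop and \<open>arc\<close> excludes.\<close>

lemma degree_X:
  assumes "x \<in> X" shows "degree E x = outd arc X x + 1"
proof -
  have "{e \<in> E. x \<in> e} = (\<lambda>x'. {x, mate M x'}) ` insert x {x' \<in> X. arc x x'}"
  proof (intro set_eqI iffI)
    fix e assume "e \<in> {e \<in> E. x \<in> e}"
    then obtain x1 y where e: "e \<in> E" "x \<in> e" "x1 \<in> X" "y \<in> Y" "e = {x1, y}" using edgeE by blast
    then have "x1 = x" using assms XY by auto
    moreover obtain x' where "x' \<in> X" "y = mate M x'" using e(4) mate_image by auto
    ultimately show "e \<in> (\<lambda>x'. {x, mate M x'}) ` insert x {x' \<in> X. arc x x'}"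
      using e(1,5) by (cases "x' = x") (auto simp: arc_def)
  qed (use mate(1)[OF assms] M_sub in \<open>auto simp: arc_def\<close>)
  moreover have "inj_on (\<lambda>x'. {x, mate M x'}) (insert x {x' \<in> X. arc x x'})"
  proof (rule inj_onI)
    fix u v assume uv: "u \<in> insert x {x' \<in> X. arc x x'}" "v \<in> insert x {x' \<in> X. arc x x'}"
      "{x, mate M u} = {x, mate M v}"
    then have "mate M u = mate M v" by (auto simp: doubleton_eq_iff)
    then show "u = v" using uv(1,2) assms mate_inj by (auto dest: inj_onD)
  qed
  ultimately have "degree E x = card (insert x {x' \<in> X. arc x x'})"
    unfolding degree_def by (simp only: card_image)
  then show ?thesis using finX by (simp add: outd_def arc_def)
qed

lemma degree_Y:
  assumes "x \<in> X" shows "degree E (mate M x) = ind arc X x + 1"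
proof -
  let ?y = "mate M x"
  have y: "?y \<in> Y" "?y \<notin> X" using mate(2)[OF assms] XY by auto
  have "{e \<in> E. ?y \<in> e} = (\<lambda>x'. {x', ?y}) ` insert x {x' \<in> X. arc x' x}"
  proof (intro set_eqI iffI)
    fix e assume "e \<in> {e \<in> E. ?y \<in> e}"
    then obtain x1 y where e: "e \<in> E" "?y \<in> e" "x1 \<in> X" "y \<in> Y" "e = {x1, y}" using edgeE by blast
    then have "y = ?y" using y(2) by auto
    then show "e \<in> (\<lambda>x'. {x', ?y}) ` insert x {x' \<in> X. arc x' x}"
      using e(1,3,5) by (cases "x1 = x") (auto simp: arc_def)
  qed (use mate(1)[OF assms] M_sub in \<open>auto simp: arc_def\<close>)
  moreover have "inj_on (\<lambda>x'. {x', ?y}) (insert x {x' \<in> X. arc x' x})"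
    by (auto simp: inj_on_def doubleton_eq_iff)
  ultimately have "degree E ?y = card (insert x {x' \<in> X. arc x' x})"
    unfolding degree_def by (simp only: card_image)
  then show ?thesis using finX by (simp add: outd_def arc_def)
qed

lemma arc_ore:
  assumes "sigma11 X Y E \<ge> enat (card X + 2)" shows "ore arc X"
  unfolding ore_def
proof (intro conjI ballI allI impI finX)
  show "\<not> arc x x" for x by (simp add: arc_def)
  fix x x' assume x: "x \<in> X" "x' \<in> X" "x \<noteq> x'" "\<not> arc x x'"
  let ?S = "{degree E x + degree E y | x y. x \<in> X \<and> y \<in> Y \<and> {x, y} \<notin> E}"
  have ne: "{x, mate M x'} \<notin> E" "mate M x' \<in> Y" using x mate(2) by (auto simp: arc_def)
  then have "sigma11 X Y E = enat (Min ?S)" using x(1) unfolding sigma11_def by auto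
  then have "card X + 2 \<le> Min ?S" using assms by simp
  also have "\<dots> \<le> degree E x + degree E (mate M x')"
  proof (rule Min_le)
    have "?S \<subseteq> (\<lambda>(x, y). degree E x + degree E y) ` (X \<times> Y)" by auto
    then show "finite ?S" using finX finY finite_subset by blast
    show "degree E x + degree E (mate M x') \<in> ?S" using x(1) ne by blast
  qed
  finally show "card X \<le> outd arc X x + ind arc X x'"
    using degree_X[OF x(1)] degree_Y[OF x(2)] by simp
qed

text \<open>Each vertex is preceded by its mate: positions \<open>2 * i\<close> and
  \<open>2 * i + 1\<close> hold a matching edge, and the step to the next even position is the edge
  behind an arc.\<close>

definition expand :: "'a list \<Rightarrow> 'a list" where
  "expand xs = map (\<lambda>i. if even i then mate M (xs ! (i div 2)) else xs ! (i div 2)) [0..<2 * length xs]"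

lemma length_expand [simp]: "length (expand xs) = 2 * length xs"
  by (simp add: expand_def)

lemma nth_expand:
  "i < length xs \<Longrightarrow> expand xs ! (2 * i) = mate M (xs ! i)"
  "i < length xs \<Longrightarrow> expand xs ! (2 * i + 1) = xs ! i"
  by (simp_all add: expand_def)

lemma less_double_cases:
  assumes "i < 2 * (l :: nat)"
  obtains j where "j < l" "i = 2 * j" | j where "j < l" "i = 2 * j + 1"
  using assms by (cases "even i") (auto elim!: evenE oddE)

lemma set_expand: "set (expand xs) = set xs \<union> mate M ` set xs"
proof (intro set_eqI iffI)
  fix v assume "v \<in> set (expand xs)"
  then obtain i where "i < 2 * length xs" "v = expand xs ! i" by (auto simp: in_set_conv_nth)
  then show "v \<in> set xs \<union> mate M ` set xs"
    by (cases rule: less_double_cases) (auto simp: nth_expand simp del: One_nat_def Suc_eq_plus1)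
next
  fix v assume "v \<in> set xs \<union> mate M ` set xs"
  then obtain i where i: "i < length xs" "v = xs ! i \<or> v = mate M (xs ! i)"
    by (auto simp: in_set_conv_nth)
  then have "v = expand xs ! (2 * i + 1) \<or> v = expand xs ! (2 * i)" using nth_expand by simp
  moreover have "2 * i + 1 < length (expand xs)" "2 * i < length (expand xs)" using i(1) by auto
  ultimately show "v \<in> set (expand xs)" by (metis nth_mem)
qed

lemma distinct_expand:
  assumes "distinct xs" "set xs \<subseteq> X" shows "distinct (expand xs)"
proof -
  have "card (set xs \<union> mate M ` set xs) = card (set xs) + card (mate M ` set xs)"
    using assms(2) mate(2) XY by (intro card_Un_disjoint) auto
  also have "card (mate M ` set xs) = card (set xs)"
    using mate_inj assms(2) by (intro card_image) (rule inj_on_subset)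
  finally have "card (set (expand xs)) = length (expand xs)"
    using distinct_card[OF assms(1)] by (simp add: set_expand)
  then show ?thesis by (rule card_distinct)
qed

lemma edges_expand:
  "cycle_edges (expand xs) =
    {{xs ! j, mate M (xs ! j)} | j. j < length xs} \<union>
    {{xs ! j, mate M (xs ! (Suc j mod length xs))} | j. j < length xs}" (is "_ = ?A \<union> ?B")
proof -
  let ?e = "\<lambda>i. {expand xs ! i, expand xs ! ((i + 1) mod length (expand xs))}"
  have even: "?e (2 * j) = {xs ! j, mate M (xs ! j)}" if j: "j < length xs" for j
    using j nth_expand[OF j] by (simp add: insert_commute)
  have odd: "?e (2 * j + 1) = {xs ! j, mate M (xs ! (Suc j mod length xs))}" if j: "j < length xs" for j
  proof -
    have "(2 * j + 1 + 1) mod (2 * length xs) = 2 * (Suc j mod length xs)"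
      using mult_mod_right[of 2 "Suc j" "length xs"] by simp
    moreover have "Suc j mod length xs < length xs" using j by (intro mod_less_divisor) auto
    ultimately show ?thesis using nth_expand(2)[OF j] nth_expand(1) by simp
  qed
  show ?thesis
  proof (intro set_eqI iffI)
    fix e assume "e \<in> cycle_edges (expand xs)"
    then obtain i where "i < 2 * length xs" "e = ?e i" by (auto simp: cycle_edges_def)
    then show "e \<in> ?A \<union> ?B"
    proof (cases rule: less_double_cases)
      case (1 j) then show ?thesis using even[OF 1(1)] \<open>e = ?e i\<close> by blast
    next
      case (2 j) then show ?thesis using odd[OF 2(1)] \<open>e = ?e i\<close> by blast
    qed
  next
    fix e assume "e \<in> ?A \<union> ?B"
    then obtain j where j: "j < length xs" "e = ?e (2 * j) \<or> e = ?e (2 * j + 1)"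
      using even odd by blast
    then have "2 * j < length (expand xs)" "2 * j + 1 < length (expand xs)" by auto
    with j(2) show "e \<in> cycle_edges (expand xs)" unfolding cycle_edges_def by blast
  qed
qed

lemma dicyc_nth:
  assumes "dicyc D xs" "2 \<le> length xs" "j < length xs"
  shows "D (xs ! j) (xs ! (Suc j mod length xs))"
proof (cases "Suc j < length xs")
  case True
  then show ?thesis using assms(1) by (simp add: dicyc_def dipath_def successively_conv_nth)
next
  case False
  then have "Suc j = length xs" using assms(3) by simp
  moreover have "xs \<noteq> []" using assms(2) by auto
  ultimately have "xs ! j = last xs" "xs ! (Suc j mod length xs) = hd xs"
    by (auto simp: last_conv_nth hd_conv_nth simp flip: \<open>Suc j = length xs\<close>)
  then show ?thesis using assms(1,2) by (simp add: dicyc_def)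
qed

lemma cycle_expand:
  assumes "dicyc arc xs" "3 \<le> length xs" "set xs \<subseteq> X"
  shows "is_cycle E (expand xs)"
  unfolding is_cycle_def
proof (intro conjI)
  show "distinct (expand xs)" by (rule distinct_expand[OF dipath_distinct[OF dicyc_dipath[OF assms(1)]] assms(3)])
  show "3 \<le> length (expand xs)" using assms(2) by simp
  have "{xs ! j, mate M (xs ! j)} \<in> E" if "j < length xs" for j
    using that assms(3) mate(1) M_sub nth_mem by blast
  moreover have "{xs ! j, mate M (xs ! (Suc j mod length xs))} \<in> E" if "j < length xs" for j
    using dicyc_nth[OF assms(1) _ that] assms(2) by (simp add: arc_def)
  ultimately show "cycle_edges (expand xs) \<subseteq> E" unfolding edges_expand by blast
qed

end

theorem theorem2:
  fixes X Y :: "'a set" and E M :: "'a set set" and k n :: nat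
  assumes "k > 0"
    and "bipartite_graph X Y E"
    and "card X = n" and "card Y = n"
    and "perfect_matching (X \<union> Y) E M"
    and "n \<ge> 12 * k + 3"
    and "sigma11 X Y E \<ge> enat (n + 2)"
  shows "\<exists>Cs. two_factor (X \<union> Y) E Cs \<and> length Cs = k \<and>
           (\<forall>c\<in>set Cs. length c \<ge> 6) \<and> M \<subseteq> (\<Union>c\<in>set Cs. cycle_edges c)"
proof -
  interpret matched X Y E M using assms by unfold_locales auto
  have "ore arc X" using assms(3,7) arc_ore by simp
  then obtain F where F: "fam arc 3 F" "card F = k" "\<Union>F = X"
    by (rule digraph_cycle_factor[of arc X k]) (use assms in auto)
  have "\<forall>C\<in>F. \<exists>xs. dicyc arc xs \<and> set xs = C" using F(1) by (auto simp: fam_def hcyc_def)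
  then obtain f where f: "\<And>C. C \<in> F \<Longrightarrow> dicyc arc (f C) \<and> set (f C) = C" by metis
  have len: "3 \<le> length (f C)" if "C \<in> F" for C
    using F(1) that f[OF that] dicyc_card[of arc "f C"] by (auto simp: fam_def)
  obtain Fs where Fs: "set Fs = F" "distinct Fs"
    using F(1) finite_distinct_list by (auto simp: fam_def)
  have sub: "C \<subseteq> X" if "C \<in> F" for C using that F(3) by auto
  have set_f: "set (expand (f C)) = C \<union> mate M ` C" if "C \<in> F" for C
    using f[OF that] by (simp add: set_expand)
  define Cs where "Cs = map (\<lambda>C. expand (f C)) Fs"
  show ?thesis
  proof (intro exI[of _ Cs] conjI)
    show "two_factor (X \<union> Y) E Cs"
      unfolding two_factor_def
    proof (intro conjI allI impI ballI)
      show "is_cycle E c" if "c \<in> set Cs" for c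
        using that Fs(1) f len sub cycle_expand by (auto simp: Cs_def)
      fix i j assume ij: "i < length Cs" "j < length Cs" "i \<noteq> j"
      then have mem: "Fs ! i \<in> F" "Fs ! j \<in> F" and ne: "Fs ! i \<noteq> Fs ! j"
        using Fs nth_eq_iff_index_eq by (auto simp: Cs_def)
      have d: "Fs ! i \<inter> Fs ! j = {}" by (rule fam_disj[OF F(1) mem ne])
      then have "mate M ` (Fs ! i) \<inter> mate M ` (Fs ! j) = {}"
        using inj_on_image_Int[OF mate_inj sub[OF mem(1)] sub[OF mem(2)]] by simp
      moreover have "C \<inter> mate M ` D = {}" if "C \<in> F" "D \<in> F" for C D
        using mate(2) XY sub[OF that(1)] sub[OF that(2)] by auto
      ultimately have "(Fs ! i \<union> mate M ` (Fs ! i)) \<inter> (Fs ! j \<union> mate M ` (Fs ! j)) = {}"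
        using d mem unfolding Int_Un_distrib Int_Un_distrib2 by (simp add: Int_commute)
      then show "set (Cs ! i) \<inter> set (Cs ! j) = {}"
        using ij set_f[OF mem(1)] set_f[OF mem(2)] by (simp add: Cs_def)
    next
      have "(\<Union>c\<in>set Cs. set c) = (\<Union>C\<in>F. set (expand (f C)))" by (simp add: Cs_def Fs(1))
      also have "\<dots> = (\<Union>C\<in>F. C \<union> mate M ` C)" using set_f by (rule SUP_cong[OF refl])
      also have "\<dots> = \<Union>F \<union> mate M ` \<Union>F" by (simp add: UN_Un_distrib image_Union)
      finally show "(\<Union>c\<in>set Cs. set c) = X \<union> Y" using F(3) mate_image by simp
    qed
    show "length Cs = k" using Fs(1) F(2) distinct_card[OF Fs(2)] by (simp add: Cs_def)
    have "6 \<le> length (expand (f C))" if "C \<in> F" for C using len[OF that] by simp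
    then show "\<forall>c\<in>set Cs. length c \<ge> 6" by (simp add: Cs_def Fs(1))
    show "M \<subseteq> (\<Union>c\<in>set Cs. cycle_edges c)"
    proof
      fix e assume "e \<in> M"
      then obtain x where x: "x \<in> X" "e = {x, mate M x}" by (rule M_edge)
      then obtain C where C: "C \<in> F" "x \<in> set (f C)" using F(3) f by blast
      then obtain j where "j < length (f C)" "x = f C ! j" by (auto simp: in_set_conv_nth)
      then have "e \<in> cycle_edges (expand (f C))" unfolding edges_expand using x(2) by blast
      then show "e \<in> (\<Union>c\<in>set Cs. cycle_edges c)" using C(1) Fs(1) by (auto simp: Cs_def)
    qed
  qed
qed

end
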